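(* Let $(B(t))_{t\in\mathbb{Z}}$ be a centered complex-valued wide sense stationary sequence with spectral measure $\mu$ on $[-\pi,\pi)$, and let $f_a$ be the density (with respect to Lebesgue measure) of the absolutely continuous component of $\mu$. Let $L$ be a linear filter with measurable frequency characteristic $\ell:[-\pi,\pi)\to\mathbb{C}$. Then for every fixed $t\in\mathbb{Z}$ the equality $\sigma^2(t)=\sigma^2(\infty)$ holds if and only if either $$\int_{-\pi}^{\pi}|\ln f_a(u)|\,du=\infty,$$ or $$\int_{-\pi}^{\pi}|\ln f_a(u)|\,du<\infty$$ and the function $\frac{1}{1+|\ell(u)|^2}$ is, Lebesgue-a.e., a trigonometric polynomial of degree not exceeding $t$, i.e. $\frac{1}{1+|\ell(u)|^2}=\sum_{|j|\le t}b_j e^{iju}$ for Lebesgue-a.e. $u\in[-\pi,\pi)$ with some coefficients $b_j\in\mathbb{C}$.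
   Context: A centered complex-valued sequence $(B(t))_{t\in\mathbb{Z}}$ is wide sense stationary if $\mathbb{E}B(t)=0$, $\mathbb{E}|B(t)|^2<\infty$ and $\mathbb{E}B(t+s)\overline{B(s)}=:K(t)$ does not depend on $s$. Its spectral measure is the finite measure $\mu$ on $[-\pi,\pi)$ with $K(t)=\int_{-\pi}^{\pi} e^{itu}\mu(du)$; one has $B(t)=\int e^{itu}\,\mathcal{W}(du)$ with an orthogonal random measure $\mathcal{W}$, $\mathbb{E}|\mathcal{W}(A)|^2=\mu(A)$. $H$ is the closed linear span of $\{B(s):s\in\mathbb{Z}\}$ in the Hilbert space of square integrable random variables, and $H_t$ is the closed linear span of $\{B(s):s\le t\}$. The stochastic integral $\phi\mapsto\int\phi\,d\mathcal{W}$ is a linear isometry of $L_2(\mu)$ onto $H$; for $\xi\in H$ write $\xi=\int\phi_\xi\,d\mathcal{W}$. The linear filter $L$ with frequency characteristic $\ell$ is $L\xi=\int\ell(u)\phi_\xi(u)\,\mathcal{W}(du)$ with domain $\mathcal{D}(L)=\{\xi\in H:\int|\ell\phi_\xi|^2d\mu<\infty\}$. The prediction errors are $$\sigma^2(t):=\inf_{Y\in H_t\cap\mathcal{D}(L)}\{\mathbb{E}|Y-B(0)|^2+\mathbb{E}|LY|^2\},\quad t\in\mathbb{Z},$$ and $\sigma^2(\infty)$ is the same quantity with $H_t$ replaced by $H$. Convention: $|\ln 0|=\infty$. For $t<0$ the sum over $|j|\le t$ is empty (equal to $0$). *)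

theory Defs
  imports "HOL-Probability.Probability"
begin

text \<open>Square integrable functions. Elements are functions rather than classes modulo null sets,
  so equality in $L_2$ is equality almost everywhere, i.e. mean square distance zero.\<close>

definition L2 :: "'a measure \<Rightarrow> ('a \<Rightarrow> complex) set" where
  "L2 M = {f \<in> borel_measurable M. integrable M (\<lambda>x. (cmod (f x))\<^sup>2)}"

definition sqnorm :: "'a measure \<Rightarrow> ('a \<Rightarrow> complex) \<Rightarrow> real" where
  "sqnorm M f = (\<integral>x. (cmod (f x))\<^sup>2 \<partial>M)"

definition wide_sense_stationary :: "'a measure \<Rightarrow> (int \<Rightarrow> 'a \<Rightarrow> complex) \<Rightarrow> bool" where
  "wide_sense_stationary M B \<longleftrightarrow>
     (\<forall>t. B t \<in> L2 M) \<and>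
     (\<forall>t. (\<integral>x. B t x \<partial>M) = 0) \<and>
     (\<forall>t s s'. (\<integral>x. B (t + s) x * cnj (B s x) \<partial>M) = (\<integral>x. B (t + s') x * cnj (B s' x) \<partial>M))"

text \<open>Every $s$ gives the same value for a wide sense stationary sequence; we take $s = 0$.\<close>

definition covariance :: "'a measure \<Rightarrow> (int \<Rightarrow> 'a \<Rightarrow> complex) \<Rightarrow> int \<Rightarrow> complex" where
  "covariance M B t = (\<integral>x. B t x * cnj (B 0 x) \<partial>M)"

text \<open>Lebesgue measure on the Borel sets of $[-\pi,\pi)$.\<close>

definition leb_circ :: "real measure" where
  "leb_circ = restrict_space lborel {-pi..<pi}"

definition spectral_measure :: "'a measure \<Rightarrow> (int \<Rightarrow> 'a \<Rightarrow> complex) \<Rightarrow> real measure \<Rightarrow> bool" where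
  "spectral_measure M B \<mu> \<longleftrightarrow>
     finite_measure \<mu> \<and> sets \<mu> = sets leb_circ \<and>
     (\<forall>t. covariance M B t = (\<integral>u. cis (of_int t * u) \<partial>\<mu>))"

text \<open>Lebesgue decomposition: \<open>f\<close> is a (finite, nonnegative) version of the density of the absolutely
  continuous component, and \<open>\<nu>\<close> is the singular component.\<close>

definition abs_cont_density :: "real measure \<Rightarrow> (real \<Rightarrow> real) \<Rightarrow> bool" where
  "abs_cont_density \<mu> f \<longleftrightarrow>
     f \<in> borel_measurable leb_circ \<and> (\<forall>u \<in> space leb_circ. 0 \<le> f u) \<and>
     (\<exists>\<nu> N. sets \<nu> = sets leb_circ \<and>
        N \<in> sets leb_circ \<and> emeasure leb_circ N = 0 \<and> emeasure \<nu> (space leb_circ - N) = 0 \<and>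
        (\<forall>A \<in> sets leb_circ.
           emeasure \<mu> A = emeasure (density leb_circ (\<lambda>u. ennreal (f u))) A + emeasure \<nu> A))"

text \<open>$|\ln x|$ with $|\ln 0| = \infty$; note that HOL has \<open>ln 0 = 0\<close>.\<close>

definition abs_ln :: "real \<Rightarrow> ennreal" where
  "abs_ln x = (if x = 0 then \<infinity> else ennreal \<bar>ln x\<bar>)"

text \<open>Countable additivity in mean square follows from finite additivity together with
  $\mathbb{E}|\mathcal{W}(A)|^2 = \mu(A)$ and the countable additivity of $\mu$.\<close>

definition orthogonal_random_measure ::
    "'a measure \<Rightarrow> real measure \<Rightarrow> (real set \<Rightarrow> 'a \<Rightarrow> complex) \<Rightarrow> bool" where
  "orthogonal_random_measure M \<mu> W \<longleftrightarrow>
     (\<forall>A \<in> sets \<mu>. W A \<in> L2 M \<and> sqnorm M (W A) = measure \<mu> A) \<and>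
     (\<forall>A \<in> sets \<mu>. \<forall>C \<in> sets \<mu>. A \<inter> C = {} \<longrightarrow>
        (AE x in M. W (A \<union> C) x = W A x + W C x) \<and>
        (\<integral>x. W A x * cnj (W C x) \<partial>M) = 0)"

definition simple_stoch_integral ::
    "real measure \<Rightarrow> (real set \<Rightarrow> 'a \<Rightarrow> complex) \<Rightarrow> (real \<Rightarrow> complex) \<Rightarrow> 'a \<Rightarrow> complex" where
  "simple_stoch_integral \<mu> W \<phi> x =
     (\<Sum>y \<in> \<phi> ` space \<mu>. y * W (\<phi> -` {y} \<inter> space \<mu>) x)"

text \<open>\<open>\<xi> = \<integral> \<phi> dW\<close>, defined by mean square approximation with simple functions.\<close>

definition has_stoch_integral ::
    "'a measure \<Rightarrow> real measure \<Rightarrow> (real set \<Rightarrow> 'a \<Rightarrow> complex) \<Rightarrow>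
     (real \<Rightarrow> complex) \<Rightarrow> ('a \<Rightarrow> complex) \<Rightarrow> bool" where
  "has_stoch_integral M \<mu> W \<phi> \<xi> \<longleftrightarrow>
     \<phi> \<in> L2 \<mu> \<and> \<xi> \<in> L2 M \<and>
     (\<exists>s. (\<forall>n::nat. simple_function \<mu> (s n) \<and> s n \<in> L2 \<mu>) \<and>
        (\<lambda>n. sqnorm \<mu> (\<lambda>u. s n u - \<phi> u)) \<longlonglongrightarrow> 0 \<and>
        (\<lambda>n. sqnorm M (\<lambda>x. simple_stoch_integral \<mu> W (s n) x - \<xi> x)) \<longlonglongrightarrow> 0)"

text \<open>The next two choices are unique up to null sets of \<open>M\<close> and \<open>\<mu>\<close> respectively, since the
  stochastic integral is an isometry.\<close>

definition stoch_integral ::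
    "'a measure \<Rightarrow> real measure \<Rightarrow> (real set \<Rightarrow> 'a \<Rightarrow> complex) \<Rightarrow> (real \<Rightarrow> complex) \<Rightarrow> 'a \<Rightarrow> complex" where
  "stoch_integral M \<mu> W \<phi> = (SOME \<xi>. has_stoch_integral M \<mu> W \<phi> \<xi>)"

definition spectral_fun ::
    "'a measure \<Rightarrow> real measure \<Rightarrow> (real set \<Rightarrow> 'a \<Rightarrow> complex) \<Rightarrow> ('a \<Rightarrow> complex) \<Rightarrow> real \<Rightarrow> complex" where
  "spectral_fun M \<mu> W \<xi> = (SOME \<phi>. has_stoch_integral M \<mu> W \<phi> \<xi>)"

definition spectral_representation ::
    "'a measure \<Rightarrow> (int \<Rightarrow> 'a \<Rightarrow> complex) \<Rightarrow> real measure \<Rightarrow> (real set \<Rightarrow> 'a \<Rightarrow> complex) \<Rightarrow> bool" where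
  "spectral_representation M B \<mu> W \<longleftrightarrow>
     orthogonal_random_measure M \<mu> W \<and>
     (\<forall>t. has_stoch_integral M \<mu> W (\<lambda>u. cis (of_int t * u)) (B t))"

text \<open>Closed linear span in $L_2$ of \<open>{B s | s \<in> S}\<close>. In particular $H$ is
  \<open>closed_span M B UNIV\<close> and $H_t$ is \<open>closed_span M B {..t}\<close>.\<close>

definition closed_span :: "'a measure \<Rightarrow> (int \<Rightarrow> 'a \<Rightarrow> complex) \<Rightarrow> int set \<Rightarrow> ('a \<Rightarrow> complex) set" where
  "closed_span M B S =
     {\<xi> \<in> L2 M. \<forall>\<epsilon>>0. \<exists>F c. finite F \<and> F \<subseteq> S \<and>
        sqnorm M (\<lambda>x. \<xi> x - (\<Sum>s\<in>F. c s * B s x)) < \<epsilon>}"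

definition linear_filter ::
    "'a measure \<Rightarrow> real measure \<Rightarrow> (real set \<Rightarrow> 'a \<Rightarrow> complex) \<Rightarrow> (real \<Rightarrow> complex) \<Rightarrow>
     ('a \<Rightarrow> complex) \<Rightarrow> 'a \<Rightarrow> complex" where
  "linear_filter M \<mu> W \<l> \<xi> = stoch_integral M \<mu> W (\<lambda>u. \<l> u * spectral_fun M \<mu> W \<xi> u)"

definition filter_domain ::
    "'a measure \<Rightarrow> (int \<Rightarrow> 'a \<Rightarrow> complex) \<Rightarrow> real measure \<Rightarrow> (real set \<Rightarrow> 'a \<Rightarrow> complex) \<Rightarrow>
     (real \<Rightarrow> complex) \<Rightarrow> ('a \<Rightarrow> complex) set" where
  "filter_domain M B \<mu> W \<l> =
     {\<xi> \<in> closed_span M B UNIV. integrable \<mu> (\<lambda>u. (cmod (\<l> u * spectral_fun M \<mu> W \<xi> u))\<^sup>2)}"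

text \<open>The infimum over predictors built from the observations \<open>B s\<close>, \<open>s \<in> S\<close>.\<close>

definition pred_error ::
    "'a measure \<Rightarrow> (int \<Rightarrow> 'a \<Rightarrow> complex) \<Rightarrow> real measure \<Rightarrow> (real set \<Rightarrow> 'a \<Rightarrow> complex) \<Rightarrow>
     (real \<Rightarrow> complex) \<Rightarrow> int set \<Rightarrow> real" where
  "pred_error M B \<mu> W \<l> S =
     (INF Y \<in> closed_span M B S \<inter> filter_domain M B \<mu> W \<l>.
        sqnorm M (\<lambda>x. Y x - B 0 x) + sqnorm M (linear_filter M \<mu> W \<l> Y))"

definition sigma2 ::
    "'a measure \<Rightarrow> (int \<Rightarrow> 'a \<Rightarrow> complex) \<Rightarrow> real measure \<Rightarrow> (real set \<Rightarrow> 'a \<Rightarrow> complex) \<Rightarrow>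
     (real \<Rightarrow> complex) \<Rightarrow> int \<Rightarrow> real" where
  "sigma2 M B \<mu> W \<l> t = pred_error M B \<mu> W \<l> {..t}"

definition sigma2_inf ::
    "'a measure \<Rightarrow> (int \<Rightarrow> 'a \<Rightarrow> complex) \<Rightarrow> real measure \<Rightarrow> (real set \<Rightarrow> 'a \<Rightarrow> complex) \<Rightarrow>
     (real \<Rightarrow> complex) \<Rightarrow> real" where
  "sigma2_inf M B \<mu> W \<l> = pred_error M B \<mu> W \<l> UNIV"

end

theory Submission
  imports Defs "HOL-Complex_Analysis.Complex_Analysis"
begin

text \<open>
  By the isometry between random variables in $H$ and their spectral functions in \<open>L2 \<mu>\<close>, both
  prediction errors become infima of
  $\int |\phi - 1|^2 + |\ell\phi|^2 d\mu$, over all \<open>\<phi>\<close> for $\sigma^2(\infty)$, and over the closed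
  span \<open>A t\<close> of the characters $e^{isu}$ with $s \le t$ for $\sigma^2(t)$ (\<open>pred_error_spectral\<close>).
  Completing the square, the integrand is $|\ell|^2/w + w\,|\phi - 1/w|^2$ with $w = 1+|\ell|^2$. So
  $\phi^* = 1/w$ is the minimiser without restriction on the past, and the errors agree exactly when
  $\phi^*$, a bounded real function, belongs to \<open>A t\<close> (\<open>pred_error_eq_iff\<close>).

  Whether $\phi^* \in$ \<open>A t\<close> is decided with entire functions $P$. For every entire $F$, the function
  $u \mapsto F(e^{-iu})$ is a uniform limit of polynomials in $e^{-iu}$, and its mean over the circle is
  $F(0)$. Nonnegative integrable functions are limits in mean of nonnegative real parts of entire functions
  (\<open>entire_L1_approx\<close>), so $e^{\pm P}$ is an element of the past whose modulus may be prescribed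
  approximately and whose mean is the geometric mean of that modulus. In this way outer functions,
  and with them boundary values and conjugate functions, are replaced by approximations. Three choices
  of the modulus give the theorem; \<open>f\<close> denotes the density of the absolutely continuous component.

  \<^item> If \<open>ln f\<close> is not integrable, $|e^{P}|^2 \approx 1/f$ where \<open>f\<close> is small makes
    $1 - e^{P-P(0)}$, which has mean zero and so involves only negative frequencies, as close to 1
    in \<open>L2 \<mu>\<close> as desired (\<open>Szego_degenerate\<close>). Hence \<open>A t\<close> is all of \<open>L2 \<mu>\<close> for every \<open>t\<close>.
  \<^item> If $N$ is a Lebesgue null set, a modulus that is small on $N$ and one elsewhere shows that the
    indicator of $N$ is a limit of trigonometric polynomials with negative frequencies
    (\<open>null_set_predictable\<close>). Hence all functions supported on $N$ belong to every \<open>A t\<close>; so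
    a function equal to a trigonometric polynomial of degree at most \<open>t\<close> Lebesgue almost everywhere
    is in \<open>A t\<close>.
  \<^item> If \<open>ln f\<close> is integrable, a modulus bounded by a multiple of $\sqrt f$ and equal to one on
    most of the circle transfers the vanishing of Fourier coefficients from trigonometric polynomials
    to their limits in \<open>L2 \<mu>\<close> (\<open>bounded_predictable_mean_zero\<close>). So a bounded element of \<open>A t\<close>
    has no Fourier coefficient of index greater than \<open>t\<close>; a real one has none of index less than
    \<open>- t\<close> either, and is a trigonometric polynomial of degree at most \<open>t\<close>.
\<close>

section \<open>The space of square integrable functions\<close>

lemma L2D [dest]:
  assumes "f \<in> L2 M"
  shows L2_measurable: "f \<in> borel_measurable M"
    and L2_integrable: "integrable M (\<lambda>x. (cmod (f x))\<^sup>2)"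
  using assms by (auto simp: L2_def)

lemma L2I: "f \<in> borel_measurable M \<Longrightarrow> integrable M (\<lambda>x. (cmod (f x))\<^sup>2) \<Longrightarrow> f \<in> L2 M"
  by (auto simp: L2_def)

lemmas [measurable_dest] = L2_measurable
lemmas [simp] = L2_integrable

lemma sqnorm_nonneg [simp]: "0 \<le> sqnorm M f"
  by (simp add: sqnorm_def)

lemma L2_scale: "f \<in> L2 M \<Longrightarrow> (\<lambda>x. c * f x) \<in> L2 M"
  by (auto intro!: L2I simp: norm_mult power_mult_distrib)

lemma sqnorm_scale: "sqnorm M (\<lambda>x. c * f x) = (cmod c)\<^sup>2 * sqnorm M f"
  by (simp add: sqnorm_def norm_mult power_mult_distrib)

lemma L2_zero [simp]: "(\<lambda>x. 0) \<in> L2 M"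
  by (auto intro!: L2I)

lemma cmod_add_sq_le: "(cmod (a + b))\<^sup>2 \<le> 2 * (cmod a)\<^sup>2 + 2 * (cmod b)\<^sup>2"
proof -
  have "(cmod (a + b))\<^sup>2 \<le> (cmod a + cmod b)\<^sup>2"
    by (intro power_mono norm_triangle_ineq) auto
  also have "\<dots> \<le> 2 * (cmod a)\<^sup>2 + 2 * (cmod b)\<^sup>2"
    using sum_squares_bound[of "cmod a" "cmod b"] by (simp add: power2_sum)
  finally show ?thesis .
qed

lemma L2_add: assumes "f \<in> L2 M" "g \<in> L2 M" shows "(\<lambda>x. f x + g x) \<in> L2 M"
proof (rule L2I)
  have [measurable]: "f \<in> borel_measurable M" "g \<in> borel_measurable M" using assms by auto
  show "(\<lambda>x. f x + g x) \<in> borel_measurable M" by measurable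
  show "integrable M (\<lambda>x. (cmod (f x + g x))\<^sup>2)"
    by (rule Bochner_Integration.integrable_bound[of M "\<lambda>x. 2 * (cmod (f x))\<^sup>2 + 2 * (cmod (g x))\<^sup>2"])
       (use assms cmod_add_sq_le in \<open>auto intro!: Bochner_Integration.integrable_add\<close>)
qed

lemma L2_minus: "f \<in> L2 M \<Longrightarrow> (\<lambda>x. - f x) \<in> L2 M"
  using L2_scale[of f M "-1"] by simp

lemma L2_diff: "f \<in> L2 M \<Longrightarrow> g \<in> L2 M \<Longrightarrow> (\<lambda>x. f x - g x) \<in> L2 M"
  using L2_add[OF _ L2_minus, of f M g] by simp

lemma L2_sum: "(\<And>i. i \<in> I \<Longrightarrow> f i \<in> L2 M) \<Longrightarrow> (\<lambda>x. \<Sum>i\<in>I. f i x) \<in> L2 M"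
  by (induction I rule: infinite_finite_induct) (auto intro!: L2_add)

lemma L2_cnj: "f \<in> L2 M \<Longrightarrow> (\<lambda>x. cnj (f x)) \<in> L2 M"
  by (rule L2I) (auto intro!: borel_measurable_continuous_on[where f = cnj] continuous_intros)

lemma L2_mult_integrable:
  assumes "f \<in> L2 M" "g \<in> L2 M" shows "integrable M (\<lambda>x. f x * g x)"
proof (rule Bochner_Integration.integrable_bound[of M "\<lambda>x. (cmod (f x))\<^sup>2 + (cmod (g x))\<^sup>2"])
  have [measurable]: "f \<in> borel_measurable M" "g \<in> borel_measurable M" using assms by auto
  show "(\<lambda>x. f x * g x) \<in> borel_measurable M" by measurable
  have "cmod (a * b) \<le> (cmod a)\<^sup>2 + (cmod b)\<^sup>2" for a b :: complex
    using sum_squares_bound[of "cmod a" "cmod b", unfolded mult.assoc]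
      mult_nonneg_nonneg[OF norm_ge_zero[of a] norm_ge_zero[of b]]
    unfolding norm_mult by linarith
  then show "AE x in M. cmod (f x * g x) \<le> norm ((cmod (f x))\<^sup>2 + (cmod (g x))\<^sup>2)"
    by auto
qed (use assms in \<open>auto intro!: Bochner_Integration.integrable_add\<close>)

lemma Cauchy_Schwarz_L2:
  assumes "f \<in> L2 M" "g \<in> L2 M"
  shows "(\<integral>x. cmod (f x) * cmod (g x) \<partial>M) \<le> sqrt (sqnorm M f) * sqrt (sqnorm M g)"
proof -
  have [measurable]: "f \<in> borel_measurable M" "g \<in> borel_measurable M" using assms by auto
  have i: "integrable M (\<lambda>x. cmod (f x) * cmod (g x))"
    using integrable_norm[OF L2_mult_integrable[OF assms]] by (simp add: norm_mult)
  have *: "(\<integral>\<^sup>+x. ennreal (cmod (f x)) * ennreal (cmod (g x)) \<partial>M)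
      = ennreal (\<integral>x. cmod (f x) * cmod (g x) \<partial>M)"
    by (subst nn_integral_eq_integral[OF i, symmetric]) (auto simp: ennreal_mult)
  have s: "(\<integral>\<^sup>+x. (ennreal (cmod (h x)))\<^sup>2 \<partial>M) = ennreal (sqnorm M h)" if "h \<in> L2 M" for h
    unfolding sqnorm_def using that
    by (subst nn_integral_eq_integral[symmetric]) (auto simp: ennreal_power)
  have "ennreal ((\<integral>x. cmod (f x) * cmod (g x) \<partial>M)\<^sup>2) \<le> ennreal (sqnorm M f * sqnorm M g)"
    using Cauchy_Schwarz_nn_integral[of "\<lambda>x. ennreal (cmod (f x))" M "\<lambda>x. ennreal (cmod (g x))"]
    unfolding * s[OF assms(1)] s[OF assms(2)] by (simp add: ennreal_power ennreal_mult)
  then have "(\<integral>x. cmod (f x) * cmod (g x) \<partial>M)\<^sup>2 \<le> sqnorm M f * sqnorm M g"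
    by (simp add: ennreal_le_iff)
  then have "\<bar>\<integral>x. cmod (f x) * cmod (g x) \<partial>M\<bar> \<le> sqrt (sqnorm M f * sqnorm M g)"
    by (metis real_sqrt_abs real_sqrt_le_mono)
  then show ?thesis by (simp add: real_sqrt_mult)
qed

lemma Minkowski_L2:
  assumes "f \<in> L2 M" "g \<in> L2 M"
  shows "sqrt (sqnorm M (\<lambda>x. f x + g x)) \<le> sqrt (sqnorm M f) + sqrt (sqnorm M g)"
proof (rule real_le_lsqrt)
  have i: "integrable M (\<lambda>x. cmod (f x) * cmod (g x))"
    using integrable_norm[OF L2_mult_integrable[OF assms]] by (simp add: norm_mult)
  have "sqnorm M (\<lambda>x. f x + g x) \<le>
      (\<integral>x. (cmod (f x))\<^sup>2 + (cmod (g x))\<^sup>2 + 2 * (cmod (f x) * cmod (g x)) \<partial>M)"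
    unfolding sqnorm_def
  proof (rule integral_mono)
    show "(cmod (f x + g x))\<^sup>2 \<le> (cmod (f x))\<^sup>2 + (cmod (g x))\<^sup>2 + 2 * (cmod (f x) * cmod (g x))" for x
      using power_mono[OF norm_triangle_ineq[of "f x" "g x"], of 2] by (simp add: power2_sum)
  qed (use assms i L2_add[OF assms] in \<open>auto intro!: Bochner_Integration.integrable_add\<close>)
  also have "\<dots> = sqnorm M f + sqnorm M g + 2 * (\<integral>x. cmod (f x) * cmod (g x) \<partial>M)"
    unfolding sqnorm_def using assms i by (simp add: L2_integrable)
  also have "\<dots> \<le> sqnorm M f + sqnorm M g + 2 * (sqrt (sqnorm M f) * sqrt (sqnorm M g))"
    using Cauchy_Schwarz_L2[OF assms] by simp
  also have "\<dots> = (sqrt (sqnorm M f) + sqrt (sqnorm M g))\<^sup>2"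
    by (simp add: power2_sum)
  finally show "sqnorm M (\<lambda>x. f x + g x) \<le> (sqrt (sqnorm M f) + sqrt (sqnorm M g))\<^sup>2" .
qed auto

lemma sqnorm_minus_commute: "sqnorm M (\<lambda>x. f x - g x) = sqnorm M (\<lambda>x. g x - f x)"
  by (simp add: sqnorm_def norm_minus_commute)

lemma sqnorm_triangle:
  assumes "f \<in> L2 M" "g \<in> L2 M" "h \<in> L2 M"
  shows "sqrt (sqnorm M (\<lambda>x. f x - h x)) \<le> sqrt (sqnorm M (\<lambda>x. f x - g x)) + sqrt (sqnorm M (\<lambda>x. g x - h x))"
  using Minkowski_L2[OF L2_diff[OF assms(1,2)] L2_diff[OF assms(2,3)]] by simp

lemma sqnorm_add_le:
  assumes "f \<in> L2 M" "g \<in> L2 M"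
  shows "sqnorm M (\<lambda>x. f x + g x) \<le> 2 * sqnorm M f + 2 * sqnorm M g"
proof -
  have "sqnorm M (\<lambda>x. f x + g x) \<le> (\<integral>x. 2 * (cmod (f x))\<^sup>2 + 2 * (cmod (g x))\<^sup>2 \<partial>M)"
    unfolding sqnorm_def
    by (rule integral_mono)
      (use assms L2_add[OF assms] cmod_add_sq_le in \<open>auto intro!: Bochner_Integration.integrable_add\<close>)
  also have "\<dots> = 2 * sqnorm M f + 2 * sqnorm M g"
    unfolding sqnorm_def using assms by (simp add: L2_integrable)
  finally show ?thesis .
qed

lemma sqnorm_diff_le:
  assumes "f \<in> L2 M" "g \<in> L2 M" "h \<in> L2 M"
  shows "sqnorm M (\<lambda>x. f x - h x) \<le> 2 * sqnorm M (\<lambda>x. f x - g x) + 2 * sqnorm M (\<lambda>x. g x - h x)"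
  using sqnorm_add_le[OF L2_diff[OF assms(1,2)] L2_diff[OF assms(2,3)]] by simp

lemma sqnorm_cong_AE:
  assumes "f \<in> borel_measurable M" "g \<in> borel_measurable M" "AE x in M. f x = g x"
  shows "sqnorm M f = sqnorm M g"
  unfolding sqnorm_def by (rule integral_cong_AE) (use assms in auto)

lemma tendsto_sqnorm_add:
  assumes L: "\<And>n. f n \<in> L2 M" "f' \<in> L2 M" "\<And>n. g n \<in> L2 M" "g' \<in> L2 M" "\<And>n. h n \<in> L2 M"
    and lim: "(\<lambda>n. sqnorm M (\<lambda>x. f n x - f' x)) \<longlonglongrightarrow> 0" "(\<lambda>n. sqnorm M (\<lambda>x. g n x - g' x)) \<longlonglongrightarrow> 0"
    and h: "\<And>n. AE x in M. h n x = f n x + g n x"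
  shows "(\<lambda>n. sqnorm M (\<lambda>x. h n x - (f' x + g' x))) \<longlonglongrightarrow> 0"
proof (rule tendsto_sandwich[OF _ _ tendsto_const])
  have "(\<lambda>n. 2 * sqnorm M (\<lambda>x. f n x - f' x) + 2 * sqnorm M (\<lambda>x. g n x - g' x)) \<longlonglongrightarrow> 2 * 0 + 2 * 0"
    by (intro tendsto_intros lim)
  then show "(\<lambda>n. 2 * sqnorm M (\<lambda>x. f n x - f' x) + 2 * sqnorm M (\<lambda>x. g n x - g' x)) \<longlonglongrightarrow> 0" by simp
  have d: "(\<lambda>x. f n x - f' x) \<in> L2 M" "(\<lambda>x. g n x - g' x) \<in> L2 M" for n by (intro L2_diff L)+
  have "sqnorm M (\<lambda>x. h n x - (f' x + g' x)) = sqnorm M (\<lambda>x. (f n x - f' x) + (g n x - g' x))" for n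
  proof (rule sqnorm_cong_AE)
    show "AE x in M. h n x - (f' x + g' x) = (f n x - f' x) + (g n x - g' x)"
      using h[of n] by eventually_elim simp
  qed (intro L2_measurable L2_diff L2_add L)+
  then show "\<forall>\<^sub>F n in sequentially. sqnorm M (\<lambda>x. h n x - (f' x + g' x)) \<le>
      2 * sqnorm M (\<lambda>x. f n x - f' x) + 2 * sqnorm M (\<lambda>x. g n x - g' x)"
    using sqnorm_add_le[OF d] by (intro always_eventually allI) simp
qed simp

lemma sqnorm_limit:
  assumes "\<And>n. f n \<in> L2 M" "g \<in> L2 M" and lim: "(\<lambda>n. sqnorm M (\<lambda>x. f n x - g x)) \<longlonglongrightarrow> 0"
  shows "(\<lambda>n. sqnorm M (f n)) \<longlonglongrightarrow> sqnorm M g"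
proof -
  have "(\<lambda>n. sqrt (sqnorm M (f n)) - sqrt (sqnorm M g)) \<longlonglongrightarrow> 0"
  proof (rule tendsto_0_le[where K = 1])
    show "(\<lambda>n. sqrt (sqnorm M (\<lambda>x. f n x - g x))) \<longlonglongrightarrow> 0"
      using tendsto_real_sqrt[OF lim] by simp
    show "\<forall>\<^sub>F n in sequentially. norm (sqrt (sqnorm M (f n)) - sqrt (sqnorm M g))
        \<le> norm (sqrt (sqnorm M (\<lambda>x. f n x - g x))) * 1"
      using sqnorm_triangle[OF assms(1,2) L2_zero] sqnorm_triangle[OF assms(2,1) L2_zero]
      by (auto simp: abs_le_iff sqnorm_minus_commute[of M g] algebra_simps intro!: always_eventually)
  qed
  then have "(\<lambda>n. sqrt (sqnorm M (f n))) \<longlonglongrightarrow> sqrt (sqnorm M g)"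
    using Lim_null by blast
  then have "(\<lambda>n. (sqrt (sqnorm M (f n)))\<^sup>2) \<longlonglongrightarrow> (sqrt (sqnorm M g))\<^sup>2"
    by (rule tendsto_power)
  then show ?thesis by simp
qed

lemma sqnorm_0_iff:
  assumes "f \<in> L2 M" shows "sqnorm M f = 0 \<longleftrightarrow> (AE x in M. f x = 0)"
  unfolding sqnorm_def using integral_nonneg_eq_0_iff_AE[OF L2_integrable[OF assms]] by auto

lemma L2_cong_AE:
  assumes "f \<in> L2 M" "g \<in> borel_measurable M" "AE x in M. f x = g x"
  shows "g \<in> L2 M"
proof (rule L2I)
  have [measurable]: "f \<in> borel_measurable M" "g \<in> borel_measurable M" using assms by auto
  show "integrable M (\<lambda>x. (cmod (g x))\<^sup>2)"
    by (rule integrable_cong_AE_imp[OF L2_integrable[OF assms(1)]]) (use assms(3) in auto)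
qed (rule assms)

lemma (in finite_measure) L2_bounded:
  assumes "f \<in> borel_measurable M" "\<And>x. x \<in> space M \<Longrightarrow> cmod (f x) \<le> C"
  shows "f \<in> L2 M"
proof (rule L2I)
  show "integrable M (\<lambda>x. (cmod (f x))\<^sup>2)"
    by (rule integrable_const_bound[where B = "C\<^sup>2"])
      (use assms in \<open>auto intro!: power_mono\<close>)
qed fact

lemma L2_bounded_mult:
  assumes f: "f \<in> L2 M" and b: "b \<in> borel_measurable M" "\<And>x. x \<in> space M \<Longrightarrow> cmod (b x) \<le> C"
  shows "(\<lambda>x. b x * f x) \<in> L2 M" "sqnorm M (\<lambda>x. b x * f x) \<le> C\<^sup>2 * sqnorm M f"
proof -
  have [measurable]: "f \<in> borel_measurable M" "b \<in> borel_measurable M" using assms by auto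
  have le: "(cmod (b x * f x))\<^sup>2 \<le> C\<^sup>2 * (cmod (f x))\<^sup>2" if "x \<in> space M" for x
    using b(2)[OF that] by (auto simp: norm_mult power_mult_distrib intro!: mult_right_mono power_mono)
  show *: "(\<lambda>x. b x * f x) \<in> L2 M"
  proof (rule L2I)
    show "integrable M (\<lambda>x. (cmod (b x * f x))\<^sup>2)"
      by (rule Bochner_Integration.integrable_bound[of M "\<lambda>x. C\<^sup>2 * (cmod (f x))\<^sup>2"])
        (use f le in auto)
  qed measurable
  have "sqnorm M (\<lambda>x. b x * f x) \<le> (\<integral>x. C\<^sup>2 * (cmod (f x))\<^sup>2 \<partial>M)"
    unfolding sqnorm_def by (rule integral_mono) (use f * le in auto)
  also have "\<dots> = C\<^sup>2 * sqnorm M f" by (simp add: sqnorm_def)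
  finally show "sqnorm M (\<lambda>x. b x * f x) \<le> C\<^sup>2 * sqnorm M f" .
qed

text \<open>A sequence with summable consecutive distances converges almost everywhere, because the
  integral of the squared partial sums of the increments stays bounded; Fatou's lemma then turns
  the pointwise limit into a limit in mean square.\<close>

lemma L2_complete_fast:
  assumes f: "\<And>n. f n \<in> L2 M" and fast: "\<And>n::nat. sqrt (sqnorm M (\<lambda>x. f (Suc n) x - f n x)) \<le> (1/2)^n"
  shows "\<exists>g \<in> L2 M. (\<lambda>n. sqnorm M (\<lambda>x. f n x - g x)) \<longlonglongrightarrow> 0"
proof -
  have [measurable]: "f n \<in> borel_measurable M" for n using f by auto
  define d where "d n x = cmod (f (Suc n) x - f n x)" for n x
  define D where "D N x = (\<Sum>n<N. complex_of_real (d n x))" for N x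
  have [measurable]: "d n \<in> borel_measurable M" for n unfolding d_def by measurable
  have dL2: "(\<lambda>x. complex_of_real (d n x)) \<in> L2 M" for n
    using L2_diff[OF f[of "Suc n"] f[of n]] by (auto intro!: L2I simp: d_def)
  have dn: "sqnorm M (\<lambda>x. complex_of_real (d n x)) = sqnorm M (\<lambda>x. f (Suc n) x - f n x)" for n
    by (simp add: sqnorm_def d_def)
  have DL2: "D N \<in> L2 M" for N unfolding D_def by (intro L2_sum dL2)
  have Dn: "sqrt (sqnorm M (D N)) \<le> 2 - 2 * (1/2)^N" for N
  proof (induction N)
    case 0 then show ?case by (simp add: D_def sqnorm_def)
  next
    case (Suc N)
    have "sqrt (sqnorm M (D (Suc N))) \<le> sqrt (sqnorm M (D N)) + sqrt (sqnorm M (\<lambda>x. complex_of_real (d N x)))"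
      using Minkowski_L2[OF DL2 dL2, of N N] unfolding D_def by simp
    with Suc fast[of N] show ?case by (simp add: dn)
  qed
  have Dcmod: "cmod (D N x) = (\<Sum>n<N. d n x)" for N x
    unfolding D_def of_real_sum[symmetric] norm_of_real by (simp add: d_def sum_nonneg)
  have nnD: "(\<integral>\<^sup>+x. ennreal ((cmod (D N x))\<^sup>2) \<partial>M) \<le> 4" for N
  proof -
    have "sqrt (sqnorm M (D N)) \<le> 2" using Dn[of N] zero_le_power[of "1/2::real" N] by linarith
    then have "sqnorm M (D N) \<le> 4" using real_sqrt_le_iff[of "sqnorm M (D N)" 4] by simp
    then show ?thesis
      using nn_integral_eq_integral[OF L2_integrable[OF DL2[of N]]] ennreal_leI[of "sqnorm M (D N)" 4]
      by (simp add: sqnorm_def[symmetric])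
  qed
  have "(\<integral>\<^sup>+x. (SUP N. ennreal ((cmod (D N x))\<^sup>2)) \<partial>M) = (SUP N. \<integral>\<^sup>+x. ennreal ((cmod (D N x))\<^sup>2) \<partial>M)"
  proof (rule nn_integral_monotone_convergence_SUP)
    show "incseq (\<lambda>N x. ennreal ((cmod (D N x))\<^sup>2))"
      unfolding incseq_def le_fun_def Dcmod
      by (auto intro!: ennreal_leI power_mono sum_mono2 sum_nonneg simp: d_def)
  qed (simp add: D_def)
  also have "\<dots> \<le> 4" using nnD by (intro SUP_least) auto
  finally have "(\<integral>\<^sup>+x. (SUP N. ennreal ((cmod (D N x))\<^sup>2)) \<partial>M) \<noteq> \<infinity>"
    using neq_top_trans[of "4::ennreal"] by (simp add: infinity_ennreal_def)
  then have "AE x in M. (SUP N. ennreal ((cmod (D N x))\<^sup>2)) \<noteq> \<infinity>"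
    by (intro nn_integral_PInf_AE) (auto simp: D_def)
  then have conv: "AE x in M. convergent (\<lambda>n. f n x)"
  proof eventually_elim
    case (elim x)
    then obtain r where r: "(SUP N. ennreal ((cmod (D N x))\<^sup>2)) = ennreal r" "0 \<le> r"
      by (cases "SUP N. ennreal ((cmod (D N x))\<^sup>2)") auto
    have "(cmod (D N x))\<^sup>2 \<le> r" for N
      using SUP_upper[of N UNIV "\<lambda>N. ennreal ((cmod (D N x))\<^sup>2)"] r by simp
    then have "(\<Sum>n<N. d n x) \<le> sqrt r" for N
      by (simp add: Dcmod real_le_rsqrt)
    then have "summable (\<lambda>n. d n x)"
      by (intro summableI_nonneg_bounded[where x = "sqrt r"]) (auto simp: d_def)
    then have "summable (\<lambda>n. f (Suc n) x - f n x)"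
      unfolding d_def by (rule summable_norm_cancel)
    then have "convergent (\<lambda>N. \<Sum>n<N. f (Suc n) x - f n x)"
      by (simp add: summable_iff_convergent)
    then have "convergent (\<lambda>N. f N x - f 0 x)"
      by (subst (asm) sum_lessThan_telescope)
    then have "convergent (\<lambda>N. (f N x - f 0 x) + f 0 x)" by (intro convergent_add convergent_const)
    then show ?case by simp
  qed
  define g where "g x = (if Cauchy (\<lambda>n. f n x) then lim (\<lambda>n. f n x) else 0)" for x
  have [measurable]: "g \<in> borel_measurable M" unfolding g_def by measurable
  have lim: "AE x in M. (\<lambda>n. f n x) \<longlonglongrightarrow> g x"
    using conv by eventually_elim (simp add: g_def convergent_LIMSEQ_iff Cauchy_convergent_iff)
  have fm: "sqrt (sqnorm M (\<lambda>x. f (n + k) x - f n x)) \<le> 2 * (1/2)^n - 2 * (1/2)^(n+k)" for n k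
  proof (induction k)
    case 0 show ?case by (simp add: sqnorm_def)
  next
    case (Suc k)
    have "sqrt (sqnorm M (\<lambda>x. f (n + Suc k) x - f n x)) \<le>
       sqrt (sqnorm M (\<lambda>x. f (Suc (n + k)) x - f (n+k) x)) + sqrt (sqnorm M (\<lambda>x. f (n + k) x - f n x))"
      using sqnorm_triangle[OF f[of "Suc (n+k)"] f[of "n+k"] f[of n]] by simp
    with Suc fast[of "n+k"] show ?case by (simp add: power_add)
  qed
  have fatou: "(\<integral>\<^sup>+x. ennreal ((cmod (g x - f n x))\<^sup>2) \<partial>M) \<le> ennreal ((2 * (1/2)^n)\<^sup>2)" for n
  proof -
    have "(\<integral>\<^sup>+x. ennreal ((cmod (g x - f n x))\<^sup>2) \<partial>M)
        = (\<integral>\<^sup>+x. liminf (\<lambda>k. ennreal ((cmod (f (n + k) x - f n x))\<^sup>2)) \<partial>M)"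
    proof (rule nn_integral_cong_AE)
      show "AE x in M. ennreal ((cmod (g x - f n x))\<^sup>2) = liminf (\<lambda>k. ennreal ((cmod (f (n + k) x - f n x))\<^sup>2))"
        using lim
      proof eventually_elim
        case (elim x)
        have "(\<lambda>k. f (n + k) x) \<longlonglongrightarrow> g x" using LIMSEQ_ignore_initial_segment[OF elim, of n] by (simp add: add.commute)
        then have "(\<lambda>k. ennreal ((cmod (f (n + k) x - f n x))\<^sup>2)) \<longlonglongrightarrow> ennreal ((cmod (g x - f n x))\<^sup>2)"
          by (intro tendsto_intros)
        then show ?case by (metis lim_imp_Liminf sequentially_bot)
      qed
    qed
    also have "\<dots> \<le> liminf (\<lambda>k. \<integral>\<^sup>+x. ennreal ((cmod (f (n + k) x - f n x))\<^sup>2) \<partial>M)"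
      by (rule nn_integral_liminf) measurable
    also have "\<dots> \<le> ennreal ((2 * (1/2)^n)\<^sup>2)"
    proof (rule Liminf_le[OF sequentially_bot], rule always_eventually, rule allI)
      fix k
      have "sqrt (sqnorm M (\<lambda>x. f (n + k) x - f n x)) \<le> 2 * (1/2)^n"
        using fm[of n k] zero_le_power[of "1/2::real" "n+k"] by linarith
      then have "sqnorm M (\<lambda>x. f (n + k) x - f n x) \<le> (2 * (1/2)^n)\<^sup>2"
        by (rule sqrt_le_D)
      then show "(\<integral>\<^sup>+x. ennreal ((cmod (f (n + k) x - f n x))\<^sup>2) \<partial>M) \<le> ennreal ((2 * (1/2)^n)\<^sup>2)"
        using nn_integral_eq_integral[OF L2_integrable[OF L2_diff[OF f f, of "n+k" n]]]
        by (simp add: sqnorm_def[symmetric] ennreal_leI)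
    qed
    finally show ?thesis .
  qed
  have gd: "(\<lambda>x. g x - f n x) \<in> L2 M" for n
  proof (rule L2I)
    show "integrable M (\<lambda>x. (cmod (g x - f n x))\<^sup>2)"
      unfolding integrable_iff_bounded
      using order_le_less_trans[OF fatou[of n] ennreal_less_top] by simp
  qed measurable
  have g: "g \<in> L2 M" using L2_add[OF gd[of 0] f[of 0]] by simp
  have le: "sqnorm M (\<lambda>x. f n x - g x) \<le> (2 * (1/2)^n)\<^sup>2" for n
    using fatou[of n] unfolding sqnorm_minus_commute[of M "f n" g]
    by (simp add: nn_integral_eq_integral[OF L2_integrable[OF gd[of n]]] sqnorm_def)
  have "(\<lambda>n. (2 * (1/2)^n)\<^sup>2 :: real) \<longlonglongrightarrow> (2 * 0)\<^sup>2"
    by (intro tendsto_intros LIMSEQ_power_zero) simp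
  then have lim0: "(\<lambda>n. (2 * (1/2)^n)\<^sup>2 :: real) \<longlonglongrightarrow> 0" by simp
  have "(\<lambda>n. sqnorm M (\<lambda>x. f n x - g x)) \<longlonglongrightarrow> 0"
  proof (rule tendsto_sandwich[OF _ _ tendsto_const lim0])
    show "\<forall>\<^sub>F n in sequentially. sqnorm M (\<lambda>x. f n x - g x) \<le> (2 * (1/2)^n)\<^sup>2"
      using le by (intro always_eventually allI)
  qed simp
  with g show ?thesis by blast
qed

lemma ex_seq_tendsto_0:
  assumes "\<And>e. e > 0 \<Longrightarrow> \<exists>y. P y \<and> (F y :: real) < e" "\<And>y. 0 \<le> F y"
  shows "\<exists>s. (\<forall>n::nat. P (s n)) \<and> (\<lambda>n. F (s n)) \<longlonglongrightarrow> 0"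
proof -
  have "\<exists>y. P y \<and> F y < 1 / real (Suc n)" for n by (rule assms) simp
  then obtain s where s: "\<And>n. P (s n)" "\<And>n. F (s n) < 1 / real (Suc n)" by metis
  have "(\<lambda>n. F (s n)) \<longlonglongrightarrow> 0"
  proof (rule tendsto_sandwich[OF _ _ tendsto_const LIMSEQ_inverse_real_of_nat])
    show "\<forall>\<^sub>F n in sequentially. F (s n) \<le> inverse (real (Suc n))"
      using s(2) by (intro always_eventually allI less_imp_le) (simp add: inverse_eq_divide)
  qed (use assms(2) in auto)
  with s(1) show ?thesis by blast
qed

lemma L2_complete:
  assumes f: "\<And>n. f n \<in> L2 M"
    and cauchy: "\<And>e. e > 0 \<Longrightarrow> \<exists>N::nat. \<forall>m\<ge>N. \<forall>n\<ge>N. sqnorm M (\<lambda>x. f m x - f n x) < e"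
  shows "\<exists>g \<in> L2 M. (\<lambda>n. sqnorm M (\<lambda>x. f n x - g x)) \<longlonglongrightarrow> 0"
proof -
  have "\<exists>N. \<forall>m\<ge>N. \<forall>n\<ge>N. sqnorm M (\<lambda>x. f m x - f n x) < ((1/2)^k)\<^sup>2" for k :: nat
    by (rule cauchy) simp
  then obtain N where N: "\<And>k m n. m \<ge> N k \<Longrightarrow> n \<ge> N k \<Longrightarrow> sqnorm M (\<lambda>x. f m x - f n x) < ((1/2)^k)\<^sup>2"
    by metis
  define r where "r k = Max (N ` {..k})" for k
  have r: "N j \<le> r k" if "j \<le> k" for j k unfolding r_def using that by (intro Max_ge) auto
  have "sqrt (sqnorm M (\<lambda>x. f (r (Suc k)) x - f (r k) x)) \<le> (1/2)^k" for k
  proof (rule real_le_lsqrt)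
    show "sqnorm M (\<lambda>x. f (r (Suc k)) x - f (r k) x) \<le> ((1/2)^k)\<^sup>2"
      using N[of k "r (Suc k)" "r k"] r[of k "Suc k"] r[of k k] by simp
  qed auto
  from L2_complete_fast[of "\<lambda>k. f (r k)", OF f this]
  obtain g where g: "g \<in> L2 M" "(\<lambda>k. sqnorm M (\<lambda>x. f (r k) x - g x)) \<longlonglongrightarrow> 0" by auto
  have "(\<lambda>n. sqnorm M (\<lambda>x. f n x - g x)) \<longlonglongrightarrow> 0"
  proof (rule LIMSEQ_I)
    fix e :: real assume e: "e > 0"
    obtain N0 where N0: "\<And>m n. m \<ge> N0 \<Longrightarrow> n \<ge> N0 \<Longrightarrow> sqnorm M (\<lambda>x. f m x - f n x) < e/4"
      using cauchy[of "e/4"] e by auto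
    obtain K where K: "\<And>k. k \<ge> K \<Longrightarrow> sqnorm M (\<lambda>x. f (r k) x - g x) < e/4"
      using LIMSEQ_D[OF g(2), of "e/4"] e by auto
    obtain k0 where k0: "((1/2::real)^k0)\<^sup>2 < e/4"
    proof -
      have "(\<lambda>n. ((1/2)^n)\<^sup>2 :: real) \<longlonglongrightarrow> 0"
        using tendsto_power[OF LIMSEQ_power_zero[of "1/2::real"], of 2] by simp
      from LIMSEQ_D[OF this, of "e/4"] e that show ?thesis by auto
    qed
    define k where "k = max K k0"
    have "sqnorm M (\<lambda>x. f n x - g x) < e" if n: "n \<ge> max (N k0) (r k)" for n
    proof -
      have "sqnorm M (\<lambda>x. f n x - f (r k) x) < ((1/2)^k0)\<^sup>2"
        by (rule N) (use n r[of k0 k] in \<open>auto simp: k_def\<close>)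
      moreover have "sqnorm M (\<lambda>x. f (r k) x - g x) < e/4" by (rule K) (simp add: k_def)
      ultimately show ?thesis
        using sqnorm_diff_le[OF f[of n] f[of "r k"] g(1)] k0 by simp
    qed
    then show "\<exists>no. \<forall>n\<ge>no. norm (sqnorm M (\<lambda>x. f n x - g x) - 0) < e"
      by (intro exI[of _ "max (N k0) (r k)"]) simp
  qed
  with g(1) show ?thesis by blast
qed

lemma L2_convergent_Cauchy:
  assumes f: "\<And>n. f n \<in> L2 M" and g: "g \<in> L2 M"
    and lim: "(\<lambda>n. sqnorm M (\<lambda>x. f n x - g x)) \<longlonglongrightarrow> 0" and e: "e > 0"
  shows "\<exists>N::nat. \<forall>m\<ge>N. \<forall>n\<ge>N. sqnorm M (\<lambda>x. f m x - f n x) < e"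
proof -
  obtain N where N: "\<And>n. n \<ge> N \<Longrightarrow> sqnorm M (\<lambda>x. f n x - g x) < e/4"
    using LIMSEQ_D[OF lim, of "e/4"] e by auto
  have "sqnorm M (\<lambda>x. f m x - f n x) < e" if "m \<ge> N" "n \<ge> N" for m n
    using sqnorm_diff_le[OF f[of m] g f[of n]] N[OF that(1)] N[OF that(2)]
    by (simp add: sqnorm_minus_commute[of M g])
  then show ?thesis by blast
qed

lemma L2_limit_unique:
  assumes f: "\<And>n::nat. f n \<in> L2 M" and g: "g \<in> L2 M" and h: "h \<in> L2 M"
    and "(\<lambda>n. sqnorm M (\<lambda>x. f n x - g x)) \<longlonglongrightarrow> 0" "(\<lambda>n. sqnorm M (\<lambda>x. f n x - h x)) \<longlonglongrightarrow> 0"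
  shows "AE x in M. g x = h x"
proof -
  have "(\<lambda>n. 2 * sqnorm M (\<lambda>x. f n x - g x) + 2 * sqnorm M (\<lambda>x. f n x - h x)) \<longlonglongrightarrow> 2 * 0 + 2 * 0"
    by (intro tendsto_intros assms)
  then have "sqnorm M (\<lambda>x. g x - h x) \<le> 2 * 0 + 2 * 0"
    by (rule LIMSEQ_le_const)
      (use sqnorm_diff_le[OF g f h] in \<open>auto simp: sqnorm_minus_commute[of M g]\<close>)
  then have "sqnorm M (\<lambda>x. g x - h x) = 0" using sqnorm_nonneg[of M "\<lambda>x. g x - h x"] by linarith
  then show ?thesis using sqnorm_0_iff[OF L2_diff[OF g h]] by simp
qed

section \<open>Closed linear spans\<close>

lemma closed_spanD: "f \<in> closed_span M B S \<Longrightarrow> f \<in> L2 M"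
  by (simp add: closed_span_def)

lemma closed_spanI:
  assumes "f \<in> L2 M" "\<And>e. e > 0 \<Longrightarrow> \<exists>F c. finite F \<and> F \<subseteq> S \<and> sqnorm M (\<lambda>x. f x - (\<Sum>s\<in>F. c s * B s x)) < e"
  shows "f \<in> closed_span M B S"
  using assms by (simp add: closed_span_def)

lemma closed_span_generator:
  assumes "B s \<in> L2 M" "s \<in> S" shows "B s \<in> closed_span M B S"
proof (rule closed_spanI)
  fix e :: real assume "e > 0"
  then show "\<exists>F c. finite F \<and> F \<subseteq> S \<and> sqnorm M (\<lambda>x. B s x - (\<Sum>s\<in>F. c s * B s x)) < e"
    using assms by (intro exI[of _ "{s}"] exI[of _ "\<lambda>_. 1"]) (auto simp: sqnorm_def)
qed fact

lemma closed_span_mono: "S \<subseteq> T \<Longrightarrow> closed_span M B S \<subseteq> closed_span M B T"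
  unfolding closed_span_def by (smt (verit, best) Collect_mono subset_trans)

lemma closed_span_closed:
  assumes B: "\<And>s. B s \<in> L2 M" and f: "f \<in> L2 M"
    and appr: "\<And>e. e > 0 \<Longrightarrow> \<exists>g \<in> closed_span M B S. sqnorm M (\<lambda>x. f x - g x) < e"
  shows "f \<in> closed_span M B S"
proof (rule closed_spanI[OF f])
  fix e :: real assume "e > 0"
  then obtain g where g: "g \<in> closed_span M B S" "sqnorm M (\<lambda>x. f x - g x) < e/4"
    using appr[of "e/4"] by auto
  from g(1) \<open>e > 0\<close> obtain F c where F: "finite F" "F \<subseteq> S" "sqnorm M (\<lambda>x. g x - (\<Sum>s\<in>F. c s * B s x)) < e/4"
    unfolding closed_span_def by (auto dest!: spec[of _ "e/4"])
  have "sqnorm M (\<lambda>x. f x - (\<Sum>s\<in>F. c s * B s x)) < e"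
    using sqnorm_diff_le[OF f closed_spanD[OF g(1)] L2_sum[of F "\<lambda>s x. c s * B s x" M, OF L2_scale[OF B]]]
      g(2) F(3) by linarith
  with F(1,2) show "\<exists>F c. finite F \<and> F \<subseteq> S \<and> sqnorm M (\<lambda>x. f x - (\<Sum>s\<in>F. c s * B s x)) < e"
    by blast
qed

lemma closed_span_scale:
  assumes "f \<in> closed_span M B S" shows "(\<lambda>x. a * f x) \<in> closed_span M B S"
proof (rule closed_spanI)
  show "(\<lambda>x. a * f x) \<in> L2 M" using assms by (intro L2_scale closed_spanD)
  fix e :: real assume e: "e > 0"
  define e' where "e' = e / ((cmod a)\<^sup>2 + 1)"
  have d: "(cmod a)\<^sup>2 + 1 > 0" by (simp add: add_nonneg_pos)
  have "e' > 0" unfolding e'_def using e d by simp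
  with assms obtain F c where F: "finite F" "F \<subseteq> S" "sqnorm M (\<lambda>x. f x - (\<Sum>s\<in>F. c s * B s x)) < e'"
    unfolding closed_span_def by auto
  have "sqnorm M (\<lambda>x. a * f x - (\<Sum>s\<in>F. (a * c s) * B s x)) =
      (cmod a)\<^sup>2 * sqnorm M (\<lambda>x. f x - (\<Sum>s\<in>F. c s * B s x))"
    unfolding sqnorm_scale[symmetric] by (simp add: algebra_simps sum_distrib_left)
  also have "\<dots> \<le> (cmod a)\<^sup>2 * e'" using F(3) by (intro mult_left_mono) auto
  also have "\<dots> < ((cmod a)\<^sup>2 + 1) * e'" using \<open>e' > 0\<close> by simp
  also have "\<dots> = e" unfolding e'_def using d by simp
  finally show "\<exists>F c. finite F \<and> F \<subseteq> S \<and> sqnorm M (\<lambda>x. a * f x - (\<Sum>s\<in>F. c s * B s x)) < e"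
    using F(1,2) by (intro exI[of _ F] exI[of _ "\<lambda>s. a * c s"]) auto
qed

lemma closed_span_add:
  assumes B: "\<And>s. B s \<in> L2 M" and f: "f \<in> closed_span M B S" and g: "g \<in> closed_span M B S"
  shows "(\<lambda>x. f x + g x) \<in> closed_span M B S"
proof (rule closed_spanI)
  show "(\<lambda>x. f x + g x) \<in> L2 M" using f g by (intro L2_add closed_spanD)
  fix e :: real assume "e > 0"
  with f obtain F c where F: "finite F" "F \<subseteq> S" "sqnorm M (\<lambda>x. f x - (\<Sum>s\<in>F. c s * B s x)) < e/4"
    unfolding closed_span_def by (auto dest!: spec[of _ "e/4"])
  from g \<open>e > 0\<close> obtain G d where G: "finite G" "G \<subseteq> S" "sqnorm M (\<lambda>x. g x - (\<Sum>s\<in>G. d s * B s x)) < e/4"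
    unfolding closed_span_def by (auto dest!: spec[of _ "e/4"])
  define h where "h s = (if s \<in> F then c s else 0) + (if s \<in> G then d s else 0)" for s
  have h: "(\<Sum>s\<in>F \<union> G. h s * B s x) = (\<Sum>s\<in>F. c s * B s x) + (\<Sum>s\<in>G. d s * B s x)" for x
  proof -
    have "(\<Sum>s\<in>F \<union> G. h s * B s x) =
       (\<Sum>s\<in>F \<union> G. if s \<in> F then c s * B s x else 0) + (\<Sum>s\<in>F \<union> G. if s \<in> G then d s * B s x else 0)"
      unfolding sum.distrib[symmetric] h_def by (intro sum.cong) (auto simp: algebra_simps)
    also have "\<dots> = (\<Sum>s\<in>F. c s * B s x) + (\<Sum>s\<in>G. d s * B s x)"
      using F(1) G(1) by (simp add: sum.inter_restrict[symmetric] Int_absorb1)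
    finally show ?thesis .
  qed
  have *: "(\<lambda>x. f x - (\<Sum>s\<in>F. c s * B s x)) \<in> L2 M" "(\<lambda>x. g x - (\<Sum>s\<in>G. d s * B s x)) \<in> L2 M"
    by (intro L2_diff L2_sum L2_scale B closed_spanD[OF f] closed_spanD[OF g])+
  have "sqnorm M (\<lambda>x. (f x + g x) - (\<Sum>s\<in>F \<union> G. h s * B s x)) < e"
    using sqnorm_add_le[OF *] F(3) G(3) unfolding h by (simp add: algebra_simps)
  with F G show "\<exists>F c. finite F \<and> F \<subseteq> S \<and> sqnorm M (\<lambda>x. f x + g x - (\<Sum>s\<in>F. c s * B s x)) < e"
    by (intro exI[of _ "F \<union> G"] exI[of _ h]) auto
qed

lemma closed_span_zero: "(\<lambda>x. 0) \<in> closed_span M B S"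
  by (rule closed_spanI) (auto intro!: exI[of _ "{}"] simp: sqnorm_def)

lemma closed_span_sum:
  assumes B: "\<And>s. B s \<in> L2 M" and f: "\<And>i. i \<in> I \<Longrightarrow> f i \<in> closed_span M B S"
  shows "(\<lambda>x. \<Sum>i\<in>I. f i x) \<in> closed_span M B S"
  using f by (induction I rule: infinite_finite_induct) (auto intro!: closed_span_add[OF B] closed_span_zero)

lemma closed_span_cong_AE:
  assumes f: "f \<in> closed_span M B S" and g: "g \<in> borel_measurable M" and eq: "AE x in M. f x = g x"
    and B: "\<And>s. B s \<in> L2 M"
  shows "g \<in> closed_span M B S"
proof -
  have gL2: "g \<in> L2 M" using L2_cong_AE[OF closed_spanD[OF f] g eq] .
  have "sqnorm M (\<lambda>x. g x - f x) = 0"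
    using eq by (subst sqnorm_0_iff[OF L2_diff[OF gL2 closed_spanD[OF f]]]) auto
  then show ?thesis by (intro closed_span_closed[OF B gL2] bexI[OF _ f]) auto
qed

text \<open>Multiplication by a bounded function is continuous, so it is enough to know what it does to
  the generators.\<close>

lemma closed_span_multiplier:
  assumes B: "\<And>s. B s \<in> L2 M" and f: "f \<in> closed_span M B S"
    and b: "b \<in> borel_measurable M" "\<And>x. x \<in> space M \<Longrightarrow> cmod (b x) \<le> C"
    and gen: "\<And>s. s \<in> S \<Longrightarrow> (\<lambda>x. b x * B s x) \<in> closed_span M B T"
  shows "(\<lambda>x. b x * f x) \<in> closed_span M B T"
proof (rule closed_span_closed[OF B L2_bounded_mult(1)[OF closed_spanD[OF f] b]])
  fix e :: real assume e: "e > 0"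
  define e' where "e' = e / (C\<^sup>2 + 1)"
  have d: "C\<^sup>2 + 1 > 0" by (simp add: add_nonneg_pos)
  have "e' > 0" unfolding e'_def using e d by simp
  with f obtain F c where F: "finite F" "F \<subseteq> S" "sqnorm M (\<lambda>x. f x - (\<Sum>s\<in>F. c s * B s x)) < e'"
    unfolding closed_span_def by auto
  have L: "(\<lambda>x. f x - (\<Sum>s\<in>F. c s * B s x)) \<in> L2 M"
    using f by (intro L2_diff L2_sum L2_scale B closed_spanD)
  have "sqnorm M (\<lambda>x. b x * f x - (\<Sum>s\<in>F. c s * (b x * B s x)))
      = sqnorm M (\<lambda>x. b x * (f x - (\<Sum>s\<in>F. c s * B s x)))"
    by (simp add: algebra_simps sum_distrib_left)
  also have "\<dots> \<le> C\<^sup>2 * sqnorm M (\<lambda>x. f x - (\<Sum>s\<in>F. c s * B s x))"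
    by (rule L2_bounded_mult(2)[OF L b])
  also have "\<dots> \<le> C\<^sup>2 * e'" using F(3) by (intro mult_left_mono) auto
  also have "\<dots> < (C\<^sup>2 + 1) * e'" using \<open>e' > 0\<close> by simp
  also have "\<dots> = e" unfolding e'_def using d by simp
  finally have "sqnorm M (\<lambda>x. b x * f x - (\<Sum>s\<in>F. c s * (b x * B s x))) < e" .
  moreover have "(\<lambda>x. \<Sum>s\<in>F. c s * (b x * B s x)) \<in> closed_span M B T"
    using F(2) gen by (intro closed_span_sum[OF B] closed_span_scale) auto
  ultimately show "\<exists>g\<in>closed_span M B T. sqnorm M (\<lambda>x. b x * f x - g x) < e"
    by (rule rev_bexI[rotated])
qed

section \<open>The stochastic integral as an isometry\<close>

lemma L2_simple_approx:
  assumes \<phi>: "\<phi> \<in> L2 M"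
  shows "\<exists>s. (\<forall>n::nat. simple_function M (s n) \<and> s n \<in> L2 M) \<and> (\<lambda>n. sqnorm M (\<lambda>u. s n u - \<phi> u)) \<longlonglongrightarrow> 0"
proof -
  have [measurable]: "\<phi> \<in> borel_measurable M" using \<phi> by auto
  obtain s where s: "\<And>i. simple_function M (s i)" "\<And>x. x \<in> space M \<Longrightarrow> (\<lambda>i. s i x) \<longlonglongrightarrow> \<phi> x"
    "\<And>i x. x \<in> space M \<Longrightarrow> dist (s i x) 0 \<le> 2 * dist (\<phi> x) 0"
    using borel_measurable_implies_sequence_metric[of \<phi> M 0] by (auto; blast)
  have [measurable]: "s i \<in> borel_measurable M" for i using s(1) by (rule borel_measurable_simple_function)
  have le: "(cmod (s i x))\<^sup>2 \<le> 4 * (cmod (\<phi> x))\<^sup>2" if "x \<in> space M" for i x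
    using power_mono[OF s(3)[OF that, of i], of 2] by (simp add: power_mult_distrib)
  have sL2: "s i \<in> L2 M" for i
    by (rule L2I, measurable, rule Bochner_Integration.integrable_bound[of M "\<lambda>x. 4 * (cmod (\<phi> x))\<^sup>2"])
      (use \<phi> le in auto)
  have "(\<lambda>n. sqnorm M (\<lambda>u. s n u - \<phi> u)) \<longlonglongrightarrow> (\<integral>x. 0 \<partial>M)"
    unfolding sqnorm_def
  proof (rule integral_dominated_convergence[where w = "\<lambda>x. 10 * (cmod (\<phi> x))\<^sup>2"])
    show "AE x in M. norm ((cmod (s i x - \<phi> x))\<^sup>2) \<le> 10 * (cmod (\<phi> x))\<^sup>2" for i
    proof (rule AE_I2)
      fix x assume x: "x \<in> space M"
      show "norm ((cmod (s i x - \<phi> x))\<^sup>2) \<le> 10 * (cmod (\<phi> x))\<^sup>2"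
        using cmod_add_sq_le[of "s i x" "- \<phi> x"] le[OF x, of i] by simp
    qed
    show "AE x in M. (\<lambda>i. (cmod (s i x - \<phi> x))\<^sup>2) \<longlonglongrightarrow> 0"
    proof (rule AE_I2)
      fix x assume "x \<in> space M"
      then have "(\<lambda>i. (cmod (s i x - \<phi> x))\<^sup>2) \<longlonglongrightarrow> (cmod (\<phi> x - \<phi> x))\<^sup>2"
        by (intro tendsto_intros s(2))
      then show "(\<lambda>i. (cmod (s i x - \<phi> x))\<^sup>2) \<longlonglongrightarrow> 0" by simp
    qed
  qed (use \<phi> in auto)
  then show ?thesis using s(1) sL2 by auto
qed

locale random_measure = finite_measure \<mu> for \<mu> :: "real measure" +
  fixes M :: "'a measure" and W :: "real set \<Rightarrow> 'a \<Rightarrow> complex"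
  assumes orth: "orthogonal_random_measure M \<mu> W"
begin

lemma W_L2: "A \<in> sets \<mu> \<Longrightarrow> W A \<in> L2 M"
  and sqnorm_W: "A \<in> sets \<mu> \<Longrightarrow> sqnorm M (W A) = measure \<mu> A"
  and W_add: "A \<in> sets \<mu> \<Longrightarrow> C \<in> sets \<mu> \<Longrightarrow> A \<inter> C = {} \<Longrightarrow> AE x in M. W (A \<union> C) x = W A x + W C x"
  and W_orth: "A \<in> sets \<mu> \<Longrightarrow> C \<in> sets \<mu> \<Longrightarrow> A \<inter> C = {} \<Longrightarrow> (\<integral>x. W A x * cnj (W C x) \<partial>M) = 0"
  using orth unfolding orthogonal_random_measure_def by blast+

lemma W_empty: "AE x in M. W {} x = 0"
  using sqnorm_0_iff[OF W_L2[of "{}"]] sqnorm_W[of "{}"] by simp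

lemma W_UN:
  assumes "finite I" "\<And>i. i \<in> I \<Longrightarrow> A i \<in> sets \<mu>" "disjoint_family_on A I"
  shows "AE x in M. W (\<Union>i\<in>I. A i) x = (\<Sum>i\<in>I. W (A i) x)"
  using assms
proof (induction I)
  case empty then show ?case using W_empty by simp
next
  case (insert i I)
  have "AE x in M. W (A i \<union> (\<Union>i\<in>I. A i)) x = W (A i) x + W (\<Union>i\<in>I. A i) x"
    using insert.prems insert.hyps by (intro W_add) (auto simp: disjoint_family_on_def)
  moreover have "AE x in M. W (\<Union>i\<in>I. A i) x = (\<Sum>i\<in>I. W (A i) x)"
    using insert.prems by (intro insert.IH) (auto simp: disjoint_family_on_def)
  ultimately show ?case
  proof eventually_elim
    case (elim x) then show ?case using insert.hyps by simp
  qed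
qed

text \<open>The integral of a simple function may be computed from any finer partition; applied to the
  common refinement of two simple functions this gives additivity.\<close>

lemma simple_stoch_integral_refine:
  assumes h: "simple_function \<mu> h" and \<phi>: "\<And>u. u \<in> space \<mu> \<Longrightarrow> \<phi> u = a (h u)"
  shows "AE x in M. simple_stoch_integral \<mu> W \<phi> x = (\<Sum>c\<in>h ` space \<mu>. a c * W (h -` {c} \<inter> space \<mu>) x)"
proof -
  define A where "A c = h -` {c} \<inter> space \<mu>" for c
  define H where "H y = {c \<in> h ` space \<mu>. a c = y}" for y
  have fin: "finite (h ` space \<mu>)" using h by (simp add: simple_function_def)
  have A: "A c \<in> sets \<mu>" for c using simple_functionD(2)[OF h] by (simp add: A_def)
  have im: "\<phi> ` space \<mu> = a ` h ` space \<mu>" using \<phi> by (auto simp: image_image)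
  have pre: "\<phi> -` {y} \<inter> space \<mu> = (\<Union>c\<in>H y. A c)" for y
    using \<phi> by (auto simp: H_def A_def)
  have "AE x in M. W (\<Union>c\<in>H y. A c) x = (\<Sum>c\<in>H y. W (A c) x)" for y
    using fin by (intro W_UN A) (auto simp: H_def disjoint_family_on_def A_def)
  then have "AE x in M. \<forall>y \<in> \<phi> ` space \<mu>. W (\<Union>c\<in>H y. A c) x = (\<Sum>c\<in>H y. W (A c) x)"
    using fin by (intro AE_finite_allI) (auto simp: im)
  then show ?thesis
  proof eventually_elim
    case (elim x)
    have "simple_stoch_integral \<mu> W \<phi> x = (\<Sum>y\<in>\<phi> ` space \<mu>. y * (\<Sum>c\<in>H y. W (A c) x))"
      unfolding simple_stoch_integral_def pre using elim by (intro sum.cong) auto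
    also have "\<dots> = (\<Sum>y\<in>\<phi> ` space \<mu>. \<Sum>c\<in>H y. a c * W (A c) x)"
      by (auto simp: sum_distrib_left H_def intro!: sum.cong)
    also have "\<dots> = (\<Sum>c\<in>h ` space \<mu>. a c * W (A c) x)"
      unfolding H_def using fin by (intro sum.group) (auto simp: im)
    finally show ?case by (simp add: A_def)
  qed
qed

lemma simple_stoch_integral_add:
  assumes "simple_function \<mu> \<phi>" "simple_function \<mu> \<psi>"
  shows "AE x in M. simple_stoch_integral \<mu> W (\<lambda>u. \<phi> u + \<psi> u) x =
     simple_stoch_integral \<mu> W \<phi> x + simple_stoch_integral \<mu> W \<psi> x"
proof -
  have h: "simple_function \<mu> (\<lambda>u. (\<phi> u, \<psi> u))" using assms by (rule simple_function_Pair)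
  have "AE x in M. simple_stoch_integral \<mu> W \<phi> x =
      (\<Sum>c\<in>(\<lambda>u. (\<phi> u, \<psi> u)) ` space \<mu>. fst c * W ((\<lambda>u. (\<phi> u, \<psi> u)) -` {c} \<inter> space \<mu>) x)"
    and "AE x in M. simple_stoch_integral \<mu> W \<psi> x =
      (\<Sum>c\<in>(\<lambda>u. (\<phi> u, \<psi> u)) ` space \<mu>. snd c * W ((\<lambda>u. (\<phi> u, \<psi> u)) -` {c} \<inter> space \<mu>) x)"
    and "AE x in M. simple_stoch_integral \<mu> W (\<lambda>u. \<phi> u + \<psi> u) x =
      (\<Sum>c\<in>(\<lambda>u. (\<phi> u, \<psi> u)) ` space \<mu>. (fst c + snd c) * W ((\<lambda>u. (\<phi> u, \<psi> u)) -` {c} \<inter> space \<mu>) x)"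
    by (intro simple_stoch_integral_refine[OF h, of _ fst] simple_stoch_integral_refine[OF h, of _ snd]
      simple_stoch_integral_refine[OF h, of _ "\<lambda>c. fst c + snd c"]; simp)+
  then show ?thesis
    by eventually_elim (simp add: sum.distrib[symmetric] distrib_right)
qed

lemma simple_stoch_integral_scale:
  assumes "simple_function \<mu> \<phi>"
  shows "AE x in M. simple_stoch_integral \<mu> W (\<lambda>u. c * \<phi> u) x = c * simple_stoch_integral \<mu> W \<phi> x"
  using simple_stoch_integral_refine[OF assms, of "\<lambda>u. c * \<phi> u" "\<lambda>y. c * y", OF refl]
    simple_stoch_integral_refine[OF assms, of \<phi> "\<lambda>y. y", OF refl]
  by eventually_elim (simp add: sum_distrib_left mult.assoc)

lemma simple_stoch_integral_L2:
  assumes s: "simple_function \<mu> s"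
  shows "simple_stoch_integral \<mu> W s \<in> L2 M"
proof -
  have "(\<lambda>x. \<Sum>y \<in> s ` space \<mu>. y * W (s -` {y} \<inter> space \<mu>) x) \<in> L2 M"
    by (intro L2_sum L2_scale W_L2 simple_functionD(2)[OF s])
  then show ?thesis by (simp add: simple_stoch_integral_def[abs_def])
qed

lemma simple_stoch_integral_isometry:
  assumes s: "simple_function \<mu> s"
  shows "sqnorm M (simple_stoch_integral \<mu> W s) = sqnorm \<mu> s"
proof -
  define A where "A y = s -` {y} \<inter> space \<mu>" for y
  define R where "R = s ` space \<mu>"
  have fin: "finite R" using s by (simp add: simple_function_def R_def)
  have A[measurable]: "A y \<in> sets \<mu>" for y using simple_functionD(2)[OF s] by (simp add: A_def)
  have int: "integrable M (\<lambda>x. y * cnj z * (W (A y) x * cnj (W (A z) x)))" for y z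
    by (intro integrable_mult_right L2_mult_integrable L2_cnj W_L2 A)
  have WW: "(\<integral>x. W (A y) x * cnj (W (A z) x) \<partial>M) = (if y = z then of_real (measure \<mu> (A y)) else 0)" for y z
  proof (cases "y = z")
    case True
    have "(\<integral>x. W (A y) x * cnj (W (A y) x) \<partial>M) = of_real (sqnorm M (W (A y)))"
      unfolding complex_norm_square[symmetric] sqnorm_def by (rule integral_complex_of_real)
    with True show ?thesis by (simp add: sqnorm_W A)
  next
    case False then show ?thesis by (simp add: W_orth A_def[symmetric] A) (rule W_orth, auto simp: A, auto simp: A_def)
  qed
  have "complex_of_real (sqnorm M (simple_stoch_integral \<mu> W s)) =
     (\<integral>x. (\<Sum>y\<in>R. y * W (A y) x) * cnj (\<Sum>z\<in>R. z * W (A z) x) \<partial>M)"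
    unfolding sqnorm_def simple_stoch_integral_def R_def A_def integral_complex_of_real[symmetric]
      complex_norm_square ..
  also have "\<dots> = (\<integral>x. (\<Sum>y\<in>R. \<Sum>z\<in>R. y * cnj z * (W (A y) x * cnj (W (A z) x))) \<partial>M)"
    by (simp add: sum_product algebra_simps)
  also have "\<dots> = (\<Sum>y\<in>R. \<Sum>z\<in>R. y * cnj z * (\<integral>x. W (A y) x * cnj (W (A z) x) \<partial>M))"
    using int by (simp add: Bochner_Integration.integral_sum Bochner_Integration.integrable_sum)
  also have "\<dots> = (\<Sum>y\<in>R. y * cnj y * of_real (measure \<mu> (A y)))"
    unfolding WW using fin by (simp add: if_distrib[of "\<lambda>x. _ * x"] sum.delta cong: if_cong)
  also have "\<dots> = of_real (\<Sum>y\<in>R. (cmod y)\<^sup>2 * measure \<mu> (A y))"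
    unfolding of_real_sum of_real_mult complex_norm_square ..
  also have "(\<Sum>y\<in>R. (cmod y)\<^sup>2 * measure \<mu> (A y)) = (\<integral>u. (\<Sum>y\<in>R. (cmod y)\<^sup>2 * indicator (A y) u) \<partial>\<mu>)"
    by (subst Bochner_Integration.integral_sum)
      (auto intro!: integrable_mult_right integrable_real_indicator simp: emeasure_eq_measure)
  also have "\<dots> = sqnorm \<mu> s"
    unfolding sqnorm_def
  proof (rule Bochner_Integration.integral_cong)
    fix u assume u: "u \<in> space \<mu>"
    have "(\<Sum>y\<in>R. (cmod y)\<^sup>2 * indicator (A y) u) = (\<Sum>y\<in>R. if y = s u then (cmod (s u))\<^sup>2 else 0)"
      using u by (intro sum.cong) (auto simp: A_def indicator_def)
    also have "\<dots> = (cmod (s u))\<^sup>2" using u fin by (auto simp: R_def)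
    finally show "(\<Sum>y\<in>R. (cmod y)\<^sup>2 * indicator (A y) u) = (cmod (s u))\<^sup>2" .
  qed simp
  finally show ?thesis by (simp only: of_real_eq_iff)
qed

lemma has_stoch_integralD:
  assumes "has_stoch_integral M \<mu> W \<phi> \<xi>" shows "\<phi> \<in> L2 \<mu>" "\<xi> \<in> L2 M"
  using assms by (auto simp: has_stoch_integral_def)

lemma has_stoch_integral_approx:
  assumes "has_stoch_integral M \<mu> W \<phi> \<xi>"
  obtains s where "\<And>n::nat. simple_function \<mu> (s n)" "\<And>n. s n \<in> L2 \<mu>"
    "(\<lambda>n. sqnorm \<mu> (\<lambda>u. s n u - \<phi> u)) \<longlonglongrightarrow> 0"
    "(\<lambda>n. sqnorm M (\<lambda>x. simple_stoch_integral \<mu> W (s n) x - \<xi> x)) \<longlonglongrightarrow> 0"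
  using assms unfolding has_stoch_integral_def by blast

lemma stoch_integral_isometry:
  assumes "has_stoch_integral M \<mu> W \<phi> \<xi>" shows "sqnorm M \<xi> = sqnorm \<mu> \<phi>"
proof -
  from assms obtain s where s: "\<And>n::nat. simple_function \<mu> (s n)" "\<And>n. s n \<in> L2 \<mu>"
    "(\<lambda>n. sqnorm \<mu> (\<lambda>u. s n u - \<phi> u)) \<longlonglongrightarrow> 0"
    "(\<lambda>n. sqnorm M (\<lambda>x. simple_stoch_integral \<mu> W (s n) x - \<xi> x)) \<longlonglongrightarrow> 0"
    by (rule has_stoch_integral_approx) blast
  have "(\<lambda>n. sqnorm \<mu> (s n)) \<longlonglongrightarrow> sqnorm \<mu> \<phi>"
    by (rule sqnorm_limit[OF s(2) has_stoch_integralD(1)[OF assms] s(3)])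
  moreover have "(\<lambda>n. sqnorm \<mu> (s n)) \<longlonglongrightarrow> sqnorm M \<xi>"
    using sqnorm_limit[OF simple_stoch_integral_L2[OF s(1)] has_stoch_integralD(2)[OF assms] s(4)]
    by (simp add: simple_stoch_integral_isometry[OF s(1)])
  ultimately show ?thesis using LIMSEQ_unique by blast
qed

lemma has_stoch_integral_add:
  assumes a: "has_stoch_integral M \<mu> W \<phi> \<xi>" and b: "has_stoch_integral M \<mu> W \<psi> \<eta>"
  shows "has_stoch_integral M \<mu> W (\<lambda>u. \<phi> u + \<psi> u) (\<lambda>x. \<xi> x + \<eta> x)"
proof -
  from a obtain s where s: "\<And>n::nat. simple_function \<mu> (s n)" "\<And>n. s n \<in> L2 \<mu>"
    "(\<lambda>n. sqnorm \<mu> (\<lambda>u. s n u - \<phi> u)) \<longlonglongrightarrow> 0"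
    "(\<lambda>n. sqnorm M (\<lambda>x. simple_stoch_integral \<mu> W (s n) x - \<xi> x)) \<longlonglongrightarrow> 0"
    by (rule has_stoch_integral_approx) blast
  from b obtain r where r: "\<And>n::nat. simple_function \<mu> (r n)" "\<And>n. r n \<in> L2 \<mu>"
    "(\<lambda>n. sqnorm \<mu> (\<lambda>u. r n u - \<psi> u)) \<longlonglongrightarrow> 0"
    "(\<lambda>n. sqnorm M (\<lambda>x. simple_stoch_integral \<mu> W (r n) x - \<eta> x)) \<longlonglongrightarrow> 0"
    by (rule has_stoch_integral_approx) blast
  note L = has_stoch_integralD[OF a] has_stoch_integralD[OF b]
  define q where "q n u = s n u + r n u" for n u
  have q: "simple_function \<mu> (q n)" "q n \<in> L2 \<mu>" for n
    unfolding q_def using s r by (auto intro!: simple_function_add L2_add)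
  have q1: "(\<lambda>n. sqnorm \<mu> (\<lambda>u. q n u - (\<phi> u + \<psi> u))) \<longlonglongrightarrow> 0"
    by (rule tendsto_sqnorm_add[OF s(2) L(1) r(2) L(3) q(2) s(3) r(3)]) (simp add: q_def)
  have q2: "(\<lambda>n. sqnorm M (\<lambda>x. simple_stoch_integral \<mu> W (q n) x - (\<xi> x + \<eta> x))) \<longlonglongrightarrow> 0"
    using simple_stoch_integral_add[OF s(1) r(1)] L s(4) r(4)
    by (intro tendsto_sqnorm_add[where f = "\<lambda>n. simple_stoch_integral \<mu> W (s n)"
          and g = "\<lambda>n. simple_stoch_integral \<mu> W (r n)"])
      (auto simp: q_def[abs_def] intro!: simple_stoch_integral_L2 s(1) r(1) q(1)[unfolded q_def[abs_def]])
  show ?thesis unfolding has_stoch_integral_def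
    using L q q1 q2 by (auto intro!: L2_add exI[of _ q])
qed

lemma has_stoch_integral_scale:
  assumes a: "has_stoch_integral M \<mu> W \<phi> \<xi>"
  shows "has_stoch_integral M \<mu> W (\<lambda>u. c * \<phi> u) (\<lambda>x. c * \<xi> x)"
proof -
  from a obtain s where s: "\<And>n::nat. simple_function \<mu> (s n)" "\<And>n. s n \<in> L2 \<mu>"
    "(\<lambda>n. sqnorm \<mu> (\<lambda>u. s n u - \<phi> u)) \<longlonglongrightarrow> 0"
    "(\<lambda>n. sqnorm M (\<lambda>x. simple_stoch_integral \<mu> W (s n) x - \<xi> x)) \<longlonglongrightarrow> 0"
    by (rule has_stoch_integral_approx) blast
  note L = has_stoch_integralD[OF a]
  let ?S = "simple_stoch_integral \<mu> W"
  have 1: "simple_function \<mu> (\<lambda>u. c * s n u)" for n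
    using s(1) by (intro simple_function_mult) auto
  have "sqnorm M (\<lambda>x. ?S (\<lambda>u. c * s n u) x - c * \<xi> x) = (cmod c)\<^sup>2 * sqnorm M (\<lambda>x. ?S (s n) x - \<xi> x)" for n
    unfolding sqnorm_scale[symmetric]
  proof (rule sqnorm_cong_AE)
    show "(\<lambda>x. ?S (\<lambda>u. c * s n u) x - c * \<xi> x) \<in> borel_measurable M"
      using L s 1 by (intro L2_measurable L2_diff L2_scale simple_stoch_integral_L2)
    show "(\<lambda>x. c * (?S (s n) x - \<xi> x)) \<in> borel_measurable M"
      using L s by (intro L2_measurable L2_diff L2_scale simple_stoch_integral_L2)
    show "AE x in M. ?S (\<lambda>u. c * s n u) x - c * \<xi> x = c * (?S (s n) x - \<xi> x)"
      using simple_stoch_integral_scale[OF s(1), of c n] by eventually_elim (simp add: algebra_simps)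
  qed
  moreover have "sqnorm \<mu> (\<lambda>u. c * s n u - c * \<phi> u) = (cmod c)\<^sup>2 * sqnorm \<mu> (\<lambda>u. s n u - \<phi> u)" for n
    unfolding sqnorm_scale[symmetric] by (simp add: algebra_simps)
  ultimately show ?thesis unfolding has_stoch_integral_def
    using L s 1 tendsto_mult_right_zero[OF s(3), of "(cmod c)\<^sup>2"] tendsto_mult_right_zero[OF s(4), of "(cmod c)\<^sup>2"]
    by (auto intro!: L2_scale exI[of _ "\<lambda>n u. c * s n u"])
qed

lemma has_stoch_integral_diff:
  assumes "has_stoch_integral M \<mu> W \<phi> \<xi>" "has_stoch_integral M \<mu> W \<psi> \<eta>"
  shows "has_stoch_integral M \<mu> W (\<lambda>u. \<phi> u - \<psi> u) (\<lambda>x. \<xi> x - \<eta> x)"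
  using has_stoch_integral_add[OF assms(1) has_stoch_integral_scale[OF assms(2), of "-1"]] by simp

lemma has_stoch_integral_sum:
  assumes "\<And>i. i \<in> F \<Longrightarrow> has_stoch_integral M \<mu> W (\<phi> i) (\<xi> i)" "finite F"
    and "has_stoch_integral M \<mu> W \<psi> \<eta>"
  shows "has_stoch_integral M \<mu> W (\<lambda>u. \<Sum>i\<in>F. c i * \<phi> i u) (\<lambda>x. \<Sum>i\<in>F. c i * \<xi> i x)"
  using assms(2,1)
proof (induction F)
  case empty
  then show ?case using has_stoch_integral_scale[OF assms(3), of 0] by simp
next
  case (insert i F)
  then show ?case by (auto intro!: has_stoch_integral_add has_stoch_integral_scale)
qed

lemma has_stoch_integral_exists:
  assumes \<phi>: "\<phi> \<in> L2 \<mu>" shows "\<exists>\<xi>. has_stoch_integral M \<mu> W \<phi> \<xi>"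
proof -
  let ?S = "simple_stoch_integral \<mu> W"
  obtain s where s: "\<And>n::nat. simple_function \<mu> (s n)" "\<And>n. s n \<in> L2 \<mu>"
    "(\<lambda>n. sqnorm \<mu> (\<lambda>u. s n u - \<phi> u)) \<longlonglongrightarrow> 0"
    using L2_simple_approx[OF \<phi>] by blast
  have d: "sqnorm M (\<lambda>x. ?S (s m) x - ?S (s n) x) = sqnorm \<mu> (\<lambda>u. s m u - s n u)" for m n
  proof -
    have m: "simple_function \<mu> (\<lambda>u. - 1 * s n u)" by (intro simple_function_mult s) auto
    have a: "simple_function \<mu> (\<lambda>u. s m u + - 1 * s n u)" by (intro simple_function_add s m)
    have "sqnorm M (\<lambda>x. ?S (s m) x - ?S (s n) x) = sqnorm M (?S (\<lambda>u. s m u + - 1 * s n u))"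
    proof (rule sqnorm_cong_AE)
      show "AE x in M. ?S (s m) x - ?S (s n) x = ?S (\<lambda>u. s m u + - 1 * s n u) x"
        using simple_stoch_integral_add[OF s(1)[of m] m] simple_stoch_integral_scale[OF s(1)[of n], of "-1"]
        by eventually_elim simp
    qed (use s a in \<open>auto intro!: L2_measurable L2_diff simple_stoch_integral_L2\<close>)
    then show ?thesis unfolding simple_stoch_integral_isometry[OF a] by simp
  qed
  have "\<exists>\<xi> \<in> L2 M. (\<lambda>n. sqnorm M (\<lambda>x. ?S (s n) x - \<xi> x)) \<longlonglongrightarrow> 0"
    by (rule L2_complete) (use s d in \<open>auto intro!: simple_stoch_integral_L2 L2_convergent_Cauchy[OF s(2) \<phi> s(3)]\<close>)
  then show ?thesis unfolding has_stoch_integral_def using \<phi> s by blast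
qed

lemma has_stoch_integral_cong_random:
  assumes a: "has_stoch_integral M \<mu> W \<phi> \<xi>" and eq: "AE x in M. \<xi> x = \<eta> x" and \<eta>: "\<eta> \<in> L2 M"
  shows "has_stoch_integral M \<mu> W \<phi> \<eta>"
proof -
  have "sqnorm M (\<lambda>x. simple_stoch_integral \<mu> W s x - \<xi> x) = sqnorm M (\<lambda>x. simple_stoch_integral \<mu> W s x - \<eta> x)"
    if "simple_function \<mu> s" for s
  proof (rule sqnorm_cong_AE)
    show "AE x in M. simple_stoch_integral \<mu> W s x - \<xi> x = simple_stoch_integral \<mu> W s x - \<eta> x"
      using eq by eventually_elim simp
  qed (use that \<eta> has_stoch_integralD[OF a] in \<open>auto intro!: L2_measurable L2_diff simple_stoch_integral_L2\<close>)
  moreover from a obtain s where s: "\<And>n::nat. simple_function \<mu> (s n)" "\<And>n. s n \<in> L2 \<mu>"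
    "(\<lambda>n. sqnorm \<mu> (\<lambda>u. s n u - \<phi> u)) \<longlonglongrightarrow> 0"
    "(\<lambda>n. sqnorm M (\<lambda>x. simple_stoch_integral \<mu> W (s n) x - \<xi> x)) \<longlonglongrightarrow> 0"
    by (rule has_stoch_integral_approx) blast
  ultimately show ?thesis
    unfolding has_stoch_integral_def using \<eta> has_stoch_integralD[OF a] by (auto intro!: exI[of _ s])
qed

lemma spectral_fun_unique:
  assumes "has_stoch_integral M \<mu> W \<phi> \<xi>" "has_stoch_integral M \<mu> W \<psi> \<xi>"
  shows "AE u in \<mu>. \<phi> u = \<psi> u"
proof -
  have "sqnorm \<mu> (\<lambda>u. \<phi> u - \<psi> u) = 0"
    using stoch_integral_isometry[OF has_stoch_integral_diff[OF assms]] by (simp add: sqnorm_def)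
  then show ?thesis
    using sqnorm_0_iff[OF L2_diff[OF has_stoch_integralD(1)[OF assms(1)] has_stoch_integralD(1)[OF assms(2)]]]
    by simp
qed

end

section \<open>Reduction to weighted approximation by trigonometric polynomials\<close>

definition trig :: "int \<Rightarrow> real \<Rightarrow> complex" where
  "trig s u = cis (of_int s * u)"

locale stationary_model = random_measure \<mu> M W
  for \<mu> :: "real measure" and M :: "'a measure" and W :: "real set \<Rightarrow> 'a \<Rightarrow> complex" +
  fixes B :: "int \<Rightarrow> 'a \<Rightarrow> complex"
  assumes repr: "\<And>t. has_stoch_integral M \<mu> W (trig t) (B t)"
begin

lemma trig_L2: "trig s \<in> L2 \<mu>" and B_L2: "B s \<in> L2 M"
  using has_stoch_integralD[OF repr] by auto

lemma stoch_integral_trig_sum: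
  assumes "finite F"
  shows "has_stoch_integral M \<mu> W (\<lambda>u. \<Sum>s\<in>F. c s * trig s u) (\<lambda>x. \<Sum>s\<in>F. c s * B s x)"
  by (rule has_stoch_integral_sum[OF repr assms repr])

lemma stoch_integral_in_closed_span_iff:
  assumes "has_stoch_integral M \<mu> W \<phi> \<xi>"
  shows "\<xi> \<in> closed_span M B S \<longleftrightarrow> \<phi> \<in> closed_span \<mu> trig S"
proof -
  have "sqnorm M (\<lambda>x. \<xi> x - (\<Sum>s\<in>F. c s * B s x)) = sqnorm \<mu> (\<lambda>u. \<phi> u - (\<Sum>s\<in>F. c s * trig s u))"
    if "finite F" for F c
    by (rule stoch_integral_isometry[OF has_stoch_integral_diff[OF assms stoch_integral_trig_sum[OF that]]])
  then show ?thesis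
    unfolding closed_span_def using has_stoch_integralD[OF assms] by (auto cong: conj_cong)
qed

text \<open>The spectral functions of approximating sums form a Cauchy sequence by the isometry. Their limit
  has a stochastic integral, which must agree with \<open>\<xi>\<close>.\<close>

lemma spectral_fun_exists:
  assumes "\<xi> \<in> closed_span M B S"
  shows "has_stoch_integral M \<mu> W (spectral_fun M \<mu> W \<xi>) \<xi>"
proof -
  have \<xi>: "\<xi> \<in> L2 M" using assms by (rule closed_spanD)
  have "\<exists>p. (\<forall>n::nat. finite (fst (p n))) \<and>
      (\<lambda>n. sqnorm M (\<lambda>x. \<xi> x - (\<Sum>s\<in>fst (p n). snd (p n) s * B s x))) \<longlonglongrightarrow> 0"
  proof (rule ex_seq_tendsto_0)
    fix e :: real assume "e > 0"
    with assms obtain F c where "finite F" "sqnorm M (\<lambda>x. \<xi> x - (\<Sum>s\<in>F. c s * B s x)) < e"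
      unfolding closed_span_def by blast
    then show "\<exists>y. finite (fst y) \<and> sqnorm M (\<lambda>x. \<xi> x - (\<Sum>s\<in>fst y. snd y s * B s x)) < e"
      by (intro exI[of _ "(F, c)"]) simp
  qed simp
  then obtain p where fin: "\<And>n::nat. finite (fst (p n))"
    and lim: "(\<lambda>n. sqnorm M (\<lambda>x. \<xi> x - (\<Sum>s\<in>fst (p n). snd (p n) s * B s x))) \<longlonglongrightarrow> 0" by blast
  define \<phi> where "\<phi> n u = (\<Sum>s\<in>fst (p n). snd (p n) s * trig s u)" for n u
  define \<eta> where "\<eta> n x = (\<Sum>s\<in>fst (p n). snd (p n) s * B s x)" for n x
  have h: "has_stoch_integral M \<mu> W (\<phi> n) (\<eta> n)" for n
    unfolding \<phi>_def \<eta>_def by (rule stoch_integral_trig_sum[OF fin])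
  note L = has_stoch_integralD[OF h]
  have lim: "(\<lambda>n. sqnorm M (\<lambda>x. \<eta> n x - \<xi> x)) \<longlonglongrightarrow> 0"
    using lim by (simp add: \<eta>_def sqnorm_minus_commute[of M \<xi>])
  have "\<exists>g \<in> L2 \<mu>. (\<lambda>n. sqnorm \<mu> (\<lambda>u. \<phi> n u - g u)) \<longlonglongrightarrow> 0"
  proof (rule L2_complete[OF L(1)])
    fix e :: real assume "e > 0"
    from L2_convergent_Cauchy[OF L(2) \<xi> lim this]
    show "\<exists>N. \<forall>m\<ge>N. \<forall>n\<ge>N. sqnorm \<mu> (\<lambda>x. \<phi> m x - \<phi> n x) < e"
      by (simp add: stoch_integral_isometry[OF has_stoch_integral_diff[OF h h]])
  qed
  then obtain g where g: "g \<in> L2 \<mu>" "(\<lambda>n. sqnorm \<mu> (\<lambda>u. \<phi> n u - g u)) \<longlonglongrightarrow> 0" by blast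
  obtain \<zeta> where z: "has_stoch_integral M \<mu> W g \<zeta>" using has_stoch_integral_exists[OF g(1)] by blast
  have "(\<lambda>n. sqnorm M (\<lambda>x. \<eta> n x - \<zeta> x)) \<longlonglongrightarrow> 0"
    using g(2) by (simp add: stoch_integral_isometry[OF has_stoch_integral_diff[OF h z]])
  from L2_limit_unique[OF L(2) has_stoch_integralD(2)[OF z] \<xi> this lim]
  have "has_stoch_integral M \<mu> W g \<xi>" by (rule has_stoch_integral_cong_random[OF z _ \<xi>])
  then show ?thesis unfolding spectral_fun_def by (rule someI[of "\<lambda>\<phi>. has_stoch_integral M \<mu> W \<phi> \<xi>"])
qed

definition weighted_error :: "(real \<Rightarrow> complex) \<Rightarrow> (real \<Rightarrow> complex) \<Rightarrow> real" where
  "weighted_error \<l> \<phi> = sqnorm \<mu> (\<lambda>u. \<phi> u - 1) + sqnorm \<mu> (\<lambda>u. \<l> u * \<phi> u)"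

lemma trig_0: "trig 0 = (\<lambda>u. 1)"
  by (simp add: trig_def fun_eq_iff)

lemma stoch_integral_SOME:
  assumes "\<phi> \<in> L2 \<mu>" shows "has_stoch_integral M \<mu> W \<phi> (stoch_integral M \<mu> W \<phi>)"
  unfolding stoch_integral_def using has_stoch_integral_exists[OF assms] by (rule someI_ex)

text \<open>Spectral functions are unique almost everywhere, so the errors can be computed from any
  representative \<open>\<phi>\<close> in place of the chosen one.\<close>

lemma filter_error:
  assumes \<l>: "\<l> \<in> borel_measurable \<mu>" and h: "has_stoch_integral M \<mu> W \<phi> Y"
    and d: "(\<lambda>u. \<l> u * \<phi> u) \<in> L2 \<mu>" and Y: "Y \<in> closed_span M B UNIV"
  shows "sqnorm M (\<lambda>x. Y x - B 0 x) + sqnorm M (linear_filter M \<mu> W \<l> Y) = weighted_error \<l> \<phi>"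
    and "Y \<in> filter_domain M B \<mu> W \<l>"
proof -
  define \<psi> where "\<psi> = spectral_fun M \<mu> W Y"
  have \<psi>: "has_stoch_integral M \<mu> W \<psi> Y" unfolding \<psi>_def by (rule spectral_fun_exists[OF Y])
  have eq: "AE u in \<mu>. \<phi> u = \<psi> u" by (rule spectral_fun_unique[OF h \<psi>])
  have [measurable]: "\<psi> \<in> borel_measurable \<mu>" "\<phi> \<in> borel_measurable \<mu>" "\<l> \<in> borel_measurable \<mu>"
    using has_stoch_integralD[OF h] has_stoch_integralD[OF \<psi>] \<l> by auto
  have eq': "AE u in \<mu>. \<l> u * \<phi> u = \<l> u * \<psi> u" using eq by eventually_elim simp
  have L: "(\<lambda>u. \<l> u * \<psi> u) \<in> L2 \<mu>" by (rule L2_cong_AE[OF d _ eq']) measurable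
  show "Y \<in> filter_domain M B \<mu> W \<l>"
    using Y L unfolding filter_domain_def \<psi>_def by auto
  have "sqnorm M (linear_filter M \<mu> W \<l> Y) = sqnorm \<mu> (\<lambda>u. \<l> u * \<psi> u)"
    unfolding linear_filter_def \<psi>_def[symmetric] by (rule stoch_integral_isometry[OF stoch_integral_SOME[OF L]])
  also have "\<dots> = sqnorm \<mu> (\<lambda>u. \<l> u * \<phi> u)"
    by (rule sqnorm_cong_AE) (use eq' in auto)
  moreover have "sqnorm M (\<lambda>x. Y x - B 0 x) = sqnorm \<mu> (\<lambda>u. \<phi> u - 1)"
    using stoch_integral_isometry[OF has_stoch_integral_diff[OF h repr[of 0]]] by (simp add: trig_0)
  ultimately show "sqnorm M (\<lambda>x. Y x - B 0 x) + sqnorm M (linear_filter M \<mu> W \<l> Y) = weighted_error \<l> \<phi>"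
    by (simp add: weighted_error_def)
qed

lemma pred_error_spectral:
  assumes \<l>: "\<l> \<in> borel_measurable \<mu>"
  shows "pred_error M B \<mu> W \<l> S =
     (INF \<phi> \<in> {\<phi> \<in> closed_span \<mu> trig S. (\<lambda>u. \<l> u * \<phi> u) \<in> L2 \<mu>}. weighted_error \<l> \<phi>)"
proof -
  have "(\<lambda>Y. sqnorm M (\<lambda>x. Y x - B 0 x) + sqnorm M (linear_filter M \<mu> W \<l> Y)) `
       (closed_span M B S \<inter> filter_domain M B \<mu> W \<l>) =
     weighted_error \<l> ` {\<phi> \<in> closed_span \<mu> trig S. (\<lambda>u. \<l> u * \<phi> u) \<in> L2 \<mu>}" (is "?J ` ?D = _ ` ?E")
  proof (intro equalityI subsetI)
    fix r assume "r \<in> ?J ` ?D"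
    then obtain Y where Y: "Y \<in> closed_span M B S" "Y \<in> filter_domain M B \<mu> W \<l>" "r = ?J Y" by blast
    define \<psi> where "\<psi> = spectral_fun M \<mu> W Y"
    have \<psi>: "has_stoch_integral M \<mu> W \<psi> Y" unfolding \<psi>_def by (rule spectral_fun_exists[OF Y(1)])
    have [measurable]: "\<psi> \<in> borel_measurable \<mu>" "\<l> \<in> borel_measurable \<mu>"
      using has_stoch_integralD[OF \<psi>] \<l> by auto
    have d: "(\<lambda>u. \<l> u * \<psi> u) \<in> L2 \<mu>"
      by (rule L2I) (use Y(2) in \<open>auto simp: filter_domain_def \<psi>_def[symmetric]\<close>)
    have U: "Y \<in> closed_span M B UNIV" using Y(2) by (simp add: filter_domain_def)
    show "r \<in> weighted_error \<l> ` ?E"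
      using filter_error(1)[OF \<l> \<psi> d U] Y d stoch_integral_in_closed_span_iff[OF \<psi>, of S] by auto
  next
    fix r assume "r \<in> weighted_error \<l> ` ?E"
    then obtain \<phi> where p: "\<phi> \<in> closed_span \<mu> trig S" "(\<lambda>u. \<l> u * \<phi> u) \<in> L2 \<mu>" "r = weighted_error \<l> \<phi>"
      by blast
    define Y where "Y = stoch_integral M \<mu> W \<phi>"
    have h: "has_stoch_integral M \<mu> W \<phi> Y"
      unfolding Y_def by (rule stoch_integral_SOME[OF closed_spanD[OF p(1)]])
    have Y: "Y \<in> closed_span M B S" using p(1) stoch_integral_in_closed_span_iff[OF h] by simp
    then have U: "Y \<in> closed_span M B UNIV" using closed_span_mono[of S UNIV] by blast
    show "r \<in> ?J ` ?D"
      using filter_error[OF \<l> h p(2) U] p(3) Y by force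
  qed
  then show ?thesis unfolding pred_error_def by simp
qed

definition wiener_filter :: "(real \<Rightarrow> complex) \<Rightarrow> real \<Rightarrow> complex" where
  "wiener_filter \<l> u = complex_of_real (1 / (1 + (cmod (\<l> u))\<^sup>2))"

lemma complete_square:
  fixes p l :: complex
  defines "w \<equiv> 1 + (cmod l)\<^sup>2"
  shows "(cmod (p - 1))\<^sup>2 + (cmod (l * p))\<^sup>2 = (cmod l)\<^sup>2 / w + w * (cmod (p - complex_of_real (1 / w)))\<^sup>2"
proof -
  have w: "w > 0" by (simp add: w_def add_pos_nonneg)
  have l: "(cmod l)\<^sup>2 = w - 1" by (simp add: w_def)
  have sq: "(cmod (p - 1))\<^sup>2 = (Re p - 1)\<^sup>2 + (Im p)\<^sup>2"
    "(cmod (p - complex_of_real (1 / w)))\<^sup>2 = (Re p - 1 / w)\<^sup>2 + (Im p)\<^sup>2"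
    "(cmod (l * p))\<^sup>2 = (w - 1) * ((Re p)\<^sup>2 + (Im p)\<^sup>2)"
    unfolding norm_mult power_mult_distrib l by (simp_all add: cmod_power2)
  show ?thesis
    unfolding sq l using w by (simp add: field_simps power2_eq_square)
qed

lemma wiener_filter_bounds:
  "cmod (wiener_filter \<l> u) \<le> 1" "cmod (\<l> u * wiener_filter \<l> u) \<le> 1"
proof -
  have w: "1 + (cmod (\<l> u))\<^sup>2 \<ge> 1" by simp
  show "cmod (wiener_filter \<l> u) \<le> 1"
    unfolding wiener_filter_def norm_of_real by (simp add: divide_le_eq_1) (use w in linarith)
  have "cmod (\<l> u) \<le> 1 + (cmod (\<l> u))\<^sup>2"
  proof (cases "cmod (\<l> u) \<le> 1")
    case False then show ?thesis using self_le_power[of "cmod (\<l> u)" 2] by linarith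
  qed (use w in linarith)
  then show "cmod (\<l> u * wiener_filter \<l> u) \<le> 1"
    unfolding wiener_filter_def norm_mult norm_of_real by (simp add: divide_le_eq_1) (use w in linarith)
qed

text \<open>The first summand does not depend on \<open>\<phi>\<close>, and by the second claim the remaining one controls the
  distance from the Wiener filter in \<open>L2 \<mu>\<close>.\<close>

lemma weighted_error_eq:
  assumes \<l>: "\<l> \<in> borel_measurable \<mu>" and \<phi>: "\<phi> \<in> L2 \<mu>" and d: "(\<lambda>u. \<l> u * \<phi> u) \<in> L2 \<mu>"
  shows "weighted_error \<l> \<phi> = (\<integral>u. (cmod (\<l> u))\<^sup>2 / (1 + (cmod (\<l> u))\<^sup>2) \<partial>\<mu>) +
      (\<integral>u. (1 + (cmod (\<l> u))\<^sup>2) * (cmod (\<phi> u - wiener_filter \<l> u))\<^sup>2 \<partial>\<mu>)"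
    and "sqnorm \<mu> (\<lambda>u. \<phi> u - wiener_filter \<l> u) \<le>
      (\<integral>u. (1 + (cmod (\<l> u))\<^sup>2) * (cmod (\<phi> u - wiener_filter \<l> u))\<^sup>2 \<partial>\<mu>)"
proof -
  have [measurable]: "\<phi> \<in> borel_measurable \<mu>" "\<l> \<in> borel_measurable \<mu>" using assms by auto
  have [measurable]: "wiener_filter \<l> \<in> borel_measurable \<mu>"
    unfolding wiener_filter_def[abs_def] by measurable
  have 1: "(\<lambda>u. 1) \<in> L2 \<mu>" using trig_L2[of 0] by (simp add: trig_0)
  have i1: "integrable \<mu> (\<lambda>u. (cmod (\<phi> u - 1))\<^sup>2 + (cmod (\<l> u * \<phi> u))\<^sup>2)"
    by (intro Bochner_Integration.integrable_add L2_integrable[OF L2_diff[OF \<phi> 1]] L2_integrable[OF d])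
  have i2: "integrable \<mu> (\<lambda>u. (cmod (\<l> u))\<^sup>2 / (1 + (cmod (\<l> u))\<^sup>2))"
    by (rule integrable_const_bound[where B = 1]) (auto simp: divide_le_eq_1 add_pos_nonneg)
  have cs: "(cmod (\<phi> u - 1))\<^sup>2 + (cmod (\<l> u * \<phi> u))\<^sup>2 = (cmod (\<l> u))\<^sup>2 / (1 + (cmod (\<l> u))\<^sup>2)
      + (1 + (cmod (\<l> u))\<^sup>2) * (cmod (\<phi> u - wiener_filter \<l> u))\<^sup>2" for u
    unfolding wiener_filter_def by (rule complete_square)
  have i3: "integrable \<mu> (\<lambda>u. (1 + (cmod (\<l> u))\<^sup>2) * (cmod (\<phi> u - wiener_filter \<l> u))\<^sup>2)"
    using Bochner_Integration.integrable_diff[OF i1 i2] unfolding cs by simp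
  have "weighted_error \<l> \<phi> = (\<integral>u. (cmod (\<phi> u - 1))\<^sup>2 + (cmod (\<l> u * \<phi> u))\<^sup>2 \<partial>\<mu>)"
    unfolding weighted_error_def sqnorm_def
    by (intro Bochner_Integration.integral_add[symmetric] L2_integrable[OF L2_diff[OF \<phi> 1]] L2_integrable[OF d])
  also have "\<dots> = (\<integral>u. (cmod (\<l> u))\<^sup>2 / (1 + (cmod (\<l> u))\<^sup>2) \<partial>\<mu>) +
      (\<integral>u. (1 + (cmod (\<l> u))\<^sup>2) * (cmod (\<phi> u - wiener_filter \<l> u))\<^sup>2 \<partial>\<mu>)"
    unfolding cs by (rule Bochner_Integration.integral_add[OF i2 i3])
  finally show "weighted_error \<l> \<phi> = \<dots>" .
  have le: "(cmod (\<phi> u - wiener_filter \<l> u))\<^sup>2 \<le> (1 + (cmod (\<l> u))\<^sup>2) * (cmod (\<phi> u - wiener_filter \<l> u))\<^sup>2" for u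
    by (simp add: distrib_right)
  show "sqnorm \<mu> (\<lambda>u. \<phi> u - wiener_filter \<l> u) \<le>
      (\<integral>u. (1 + (cmod (\<l> u))\<^sup>2) * (cmod (\<phi> u - wiener_filter \<l> u))\<^sup>2 \<partial>\<mu>)"
    unfolding sqnorm_def
  proof (rule integral_mono[OF _ i3 le])
    show "integrable \<mu> (\<lambda>u. (cmod (\<phi> u - wiener_filter \<l> u))\<^sup>2)"
      by (rule Bochner_Integration.integrable_bound[OF i3]) (use le in auto)
  qed
qed

text \<open>The unrestricted infimum is attained at the Wiener filter. An infimum over a smaller span has the
  same value only if some sequence in that span converges to the Wiener filter; as the span is closed,
  this means membership.\<close>

lemma pred_error_eq_iff:
  assumes \<l>: "\<l> \<in> borel_measurable \<mu>" and dense: "L2 \<mu> \<subseteq> closed_span \<mu> trig UNIV"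
  shows "pred_error M B \<mu> W \<l> S = pred_error M B \<mu> W \<l> UNIV \<longleftrightarrow> wiener_filter \<l> \<in> closed_span \<mu> trig S"
proof -
  define m where "m = (\<integral>u. (cmod (\<l> u))\<^sup>2 / (1 + (cmod (\<l> u))\<^sup>2) \<partial>\<mu>)"
  let ?E = "\<lambda>S. {\<phi> \<in> closed_span \<mu> trig S. (\<lambda>u. \<l> u * \<phi> u) \<in> L2 \<mu>}"
  have [measurable]: "\<l> \<in> borel_measurable \<mu>" using assms by auto
  have [measurable]: "wiener_filter \<l> \<in> borel_measurable \<mu>"
    unfolding wiener_filter_def[abs_def] by measurable
  have w: "wiener_filter \<l> \<in> L2 \<mu>" "(\<lambda>u. \<l> u * wiener_filter \<l> u) \<in> L2 \<mu>"
    by (rule L2_bounded[OF _ wiener_filter_bounds(1)], measurable)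
      (rule L2_bounded[OF _ wiener_filter_bounds(2)], measurable)
  have wm: "weighted_error \<l> (wiener_filter \<l>) = m"
    using weighted_error_eq(1)[OF \<l> w] by (simp add: m_def)
  have lb: "m + sqnorm \<mu> (\<lambda>u. \<phi> u - wiener_filter \<l> u) \<le> weighted_error \<l> \<phi>" if "\<phi> \<in> ?E S" for \<phi> S
    using weighted_error_eq[OF \<l> closed_spanD, of \<phi> trig S] that unfolding m_def by auto
  have lb': "m \<le> weighted_error \<l> \<phi>" if "\<phi> \<in> ?E S" for \<phi> S
    using lb[OF that] sqnorm_nonneg[of \<mu> "\<lambda>u. \<phi> u - wiener_filter \<l> u"] by linarith
  have attained: "pred_error M B \<mu> W \<l> S = m" if "wiener_filter \<l> \<in> closed_span \<mu> trig S" for S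
    unfolding pred_error_spectral[OF \<l>] using that w lb'[of _ S]
    by (intro cInf_eq_minimum) (auto simp: wm[symmetric])
  show ?thesis
  proof
    assume "wiener_filter \<l> \<in> closed_span \<mu> trig S"
    then show "pred_error M B \<mu> W \<l> S = pred_error M B \<mu> W \<l> UNIV"
      using attained[of S] attained[of UNIV] dense w by auto
  next
    assume "pred_error M B \<mu> W \<l> S = pred_error M B \<mu> W \<l> UNIV"
    then have m: "(INF \<phi> \<in> ?E S. weighted_error \<l> \<phi>) = m"
      using attained[of UNIV] dense w pred_error_spectral[OF \<l>, of S] by auto
    have ne: "?E S \<noteq> {}" using closed_span_zero[of \<mu> trig S] by (auto intro!: exI[of _ "\<lambda>u. 0"])
    show "wiener_filter \<l> \<in> closed_span \<mu> trig S"
    proof (rule closed_span_closed[OF trig_L2 w(1)])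
      fix e :: real assume "e > 0"
      then have "(INF \<phi> \<in> ?E S. weighted_error \<l> \<phi>) < m + e" using m by simp
      then obtain \<phi> where p: "\<phi> \<in> ?E S" "weighted_error \<l> \<phi> < m + e"
        using cInf_lessD[of "weighted_error \<l> ` ?E S"] ne by auto
      then show "\<exists>g\<in>closed_span \<mu> trig S. sqnorm \<mu> (\<lambda>u. wiener_filter \<l> u - g u) < e"
        using lb[OF p(1)] by (intro bexI[of _ \<phi>]) (auto simp: sqnorm_minus_commute[of \<mu> "wiener_filter \<l>"])
    qed
  qed
qed

end

section \<open>Approximation by real parts of entire functions\<close>

text \<open>The functions with this approximation property are stable under linear combinations and dominated
  limits. They contain the indicators of open sets, which are increasing limits of the functions
  $\min(1, n\,\mathrm{dist}(x, U^c))$, hence by the $\pi$-$\lambda$ theorem all indicators of Borel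
  sets.\<close>

lemma continuous_dense_L1:
  fixes w :: "'b::metric_space \<Rightarrow> real"
  assumes fin: "finite_measure m" and sets: "sets m = sets borel" and w: "integrable m w" and e: "e > 0"
  shows "\<exists>c. continuous_on UNIV c \<and> bounded (range c) \<and> (\<integral>x. \<bar>c x - w x\<bar> \<partial>m) < e"
proof -
  interpret finite_measure m by fact
  have space: "space m = UNIV" using sets_eq_imp_space_eq[OF sets] by simp
  define appr where "appr f \<longleftrightarrow> integrable m f \<and>
    (\<forall>e>0. \<exists>c. continuous_on UNIV c \<and> bounded (range c) \<and> (\<integral>x. \<bar>c x - f x\<bar> \<partial>m) < e)" for f :: "'b \<Rightarrow> real"
  have ci: "integrable m c" if "continuous_on UNIV c" "bounded (range c)" for c :: "'b \<Rightarrow> real"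
  proof -
    obtain K where "\<And>x. norm (c x) \<le> K" using \<open>bounded (range c)\<close> by (auto simp: bounded_iff)
    moreover have "c \<in> borel_measurable m"
      unfolding measurable_cong_sets[OF sets refl] by (rule borel_measurable_continuous_onI) fact
    ultimately show ?thesis by (intro integrable_const_bound[where B = K]) auto
  qed
  have close: "appr f" if f: "integrable m f" and a: "\<And>e. e > 0 \<Longrightarrow> \<exists>g. appr g \<and> (\<integral>x. \<bar>g x - f x\<bar> \<partial>m) < e" for f
    unfolding appr_def
  proof (intro conjI f allI impI)
    fix e :: real assume "e > 0"
    then obtain g where g: "appr g" "(\<integral>x. \<bar>g x - f x\<bar> \<partial>m) < e/2" using a[of "e/2"] by auto
    then obtain c where c: "continuous_on UNIV c" "bounded (range c)" "(\<integral>x. \<bar>c x - g x\<bar> \<partial>m) < e/2"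
      using \<open>e > 0\<close> unfolding appr_def by (meson half_gt_zero)
    have gi: "integrable m g" using g(1) by (simp add: appr_def)
    have "(\<integral>x. \<bar>c x - f x\<bar> \<partial>m) \<le> (\<integral>x. \<bar>c x - g x\<bar> + \<bar>g x - f x\<bar> \<partial>m)"
      by (rule integral_mono) (use f gi ci[OF c(1,2)] in auto)
    also have "\<dots> = (\<integral>x. \<bar>c x - g x\<bar> \<partial>m) + (\<integral>x. \<bar>g x - f x\<bar> \<partial>m)"
      by (rule Bochner_Integration.integral_add) (use f gi ci[OF c(1,2)] in auto)
    also have "\<dots> < e" using g(2) c(3) by simp
    finally show "\<exists>c. continuous_on UNIV c \<and> bounded (range c) \<and> (\<integral>x. \<bar>c x - f x\<bar> \<partial>m) < e"
      using c by blast
  qed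
  have cont: "appr c" if "continuous_on UNIV c" "bounded (range c)" for c
    unfolding appr_def using ci[OF that] that by (auto intro!: exI[of _ c])
  have sum: "appr (\<lambda>x. f x + g x)" if f: "appr f" and g: "appr g" for f g
    unfolding appr_def
  proof (intro conjI allI impI)
    have i: "integrable m f" "integrable m g" using f g by (auto simp: appr_def)
    then show "integrable m (\<lambda>x. f x + g x)" by simp
    fix e :: real assume "e > 0"
    then obtain c d where c: "continuous_on UNIV c" "bounded (range c)" "(\<integral>x. \<bar>c x - f x\<bar> \<partial>m) < e/2"
      and d: "continuous_on UNIV d" "bounded (range d)" "(\<integral>x. \<bar>d x - g x\<bar> \<partial>m) < e/2"
      using f g unfolding appr_def by (meson half_gt_zero)
    have "(\<integral>x. \<bar>(c x + d x) - (f x + g x)\<bar> \<partial>m) \<le> (\<integral>x. \<bar>c x - f x\<bar> + \<bar>d x - g x\<bar> \<partial>m)"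
      by (rule integral_mono) (use i ci[OF c(1,2)] ci[OF d(1,2)] in auto)
    also have "\<dots> = (\<integral>x. \<bar>c x - f x\<bar> \<partial>m) + (\<integral>x. \<bar>d x - g x\<bar> \<partial>m)"
      by (rule Bochner_Integration.integral_add) (use i ci[OF c(1,2)] ci[OF d(1,2)] in auto)
    also have "\<dots> < e" using c(3) d(3) by simp
    finally show "\<exists>c. continuous_on UNIV c \<and> bounded (range c) \<and> (\<integral>x. \<bar>c x - (f x + g x)\<bar> \<partial>m) < e"
      using c d by (intro exI[of _ "\<lambda>x. c x + d x"]) (auto intro!: continuous_intros bounded_plus_comp)
  qed
  have scale: "appr (\<lambda>x. a * f x)" if f: "appr f" for a f
    unfolding appr_def
  proof (intro conjI allI impI)
    have i: "integrable m f" using f by (auto simp: appr_def)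
    then show "integrable m (\<lambda>x. a * f x)" by simp
    fix e :: real assume e: "e > 0"
    then have "e / (\<bar>a\<bar> + 1) > 0" by simp
    then obtain c where c: "continuous_on UNIV c" "bounded (range c)" "(\<integral>x. \<bar>c x - f x\<bar> \<partial>m) < e / (\<bar>a\<bar> + 1)"
      using f unfolding appr_def by meson
    have "(\<integral>x. \<bar>a * c x - a * f x\<bar> \<partial>m) = \<bar>a\<bar> * (\<integral>x. \<bar>c x - f x\<bar> \<partial>m)"
      unfolding right_diff_distrib[symmetric] abs_mult by simp
    also have "\<dots> \<le> \<bar>a\<bar> * (e / (\<bar>a\<bar> + 1))" using c(3) by (intro mult_left_mono) auto
    also have "\<dots> < e" using e by (simp add: field_simps add_pos_nonneg)
    finally show "\<exists>c. continuous_on UNIV c \<and> bounded (range c) \<and> (\<integral>x. \<bar>c x - a * f x\<bar> \<partial>m) < e"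
      using c by (intro exI[of _ "\<lambda>x. a * c x"]) (auto intro!: continuous_intros bounded_scaleR_comp[where 'b = real, simplified])
  qed
  have limit: "appr f" if s: "\<And>i::nat. appr (s i)" and p: "\<And>x. (\<lambda>i. s i x) \<longlonglongrightarrow> f x"
    and b: "\<And>i x. \<bar>s i x\<bar> \<le> h x" and h: "integrable m h" for s f h
  proof -
    have si: "integrable m (s i)" for i using s by (simp add: appr_def)
    then have [measurable]: "s i \<in> borel_measurable m" for i by simp
    have [measurable]: "f \<in> borel_measurable m" by (rule borel_measurable_LIMSEQ_metric[of s]) (use p in auto)
    have f: "integrable m f"
      by (rule integrable_dominated_convergence[where s = s and w = h]) (use p b h in auto)
    have "(\<lambda>i. \<integral>x. \<bar>s i x - f x\<bar> \<partial>m) \<longlonglongrightarrow> (\<integral>x. 0 \<partial>m)"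
    proof (rule integral_dominated_convergence[where w = "\<lambda>x. h x + \<bar>f x\<bar>"])
      show "AE x in m. (\<lambda>i. \<bar>s i x - f x\<bar>) \<longlonglongrightarrow> 0"
        using p by (intro AE_I2 tendsto_rabs_zero) (simp add: LIM_zero)
      show "AE x in m. norm \<bar>s i x - f x\<bar> \<le> h x + \<bar>f x\<bar>" for i
        using b[of i] by (intro AE_I2) (smt (verit) real_norm_def)
    qed (use h f in auto)
    then have L: "(\<lambda>i. \<integral>x. \<bar>s i x - f x\<bar> \<partial>m) \<longlonglongrightarrow> 0" by simp
    show ?thesis
    proof (rule close[OF f])
      fix e :: real assume "e > 0"
      from LIMSEQ_D[OF L this] obtain N where "norm ((\<integral>x. \<bar>s N x - f x\<bar> \<partial>m) - 0) < e" by blast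
      then show "\<exists>g. appr g \<and> (\<integral>x. \<bar>g x - f x\<bar> \<partial>m) < e" using s[of N] by (intro exI[of _ "s N"]) simp
    qed
  qed
  have const: "appr (\<lambda>x. a)" for a by (rule cont) auto
  have ind: "appr (indicator A)" if A: "A \<in> sets borel" for A :: "'b set"
  proof -
    have 1: "Int_stable {S::'b set. open S}" by (auto simp: Int_stable_def)
    have 2: "{S::'b set. open S} \<subseteq> Pow UNIV" by simp
    have 3: "A \<in> sigma_sets UNIV {S. open S}" using A by (simp add: borel_def)
    from 1 2 3 show ?thesis
    proof (induction rule: sigma_sets_induct_disjoint)
      case (basic U)
      then have U: "open U" by simp
      show ?case
      proof (cases "U = UNIV")
        case True then show ?thesis using const[of 1] by simp
      next
        case False
        define c where "c n x = min 1 (real n * infdist x (- U))" for n x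
        show ?thesis
        proof (rule limit[where s = c and h = "\<lambda>x. 1"])
          show "appr (c n)" for n
          proof (rule cont)
            show "continuous_on UNIV (c n)" unfolding c_def by (intro continuous_intros)
            show "bounded (range (c n))"
              by (rule boundedI[where B = 1]) (auto simp: c_def infdist_nonneg)
          qed
          show "(\<lambda>n. c n x) \<longlonglongrightarrow> indicator U x" for x
          proof (cases "x \<in> U")
            case True
            have "infdist x (- U) \<noteq> 0"
              using in_closed_iff_infdist_zero[of "- U" x] U False True by (auto simp: closed_Compl)
            then have p: "infdist x (- U) > 0" using infdist_nonneg[of x "- U"] by simp
            obtain N where N: "real N * infdist x (- U) > 1" using reals_Archimedean3[OF p] by blast
            have "c n x = 1" if "n \<ge> N" for n
            proof -
              have "real N * infdist x (- U) \<le> real n * infdist x (- U)"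
                using that p by (intro mult_right_mono) auto
              then show ?thesis using N by (simp add: c_def)
            qed
            then have "\<forall>\<^sub>F n in sequentially. c n x = 1" unfolding eventually_sequentially by blast
            then show ?thesis using True by (simp add: tendsto_eventually)
          next
            case False
            then show ?thesis by (simp add: c_def)
          qed
          show "\<bar>c n x\<bar> \<le> 1" for n x by (auto simp: c_def infdist_nonneg)
        qed simp
      qed
    next
      case empty then show ?case using const[of 0] by simp
    next
      case (compl A)
      have "indicator (UNIV - A) = (\<lambda>x. 1 + - 1 * indicator A x :: real)"
        by (auto simp: indicator_def fun_eq_iff)
      then show ?case by (simp only: sum[OF const scale[OF compl(2)]])
    next
      case (union A)
      have fin: "appr (\<lambda>x. \<Sum>i<n. indicator (A i) x)" for n
        by (induction n) (use const[of 0] in \<open>auto intro!: sum union(3)\<close>)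
      have eq: "(\<Sum>i<n. indicator (A i) x) = (indicator (\<Union>i<n. A i) x :: real)" for n x
        using union(1) by (intro indicator_UN_disjoint[symmetric]) (auto intro: disjoint_family_on_mono)
      show ?case
      proof (rule limit[where s = "\<lambda>n x. \<Sum>i<n. indicator (A i) x" and h = "\<lambda>x. 1", OF fin])
        show "(\<lambda>n. \<Sum>i<n. indicator (A i) x) \<longlonglongrightarrow> indicat_real (\<Union> (range A)) x" for x
          unfolding eq by (rule LIMSEQ_indicator_UN)
      qed (auto simp: eq)
    qed
  qed
  have "appr w" using w
  proof induction
    case (base A c)
    show ?case using scale[OF ind[of A], of c] base(1) sets by (simp add: mult.commute)
  next
    case (add f g) then show ?case by (intro sum)
  next
    case (lim f s)
    show ?case
    proof (rule limit[where s = s and h = "\<lambda>x. 2 * \<bar>f x\<bar>"])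
      show "\<bar>s i x\<bar> \<le> 2 * \<bar>f x\<bar>" for i x using lim space by simp
    qed (use lim space in auto)
  qed
  then show ?thesis using e unfolding appr_def by blast
qed

text \<open>On the unit circle $\bar z = 1/z$, so a product $z^i \bar z^j$ is a power of $z$ or of $\bar z$; in the
  latter case conjugation turns it into a power of $z$ with the same real part. Thus the real parts of
  polynomials form an algebra there.\<close>

lemma Re_poly_mult_on_circle:
  fixes p q :: "complex poly"
  shows "\<exists>r. \<forall>z. cmod z = 1 \<longrightarrow> Re (poly p z) * Re (poly q z) = Re (poly r z)"
proof -
  define r where "r = (\<Sum>i\<le>degree p. \<Sum>j\<le>degree q.
     if j \<le> i then monom (coeff p i * cnj (coeff q j)) (i - j) else monom (cnj (coeff p i) * coeff q j) (j - i))"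
  have "Re (poly p z) * Re (poly q z) = Re (poly (smult (1/2) (p * q + r)) z)" if z: "cmod z = 1" for z
  proof -
    have zz: "z * cnj z = 1" using z by (simp add: complex_norm_square[symmetric])
    have tm: "Re (coeff p i * z ^ i * cnj (coeff q j * z ^ j)) =
       Re (poly (if j \<le> i then monom (coeff p i * cnj (coeff q j)) (i - j)
          else monom (cnj (coeff p i) * coeff q j) (j - i)) z)" for i j
    proof (cases "j \<le> i")
      case True
      then have "z ^ i = z ^ (i - j) * z ^ j" by (simp add: power_add[symmetric])
      then have "z ^ i * cnj (z ^ j) = z ^ (i - j) * (z * cnj z) ^ j" by (simp add: power_mult_distrib)
      then have "coeff p i * z ^ i * cnj (coeff q j * z ^ j) = coeff p i * cnj (coeff q j) * z ^ (i - j)"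
        by (simp add: zz)
      then show ?thesis by (simp only: True if_True poly_monom)
    next
      case False
      then have "z ^ j = z ^ (j - i) * z ^ i" by (simp add: power_add[symmetric])
      then have "z ^ i * cnj (z ^ j) = cnj (z ^ (j - i)) * (z * cnj z) ^ i" by (simp add: power_mult_distrib)
      then have "coeff p i * z ^ i * cnj (coeff q j * z ^ j) = cnj (cnj (coeff p i) * coeff q j * z ^ (j - i))"
        by (simp add: zz)
      then show ?thesis by (simp only: False if_False poly_monom cnj.sel(1))
    qed
    have "Re (poly p z * cnj (poly q z)) = Re (poly r z)"
      unfolding poly_altdef[of p] poly_altdef[of q] r_def
      by (simp only: cnj_sum sum_product poly_sum Re_sum tm)
    then show ?thesis by (simp add: field_simps)
  qed
  then show ?thesis by blast
qed

lemma real_polynomial_on_circle: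
  fixes f :: "complex \<Rightarrow> real"
  assumes "real_polynomial_function f"
  shows "\<exists>p::complex poly. \<forall>z. cmod z = 1 \<longrightarrow> f z = Re (poly p z)"
  using assms
proof induction
  case (linear f)
  interpret bounded_linear f by fact
  have "f z = Re (poly [:0, Complex (f 1) (- f \<i>):] z)" for z
  proof -
    have "z = Re z *\<^sub>R 1 + Im z *\<^sub>R \<i>" by (simp add: complex_eq_iff)
    then have "f z = Re z * f 1 + Im z * f \<i>" by (metis add scaleR real_scaleR_def)
    then show ?thesis by (simp add: algebra_simps)
  qed
  then show ?case by blast
next
  case (const c)
  show ?case by (intro exI[of _ "[:complex_of_real c:]"]) simp
next
  case (add f g)
  then obtain p q where "\<And>z. cmod z = 1 \<Longrightarrow> f z = Re (poly p z)" "\<And>z. cmod z = 1 \<Longrightarrow> g z = Re (poly q z)"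
    by blast
  then show ?case by (intro exI[of _ "p + q"]) simp
next
  case (mult f g)
  then obtain p q where "\<And>z. cmod z = 1 \<Longrightarrow> f z = Re (poly p z)" "\<And>z. cmod z = 1 \<Longrightarrow> g z = Re (poly q z)"
    by blast
  then show ?case using Re_poly_mult_on_circle[of p q] by simp
qed

text \<open>The normalization $\mathrm{Im}\,P(0) = 0$ makes $e^{-P(0)}$ positive, so that the mean of $e^{-P}$
  is close to one as soon as the mean of $\mathrm{Re}\,P$ is small.\<close>

lemma continuous_on_circle_approx:
  fixes c :: "complex \<Rightarrow> real"
  assumes "continuous_on UNIV c" "e > 0"
  shows "\<exists>P. P holomorphic_on UNIV \<and> Im (P 0) = 0 \<and> (\<forall>z. cmod z = 1 \<longrightarrow> \<bar>Re (P z) - c z\<bar> < e)"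
proof -
  obtain g where g: "real_polynomial_function g" "\<And>z. z \<in> sphere 0 1 \<Longrightarrow> \<bar>c z - g z\<bar> < e"
    using Stone_Weierstrass_real_polynomial_function[of "sphere 0 1" c e] assms
    by (auto intro: continuous_on_subset)
  obtain p where p: "\<And>z. cmod z = 1 \<Longrightarrow> g z = Re (poly p z)"
    using real_polynomial_on_circle[OF g(1)] by blast
  show ?thesis
    using g(2) p by (intro exI[of _ "\<lambda>z. poly p z - \<i> * Im (poly p 0)"])
      (auto intro!: holomorphic_intros simp: abs_minus_commute)
qed

lemma space_leb_circ [simp]: "space leb_circ = {-pi..<pi}"
  by (simp add: leb_circ_def space_restrict_space)

lemma integral_excess_tendsto_0:
  assumes w: "integrable M w" "AE x in M. 0 \<le> w x"
  shows "(\<lambda>n. \<integral>x. max 0 (w x - real n) \<partial>M) \<longlonglongrightarrow> 0"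
proof -
  have "(\<lambda>n. \<integral>x. max 0 (w x - real n) \<partial>M) \<longlonglongrightarrow> (\<integral>x. 0 \<partial>M)"
  proof (rule integral_dominated_convergence[where w = w])
    show "AE x in M. (\<lambda>n. max 0 (w x - real n)) \<longlonglongrightarrow> 0"
    proof (rule AE_I2)
      fix x
      have "\<forall>\<^sub>F n in sequentially. w x \<le> real n"
        using eventually_ge_at_top[of "nat \<lceil>w x\<rceil>"] by eventually_elim linarith
      then have "\<forall>\<^sub>F n in sequentially. max 0 (w x - real n) = 0" by eventually_elim simp
      then show "(\<lambda>n. max 0 (w x - real n)) \<longlonglongrightarrow> 0" by (rule tendsto_eventually)
    qed
    show "AE x in M. norm (max 0 (w x - real n)) \<le> w x" for n
      using w(2) by eventually_elim auto
  qed (use w in auto)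
  then show ?thesis by simp
qed

lemma ex_integral_excess_less:
  assumes w: "integrable M w" "AE x in M. 0 \<le> w x" and "e > 0"
  shows "\<exists>n::nat. (\<integral>x. max 0 (w x - real n) \<partial>M) < e"
  using LIMSEQ_D[OF integral_excess_tendsto_0[OF w] \<open>e > 0\<close>] by (force dest: spec)

locale circle_measure = finite_measure \<mu> for \<mu> :: "real measure" +
  assumes sets_circle: "sets \<mu> = sets leb_circ"
begin

lemma space_circle [simp]: "space \<mu> = {-pi..<pi}"
  using sets_eq_imp_space_eq[OF sets_circle] by simp

lemma measurable_circle_iff: "f \<in> measurable \<mu> N \<longleftrightarrow> f \<in> measurable leb_circ N"
  using measurable_cong_sets[OF sets_circle refl] by blast

lemma measurable_circleI: "f \<in> borel_measurable borel \<Longrightarrow> f \<in> borel_measurable \<mu>"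
  unfolding measurable_circle_iff leb_circ_def by (intro measurable_restrict_space1) simp

lemma continuous_measurable_circle: "continuous_on UNIV f \<Longrightarrow> f \<in> borel_measurable \<mu>"
  by (intro measurable_circleI borel_measurable_continuous_onI)

text \<open>The map $u \mapsto e^{-iu}$ transports \<open>\<mu>\<close> to the unit circle; on $[-\pi,\pi)$ it is inverted by
  \<open>\<lambda>z. - Arg z\<close>.\<close>

lemma entire_L1_approx_bounded:
  assumes w: "w \<in> borel_measurable \<mu>" "\<And>u. u \<in> space \<mu> \<Longrightarrow> 0 \<le> w u \<and> w u \<le> C" and C: "0 \<le> C" and e: "e > 0"
  shows "\<exists>P. P holomorphic_on UNIV \<and> Im (P 0) = 0 \<and> (\<forall>u. 0 \<le> Re (P (cis (- u))) \<and> Re (P (cis (- u))) \<le> C + 1) \<and>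
     (\<integral>u. \<bar>Re (P (cis (- u))) - w u\<bar> \<partial>\<mu>) < e"
proof -
  have [measurable]: "(\<lambda>u. cis (- u)) \<in> measurable \<mu> borel"
    by (intro continuous_measurable_circle continuous_intros)
  have Argm: "(\<lambda>z. - Arg z) \<in> measurable borel \<mu>"
  proof -
    have "Arg = (\<lambda>z. if z = 0 then 0 else Im (Ln z))" by (auto simp: Arg_def fun_eq_iff)
    moreover have "(\<lambda>z. if z = 0 then 0 else Im (Ln z)) \<in> borel_measurable borel" by measurable
    ultimately have "Arg \<in> borel_measurable borel" by simp
    then have "(\<lambda>z. - Arg z) \<in> measurable borel (restrict_space borel {-pi..<pi})"
      using mpi_less_Arg Arg_le_pi by (intro measurable_restrict_space2) (auto simp: less_imp_le minus_less_iff)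
    moreover have "sets \<mu> = sets (restrict_space borel {-pi..<pi})"
      unfolding sets_circle leb_circ_def by (rule sets_restrict_space_cong) simp
    ultimately show ?thesis using measurable_cong_sets[OF refl] by blast
  qed
  define m where "m = distr \<mu> borel (\<lambda>u. cis (- u))"
  interpret m: finite_measure m unfolding m_def by (rule finite_measure_distr) measurable
  define v where "v z = w (- Arg z)" for z
  have vm[measurable]: "v \<in> borel_measurable borel" unfolding v_def using measurable_compose[OF Argm w(1)] .
  have Arg_mem: "- Arg z \<in> {-pi..<pi}" for z using mpi_less_Arg[of z] Arg_le_pi[of z] by auto
  have v: "0 \<le> v z \<and> v z \<le> C" for z using w(2)[of "- Arg z"] Arg_mem[of z] by (simp add: v_def)
  have vw: "v (cis (- u)) = w u" if "u \<in> {-pi..<pi}" for u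
    using that Arg_cis[of "- u"] by (auto simp: v_def)
  have vi: "integrable m v"
    by (rule m.integrable_const_bound[where B = C]) (use v in \<open>auto simp: m_def\<close>)
  obtain c where c: "continuous_on UNIV c" "bounded (range c)" "(\<integral>z. \<bar>c z - v z\<bar> \<partial>m) < e/2"
    using continuous_dense_L1[OF m.finite_measure_axioms _ vi, of "e/2"] e by (auto simp: m_def)
  have [measurable]: "c \<in> borel_measurable borel" using c(1) by (rule borel_measurable_continuous_onI)
  define K where "K = measure \<mu> (space \<mu>)"
  have K: "K \<ge> 0" by (simp add: K_def)
  define d where "d = min (1/2) (e / (4 * (K + 1)))"
  have d: "d > 0" "d \<le> 1/2" "2 * d * K < e/2"
  proof -
    show d0: "d > 0" using e K by (simp add: d_def)
    show "d \<le> 1/2" unfolding d_def by (rule min.cobounded1)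
    have "2 * d * (K + 1) \<le> 2 * (e / (4 * (K + 1))) * (K + 1)"
      using K by (intro mult_right_mono mult_left_mono) (auto simp: d_def)
    also have "\<dots> = e/2" using K by (simp add: field_simps)
    finally show "2 * d * K < e/2" using d0 by (simp add: algebra_simps)
  qed
  \<comment> \<open>clamping to $[0,C]$ does not increase the distance from \<open>v\<close>; adding \<open>d\<close> keeps the approximation nonnegative\<close>
  define c' where "c' z = max 0 (min C (c z)) + d" for z
  have cont: "continuous_on UNIV c'" unfolding c'_def by (intro continuous_intros c(1))
  obtain P where P: "P holomorphic_on UNIV" "Im (P 0) = 0" "\<And>z. cmod z = 1 \<Longrightarrow> \<bar>Re (P z) - c' z\<bar> < d"
    using continuous_on_circle_approx[of c' d] cont d(1) by blast
  define R where "R u = Re (P (cis (- u)))" for u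
  have Rc: "continuous_on UNIV R"
    unfolding R_def using holomorphic_on_imp_continuous_on[OF P(1)]
    by (auto intro!: continuous_intros intro: continuous_on_compose2)
  have [measurable]: "R \<in> borel_measurable \<mu>" by (rule continuous_measurable_circle[OF Rc])
  have cR: "\<bar>R u - c' (cis (- u))\<bar> < d" for u unfolding R_def by (rule P(3)) simp
  have R: "0 \<le> R u" "R u \<le> C + 1" for u
    using cR[of u] d C unfolding c'_def by (auto simp: abs_less_iff)
  have Rw: "\<bar>R u - w u\<bar> \<le> \<bar>c (cis (- u)) - v (cis (- u))\<bar> + 2 * d" if "u \<in> {-pi..<pi}" for u
    using cR[of u] v[of "cis (- u)"] vw[OF that] unfolding c'_def by linarith
  have ci: "integrable \<mu> (\<lambda>u. \<bar>c (cis (- u)) - v (cis (- u))\<bar>)"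
  proof -
    obtain B where "\<And>z. norm (c z) \<le> B" using c(2) by (auto simp: bounded_iff)
    then have "\<bar>c z - v z\<bar> \<le> B + C" for z using v[of z] by (smt (verit) real_norm_def)
    moreover have "(\<lambda>u. c (cis (- u))) \<in> borel_measurable \<mu>"
      by (rule continuous_measurable_circle) (auto intro!: continuous_intros continuous_on_compose2[OF c(1)])
    ultimately show ?thesis by (intro integrable_const_bound[where B = "B + C"]) auto
  qed
  have "(\<integral>u. \<bar>R u - w u\<bar> \<partial>\<mu>) \<le> (\<integral>u. \<bar>c (cis (- u)) - v (cis (- u))\<bar> + 2 * d \<partial>\<mu>)"
  proof (rule integral_mono)
    show "integrable \<mu> (\<lambda>u. \<bar>R u - w u\<bar>)"
    proof (rule integrable_const_bound[where B = "C + 1"])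
      show "AE u in \<mu>. norm \<bar>R u - w u\<bar> \<le> C + 1"
        using w(2) R by (intro AE_I2) (smt (verit) real_norm_def)
    qed (use w in measurable)
  qed (use ci Rw in auto)
  also have "\<dots> = (\<integral>u. \<bar>c (cis (- u)) - v (cis (- u))\<bar> \<partial>\<mu>) + 2 * d * K"
    using ci by (simp add: K_def)
  also have "(\<integral>u. \<bar>c (cis (- u)) - v (cis (- u))\<bar> \<partial>\<mu>) = (\<integral>z. \<bar>c z - v z\<bar> \<partial>m)"
    unfolding m_def by (subst integral_distr) measurable
  finally have "(\<integral>u. \<bar>R u - w u\<bar> \<partial>\<mu>) < e" using c(3) d(3) by simp
  then show ?thesis using P(1,2) R unfolding R_def by blast
qed

lemma entire_L1_approx:
  assumes w: "integrable \<mu> w" "\<And>u. u \<in> space \<mu> \<Longrightarrow> 0 \<le> w u" and e: "e > 0"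
  shows "\<exists>P. P holomorphic_on UNIV \<and> Im (P 0) = 0 \<and> (\<forall>u. 0 \<le> Re (P (cis (- u)))) \<and>
     (\<integral>u. \<bar>Re (P (cis (- u))) - w u\<bar> \<partial>\<mu>) < e"
proof -
  have [measurable]: "w \<in> borel_measurable \<mu>" using w by auto
  have "\<bar>min (w u) (real n) - w u\<bar> = max 0 (w u - real n)" for n u by auto
  moreover have "AE u in \<mu>. 0 \<le> w u" using w(2) by (intro AE_I2)
  ultimately obtain n where n: "(\<integral>u. \<bar>min (w u) (real n) - w u\<bar> \<partial>\<mu>) < e/2"
    using ex_integral_excess_less[OF w(1), of "e/2"] e by auto
  obtain P where P: "P holomorphic_on UNIV" "Im (P 0) = 0"
    "\<And>u. 0 \<le> Re (P (cis (- u))) \<and> Re (P (cis (- u))) \<le> real n + 1"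
    "(\<integral>u. \<bar>Re (P (cis (- u))) - min (w u) (real n)\<bar> \<partial>\<mu>) < e/2"
    using entire_L1_approx_bounded[of "\<lambda>u. min (w u) (real n)" "real n" "e/2"] w(2) e by auto
  have [measurable]: "(\<lambda>u. Re (P (cis (- u)))) \<in> borel_measurable \<mu>"
    using holomorphic_on_imp_continuous_on[OF P(1)]
    by (intro continuous_measurable_circle) (auto intro!: continuous_intros intro: continuous_on_compose2)
  have i1: "integrable \<mu> (\<lambda>u. \<bar>Re (P (cis (- u))) - min (w u) (real n)\<bar>)"
  proof (rule integrable_const_bound[where B = "real n + 1"])
    show "AE u in \<mu>. norm \<bar>Re (P (cis (- u))) - min (w u) (real n)\<bar> \<le> real n + 1"
    proof (rule AE_I2)
      fix u assume "u \<in> space \<mu>"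
      from w(2)[OF this] P(3)[of u] show "norm \<bar>Re (P (cis (- u))) - min (w u) (real n)\<bar> \<le> real n + 1"
        by (auto simp: min_def)
    qed
  qed measurable
  have i2: "integrable \<mu> (\<lambda>u. \<bar>min (w u) (real n) - w u\<bar>)"
    using w by (auto intro!: integrable_abs integrable_min)
  have i0: "integrable \<mu> (\<lambda>u. \<bar>Re (P (cis (- u))) - w u\<bar>)"
    by (rule Bochner_Integration.integrable_bound[OF Bochner_Integration.integrable_add[OF i1 i2]]) auto
  have "(\<integral>u. \<bar>Re (P (cis (- u))) - w u\<bar> \<partial>\<mu>) \<le>
     (\<integral>u. \<bar>Re (P (cis (- u))) - min (w u) (real n)\<bar> + \<bar>min (w u) (real n) - w u\<bar> \<partial>\<mu>)"
    by (intro integral_mono[OF i0 Bochner_Integration.integrable_add[OF i1 i2]]) auto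
  also have "\<dots> < e" using P(4) n i1 i2 by simp
  finally show ?thesis using P by blast
qed

end

section \<open>Trigonometric polynomials and entire functions on the circle\<close>

lemma cmod_trig [simp]: "cmod (trig s u) = 1"
  by (simp add: trig_def)

lemma trig_mult: "trig s u * trig r u = trig (s + r) u"
  by (simp add: trig_def cis_mult algebra_simps)

lemma cnj_trig: "cnj (trig s u) = trig (- s) u"
  by (simp add: trig_def cis_cnj)

lemma trig_power: "cis (- u) ^ n = trig (- int n) u"
  by (simp add: trig_def Complex.DeMoivre)

lemma continuous_on_trig: "continuous_on UNIV (trig s)"
  unfolding trig_def by (intro continuous_intros)

lemma entire_series_on_circle:
  fixes F :: "complex \<Rightarrow> complex"
  assumes F: "F holomorphic_on UNIV"
  shows "\<exists>a. a 0 = F 0 \<and> (\<forall>e>0. \<exists>N. \<forall>u. cmod (F (cis (- u)) - (\<Sum>n<Suc N. a n * trig (- int n) u)) < e)"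
proof -
  define a where "a n = (deriv ^^ n) F 0 / fact n" for n
  have s: "(\<lambda>n. a n * z ^ n) sums F z" for z
    using holomorphic_power_series[of F 0 "cmod z + 1" z] F
    by (auto simp: a_def intro: holomorphic_on_subset)
  have sn: "summable (\<lambda>n. cmod (a n * 1 ^ n))"
    by (rule powser_insidea[of a 2]) (use s[of 2] in \<open>auto simp: sums_iff\<close>)
  then have sn: "summable (\<lambda>n. cmod (a n))" by simp
  have "\<exists>N. \<forall>u. cmod (F (cis (- u)) - (\<Sum>n<Suc N. a n * trig (- int n) u)) < e" if e: "e > 0" for e
  proof -
    obtain N where N: "\<And>n. n \<ge> N \<Longrightarrow> norm (\<Sum>i. cmod (a (i + n))) < e"
      using suminf_exist_split[OF e sn] by blast
    have "cmod (F (cis (- u)) - (\<Sum>n<Suc N. a n * trig (- int n) u)) < e" for u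
    proof -
      define b where "b n = a n * cis (- u) ^ n" for n
      have nb: "cmod (b n) = cmod (a n)" for n by (simp add: b_def norm_mult norm_power)
      have b: "summable b" "F (cis (- u)) = suminf b"
        using s[of "cis (- u)"] unfolding b_def by (auto simp: sums_iff)
      have "F (cis (- u)) - (\<Sum>n<Suc N. b n) = (\<Sum>n. b (n + Suc N))"
        unfolding b(2) using suminf_minus_initial_segment[OF b(1), of "Suc N"] by simp
      also have "cmod \<dots> \<le> (\<Sum>n. cmod (b (n + Suc N)))"
        by (rule summable_norm) (use summable_ignore_initial_segment[OF sn, of "Suc N"] in \<open>simp add: nb\<close>)
      also have "\<dots> < e" using N[of "Suc N"] unfolding nb by simp
      finally show ?thesis by (simp add: b_def trig_power)
    qed
    then show ?thesis by blast
  qed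
  moreover have "a 0 = F 0" by (simp add: a_def)
  ultimately show ?thesis by blast
qed

context circle_measure
begin

lemma trig_measurable [measurable]: "trig s \<in> borel_measurable \<mu>"
  by (rule continuous_measurable_circle[OF continuous_on_trig])

lemma trig_L2_circle: "trig s \<in> L2 \<mu>"
  by (rule L2_bounded[where C = 1]) auto

lemma entire_measurable:
  fixes F :: "complex \<Rightarrow> complex"
  assumes "F holomorphic_on UNIV" shows "(\<lambda>u. F (cis (- u))) \<in> borel_measurable \<mu>"
  using holomorphic_on_imp_continuous_on[OF assms]
  by (intro continuous_measurable_circle) (auto intro!: continuous_intros intro: continuous_on_compose2)

lemma entire_bounded:
  fixes F :: "complex \<Rightarrow> complex"
  assumes "F holomorphic_on UNIV" shows "\<exists>C. \<forall>u. cmod (F (cis (- u))) \<le> C"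
proof -
  have "compact (F ` sphere 0 1)"
    by (rule compact_continuous_image)
      (auto intro: holomorphic_on_imp_continuous_on holomorphic_on_subset[OF assms])
  then obtain C where "\<And>z. z \<in> sphere 0 1 \<Longrightarrow> cmod (F z) \<le> C"
    using compact_imp_bounded by (fastforce simp: bounded_iff)
  then show ?thesis by (intro exI[of _ C]) simp
qed

lemma entire_L2:
  assumes "F holomorphic_on UNIV" shows "(\<lambda>u. F (cis (- u))) \<in> L2 \<mu>"
  using entire_bounded[OF assms] entire_measurable[OF assms] by (blast intro: L2_bounded)

lemma sqnorm_le_uniform:
  assumes f: "f \<in> L2 \<mu>" and le: "\<And>u. cmod (f u) \<le> d"
  shows "sqnorm \<mu> f \<le> d\<^sup>2 * measure \<mu> (space \<mu>)"
proof -
  have "sqnorm \<mu> f \<le> (\<integral>u. d\<^sup>2 \<partial>\<mu>)"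
    unfolding sqnorm_def by (rule integral_mono) (use f le in \<open>auto intro!: power_mono\<close>)
  then show ?thesis by (simp add: mult.commute)
qed

lemma ex_small_square: assumes "e > 0" shows "\<exists>d>0. d\<^sup>2 * measure \<mu> (space \<mu>) < e"
proof -
  define K where "K = measure \<mu> (space \<mu>)"
  have K: "K \<ge> 0" by (simp add: K_def)
  define d where "d = sqrt (e / (K + 1))"
  have "d\<^sup>2 * K = e * (K / (K + 1))" using assms K by (simp add: d_def)
  also have "\<dots> < e * 1" using assms K by (intro mult_strict_left_mono) auto
  finally have "d\<^sup>2 * K < e" by simp
  moreover have "d > 0" using assms K by (simp add: d_def)
  ultimately show ?thesis unfolding K_def by blast
qed

text \<open>The partial sums of the power series of \<open>F\<close> converge uniformly on the circle, and its \<open>n\<close>-th term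
  is a multiple of the character $e^{-inu}$.\<close>

lemma entire_in_past:
  fixes F :: "complex \<Rightarrow> complex"
  assumes F: "F holomorphic_on UNIV"
  shows "(\<lambda>u. F (cis (- u))) \<in> closed_span \<mu> trig {..0}"
    and "F 0 = 0 \<Longrightarrow> (\<lambda>u. F (cis (- u))) \<in> closed_span \<mu> trig {..-1}"
proof -
  have *: "(\<lambda>u. F (cis (- u))) \<in> closed_span \<mu> trig S"
    if S: "\<And>n. (n = 0 \<and> F 0 = 0) \<or> - int n \<in> S" for S
  proof (rule closed_span_closed[OF trig_L2_circle entire_L2[OF F]])
    fix e :: real assume "e > 0"
    then obtain d where d: "d > 0" "d\<^sup>2 * measure \<mu> (space \<mu>) < e" using ex_small_square by blast
    obtain a N where a: "a 0 = F 0" "\<And>u. cmod (F (cis (- u)) - (\<Sum>n<Suc N. a n * trig (- int n) u)) < d"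
      using entire_series_on_circle[OF F] d(1) by blast
    have in_span: "(\<lambda>u. \<Sum>n<Suc N. a n * trig (- int n) u) \<in> closed_span \<mu> trig S"
    proof (rule closed_span_sum[OF trig_L2_circle])
      fix n show "(\<lambda>u. a n * trig (- int n) u) \<in> closed_span \<mu> trig S"
      proof (cases "n = 0 \<and> F 0 = 0")
        case True then show ?thesis using a(1) by (simp add: closed_span_zero)
      next
        case False then show ?thesis using S[of n] by (intro closed_span_scale closed_span_generator trig_L2_circle) auto
      qed
    qed
    have "sqnorm \<mu> (\<lambda>u. F (cis (- u)) - (\<Sum>n<Suc N. a n * trig (- int n) u)) \<le> d\<^sup>2 * measure \<mu> (space \<mu>)"
      using a(2) by (intro sqnorm_le_uniform L2_diff entire_L2[OF F] closed_spanD[OF in_span] less_imp_le)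
    then show "\<exists>g\<in>closed_span \<mu> trig S. sqnorm \<mu> (\<lambda>u. F (cis (- u)) - g u) < e"
      using d(2) by (intro bexI[OF _ in_span]) simp
  qed
  show "(\<lambda>u. F (cis (- u))) \<in> closed_span \<mu> trig {..0}" by (rule *) auto
  show "(\<lambda>u. F (cis (- u))) \<in> closed_span \<mu> trig {..-1}" if "F 0 = 0"
    by (rule *) (use that in auto)
qed

lemma closed_span_cnj:
  assumes "f \<in> closed_span \<mu> trig UNIV" shows "(\<lambda>u. cnj (f u)) \<in> closed_span \<mu> trig UNIV"
proof (rule closed_spanI)
  show "(\<lambda>u. cnj (f u)) \<in> L2 \<mu>" using assms by (intro L2_cnj closed_spanD)
  fix e :: real assume "e > 0"
  with assms obtain F c where F: "finite F" "sqnorm \<mu> (\<lambda>u. f u - (\<Sum>s\<in>F. c s * trig s u)) < e"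
    unfolding closed_span_def by auto
  have eq: "cnj (f u) - (\<Sum>s\<in>uminus ` F. cnj (c (- s)) * trig s u) = cnj (f u - (\<Sum>s\<in>F. c s * trig s u))" for u
    by (subst sum.reindex) (auto simp: inj_on_def cnj_trig)
  have "sqnorm \<mu> (\<lambda>u. cnj (f u) - (\<Sum>s\<in>uminus ` F. cnj (c (- s)) * trig s u)) < e"
    using F(2) unfolding sqnorm_def eq complex_mod_cnj .
  then show "\<exists>F c. finite F \<and> F \<subseteq> UNIV \<and> sqnorm \<mu> (\<lambda>u. cnj (f u) - (\<Sum>s\<in>F. c s * trig s u)) < e"
    using F(1) by (intro exI[of _ "uminus ` F"] exI[of _ "\<lambda>s. cnj (c (- s))"]) auto
qed

lemma indicator_in_span:
  assumes A: "A \<in> sets \<mu>"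
  shows "indicator A \<in> closed_span \<mu> trig UNIV"
proof (rule closed_span_closed[OF trig_L2_circle])
  have [measurable]: "A \<in> sets \<mu>" by fact
  show 1: "indicator A \<in> L2 \<mu>" by (rule L2_bounded[where C = 1]) (auto simp: indicator_def)
  fix e :: real assume "e > 0"
  then obtain P where P: "P holomorphic_on UNIV"
    "\<And>u. 0 \<le> Re (P (cis (- u)))" "\<And>u. Re (P (cis (- u))) \<le> 2"
    "(\<integral>u. \<bar>Re (P (cis (- u))) - indicator A u\<bar> \<partial>\<mu>) < e / 2"
    using entire_L1_approx_bounded[of "indicator A" 1 "e/2"] by (auto simp: indicator_def)
  define g where "g u = (1/2) * (P (cis (- u)) + cnj (P (cis (- u))))" for u
  have g: "g u = of_real (Re (P (cis (- u))))" for u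
    by (simp add: g_def complex_add_cnj)
  have "(\<lambda>u. P (cis (- u))) \<in> closed_span \<mu> trig UNIV"
    using entire_in_past(1)[OF P(1)] closed_span_mono[of "{..0}" UNIV] by blast
  then have gs: "g \<in> closed_span \<mu> trig UNIV"
    unfolding g_def by (intro closed_span_scale closed_span_add[OF trig_L2_circle] closed_span_cnj)
  have [measurable]: "(\<lambda>u. Re (P (cis (- u)))) \<in> borel_measurable \<mu>"
    using entire_measurable[OF P(1)] by measurable
  have b: "\<bar>Re (P (cis (- u))) - indicator A u\<bar> \<le> 2" for u
    using P(2,3)[of u] by (auto simp: indicator_def abs_le_iff)
  have "sqnorm \<mu> (\<lambda>u. indicator A u - g u) \<le> (\<integral>u. 2 * \<bar>Re (P (cis (- u))) - indicator A u\<bar> \<partial>\<mu>)"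
    unfolding sqnorm_def
  proof (rule integral_mono)
    show "(cmod (indicator A u - g u))\<^sup>2 \<le> 2 * \<bar>Re (P (cis (- u))) - indicator A u\<bar>" for u
    proof -
      have "indicator A u - g u = of_real (indicator A u - Re (P (cis (- u))))"
        unfolding g by (simp add: indicator_def)
      then have "(cmod (indicator A u - g u))\<^sup>2 = \<bar>Re (P (cis (- u))) - indicator A u\<bar> * \<bar>Re (P (cis (- u))) - indicator A u\<bar>"
        by (simp only: norm_of_real) (simp add: power2_eq_square abs_minus_commute)
      also have "\<dots> \<le> 2 * \<bar>Re (P (cis (- u))) - indicator A u\<bar>"
        using b[of u] by (intro mult_right_mono) auto
      finally show ?thesis .
    qed
    show "integrable \<mu> (\<lambda>u. 2 * \<bar>Re (P (cis (- u))) - indicator A u\<bar>)"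
      by (rule integrable_const_bound[where B = 4]) (use b in auto)
  qed (use L2_integrable[OF L2_diff[OF 1 closed_spanD[OF gs]]] in auto)
  also have "\<dots> < e" using P(4) by simp
  finally show "\<exists>g\<in>closed_span \<mu> trig UNIV. sqnorm \<mu> (\<lambda>u. indicator A u - g u) < e"
    using gs by blast
qed

text \<open>Simple functions are dense, and an indicator function is approximated by real parts of entire
  functions, that is by sums of an element of the past and its conjugate.\<close>

lemma trig_span_dense: "L2 \<mu> \<subseteq> closed_span \<mu> trig UNIV"
proof
  fix f assume f: "f \<in> L2 \<mu>"
  have simple: "s \<in> closed_span \<mu> trig UNIV" if s: "simple_function \<mu> s" for s :: "real \<Rightarrow> complex"
  proof (rule closed_span_cong_AE[OF _ borel_measurable_simple_function[OF s] _ trig_L2_circle])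
    show "(\<lambda>u. \<Sum>y\<in>s ` space \<mu>. y * indicator (s -` {y} \<inter> space \<mu>) u) \<in> closed_span \<mu> trig UNIV"
      by (intro closed_span_sum[OF trig_L2_circle] closed_span_scale indicator_in_span simple_functionD(2)[OF s])
    show "AE u in \<mu>. (\<Sum>y\<in>s ` space \<mu>. y * indicator (s -` {y} \<inter> space \<mu>) u) = s u"
    proof (rule AE_I2)
      fix u assume u: "u \<in> space \<mu>"
      have "(\<Sum>y\<in>s ` space \<mu>. y * indicator (s -` {y} \<inter> space \<mu>) u) = (\<Sum>y\<in>s ` space \<mu>. if y = s u then y else 0)"
        using u by (intro sum.cong) (auto simp: indicator_def)
      also have "\<dots> = s u" using u simple_functionD(1)[OF s] by (subst sum.delta) (auto simp del: space_circle)
      finally show "(\<Sum>y\<in>s ` space \<mu>. y * indicator (s -` {y} \<inter> space \<mu>) u) = s u" .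
    qed
  qed
  obtain s where s: "\<And>n::nat. simple_function \<mu> (s n)" "(\<lambda>n. sqnorm \<mu> (\<lambda>u. s n u - f u)) \<longlonglongrightarrow> 0"
    using L2_simple_approx[OF f] by blast
  show "f \<in> closed_span \<mu> trig UNIV"
  proof (rule closed_span_closed[OF trig_L2_circle f])
    fix e :: real assume "e > 0"
    from LIMSEQ_D[OF s(2) this] obtain n where "norm (sqnorm \<mu> (\<lambda>u. s n u - f u) - 0) < e" by blast
    then show "\<exists>g\<in>closed_span \<mu> trig UNIV. sqnorm \<mu> (\<lambda>u. f u - g u) < e"
      using simple[OF s(1), of n] by (intro bexI[of _ "s n"]) (auto simp: sqnorm_minus_commute[of \<mu> f])
  qed
qed

lemma trig_shift:
  assumes "f \<in> closed_span \<mu> trig {..t}"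
  shows "(\<lambda>u. trig s u * f u) \<in> closed_span \<mu> trig {..t + s}"
proof (rule closed_span_multiplier[OF trig_L2_circle assms, where C = 1])
  fix r assume "r \<in> {..t}"
  then show "(\<lambda>u. trig s u * trig r u) \<in> closed_span \<mu> trig {..t + s}"
    unfolding trig_mult by (intro closed_span_generator trig_L2_circle) simp
qed auto

text \<open>If a bounded idempotent \<open>b\<close> is predictable one step ahead, then multiplication by \<open>b\<close> moves
  the past back by one step, and since $b^n=b$ this can be repeated: everything supported where
  $b = 1$ lies in the remote past.\<close>

lemma idempotent_in_remote_past:
  assumes b: "b \<in> closed_span \<mu> trig {..-1}" and idem: "\<And>u. b u * b u = b u" and f: "f \<in> L2 \<mu>"
  shows "(\<lambda>u. b u * f u) \<in> closed_span \<mu> trig {..t}"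
proof -
  have bm: "b \<in> borel_measurable \<mu>" using closed_spanD[OF b] by auto
  have bb: "cmod (b u) \<le> 1" for u using idem[of u] by (cases "b u = 0") auto
  have retreat: "(\<lambda>u. b u * g u) \<in> closed_span \<mu> trig {..r - 1}" if g: "g \<in> closed_span \<mu> trig {..r}" for g r
  proof (rule closed_span_multiplier[OF trig_L2_circle g bm bb])
    fix s assume "s \<in> {..r}"
    then show "(\<lambda>u. b u * trig s u) \<in> closed_span \<mu> trig {..r - 1}"
      using trig_shift[OF b, of s] closed_span_mono[of "{..-1 + s}" "{..r - 1}" \<mu> trig]
      by (auto simp: mult.commute)
  qed
  have iter: "(\<lambda>u. b u * trig s u) \<in> closed_span \<mu> trig {..s - 1 - int n}" for s n
  proof (induction n)
    case 0
    show ?case using retreat[OF closed_span_generator[OF trig_L2_circle], of s s] by simp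
  next
    case (Suc n)
    show ?case using retreat[OF Suc] idem by (simp add: mult.assoc[symmetric])
  qed
  show ?thesis
  proof (rule closed_span_multiplier[OF trig_L2_circle _ bm bb])
    show "f \<in> closed_span \<mu> trig UNIV" using f trig_span_dense by blast
    fix s
    show "(\<lambda>u. b u * trig s u) \<in> closed_span \<mu> trig {..t}"
    proof (rule subsetD[OF closed_span_mono iter[of s "nat \<bar>s - t\<bar>"]])
      have "s - 1 - int (nat \<bar>s - t\<bar>) \<le> t" by linarith
      then show "{..s - 1 - int (nat \<bar>s - t\<bar>)} \<subseteq> {..t}" by simp
    qed
  qed
qed

end

section \<open>Lebesgue measure on the circle\<close>

lemma emeasure_leb_circ: "emeasure leb_circ {-pi..<pi} = ennreal (2 * pi)"
  unfolding leb_circ_def by (subst emeasure_restrict_space) auto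

interpretation leb: circle_measure leb_circ
proof -
  interpret finite_measure leb_circ
    by (rule finite_measureI) (simp add: emeasure_leb_circ)
  show "circle_measure leb_circ" by unfold_locales simp
qed

lemma measure_leb_circ: "measure leb_circ {-pi..<pi} = 2 * pi"
  by (simp add: measure_def emeasure_leb_circ)

lemma integral_trig: "(\<integral>u. trig k u \<partial>leb_circ) = (if k = 0 then 2 * pi else 0)"
proof (cases "k = 0")
  case True
  then show ?thesis by (simp add: trig_def measure_leb_circ scaleR_conv_of_real)
next
  case False
  have [measurable]: "trig k \<in> borel_measurable borel"
    by (rule borel_measurable_continuous_onI[OF continuous_on_trig])
  have "(\<integral>u. trig k u \<partial>leb_circ) = (\<integral>u. indicator {-pi..<pi} u *\<^sub>R trig k u \<partial>lborel)"
    unfolding leb_circ_def by (subst integral_restrict_space) auto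
  also have "\<dots> = (\<integral>u. indicator {-pi..pi} u *\<^sub>R trig k u \<partial>lborel)"
  proof (rule integral_cong_AE)
    have "AE u in lborel. u \<noteq> pi" by (rule AE_lborel_singleton)
    then show "AE u in lborel. indicator {-pi..<pi} u *\<^sub>R trig k u = indicator {-pi..pi} u *\<^sub>R trig k u"
      by eventually_elim (auto simp: indicator_def)
  qed measurable
  also have "\<dots> = cis (of_int k * pi) / (\<i> * of_int k) - cis (of_int k * (- pi)) / (\<i> * of_int k)"
  proof (rule integral_FTC_Icc)
    fix x
    have ii: "- (\<i> * (E * \<i>)) = E" for E by (simp add: complex_eq_iff)
    show "((\<lambda>u. cis (of_int k * u) / (\<i> * of_int k)) has_vector_derivative trig k x) (at x within {-pi..pi})"
      unfolding trig_def cis_conv_exp using False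
      by (auto intro!: derivative_eq_intros has_vector_derivative_real_field simp: ii)
  qed (auto intro: continuous_on_subset[OF continuous_on_trig])
  also have "cis (of_int k * (- pi)) = cis (of_int k * pi)"
  proof -
    have "sin (of_int k * pi) = 0" using sin_times_pi_eq_0[of "of_int k"] by simp
    then show ?thesis by (simp add: complex_eq_iff)
  qed
  finally show ?thesis using False by simp
qed

lemma entire_mean_value:
  fixes F :: "complex \<Rightarrow> complex"
  assumes F: "F holomorphic_on UNIV"
  shows "(\<integral>u. F (cis (- u)) \<partial>leb_circ) = 2 * pi * F 0"
proof -
  have iF: "integrable leb_circ (\<lambda>u. F (cis (- u)))"
    using leb.entire_bounded[OF F] leb.entire_measurable[OF F]
    by (auto intro: leb.integrable_const_bound)
  have "cmod ((\<integral>u. F (cis (- u)) \<partial>leb_circ) - 2 * pi * F 0) \<le> e * (2 * pi)" if e: "e > 0" for e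
  proof -
    obtain a N where a: "a 0 = F 0" "\<And>u. cmod (F (cis (- u)) - (\<Sum>n<Suc N. a n * trig (- int n) u)) < e"
      using entire_series_on_circle[OF F] e by blast
    have it: "integrable leb_circ (\<lambda>u. a n * trig (- int n) u)" for n
      by (intro integrable_mult_right leb.integrable_const_bound[where B = 1]) auto
    have "(\<integral>u. (\<Sum>n<Suc N. a n * trig (- int n) u) \<partial>leb_circ) = (\<Sum>n<Suc N. a n * (\<integral>u. trig (- int n) u \<partial>leb_circ))"
      using it by (subst Bochner_Integration.integral_sum) auto
    also have "\<dots> = (\<Sum>n<Suc N. if n = 0 then a 0 * (2 * pi) else 0)"
      unfolding integral_trig by (intro sum.cong) auto
    also have "\<dots> = 2 * pi * F 0" by (simp add: a(1))
    finally have "(\<integral>u. F (cis (- u)) \<partial>leb_circ) - 2 * pi * F 0 =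
       (\<integral>u. F (cis (- u)) - (\<Sum>n<Suc N. a n * trig (- int n) u) \<partial>leb_circ)"
      by (subst Bochner_Integration.integral_diff[OF iF Bochner_Integration.integrable_sum[OF it]]) auto
    also have "cmod \<dots> \<le> (\<integral>u. cmod (F (cis (- u)) - (\<Sum>n<Suc N. a n * trig (- int n) u)) \<partial>leb_circ)"
      by (rule integral_norm_bound)
    also have "\<dots> \<le> (\<integral>u. e \<partial>leb_circ)"
      by (rule integral_mono)
        (use iF it a(2) in \<open>auto intro!: integrable_norm Bochner_Integration.integrable_diff Bochner_Integration.integrable_sum less_imp_le\<close>)
    finally show ?thesis by (simp add: measure_leb_circ mult.commute)
  qed
  then have "cmod ((\<integral>u. F (cis (- u)) \<partial>leb_circ) - 2 * pi * F 0) \<le> e" if "e > 0" for e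
    using that divide_pos_pos[OF that, of "2 * pi"] by fastforce
  then show ?thesis by (metis eq_iff_diff_eq_0 field_le_epsilon add_0 norm_le_zero_iff)
qed

text \<open>A square integrable function orthogonal to all characters is orthogonal to its own
  approximants, hence vanishes.\<close>

lemma vanishing_Fourier_coefficients:
  assumes d: "d \<in> L2 leb_circ" and orth: "\<And>k. (\<integral>u. d u * trig k u \<partial>leb_circ) = 0"
  shows "AE u in leb_circ. d u = 0"
proof -
  have "sqnorm leb_circ d < e" if e: "e > 0" for e
  proof -
    have "d \<in> closed_span leb_circ trig UNIV" using leb.trig_span_dense d by (rule subsetD)
    then obtain F c where F: "finite F" "sqnorm leb_circ (\<lambda>u. d u - (\<Sum>s\<in>F. c s * trig s u)) < e"
      unfolding closed_span_def using e by auto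
    define p where "p u = (\<Sum>s\<in>F. c s * trig s u)" for u
    have p: "p \<in> L2 leb_circ" unfolding p_def by (intro L2_sum L2_scale leb.trig_L2_circle)
    have i: "integrable leb_circ (\<lambda>u. d u * cnj (p u))" by (rule L2_mult_integrable[OF d L2_cnj[OF p]])
    have "(\<integral>u. d u * cnj (p u) \<partial>leb_circ) = (\<integral>u. (\<Sum>s\<in>F. cnj (c s) * (d u * trig (- s) u)) \<partial>leb_circ)"
      unfolding p_def cnj_sum complex_cnj_mult cnj_trig sum_distrib_left by (simp add: mult.left_commute)
    also have "\<dots> = (\<Sum>s\<in>F. cnj (c s) * (\<integral>u. d u * trig (- s) u \<partial>leb_circ))"
      using L2_mult_integrable[OF d leb.trig_L2_circle]
      by (subst Bochner_Integration.integral_sum) auto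
    also have "\<dots> = 0" by (simp add: orth)
    finally have orth_p: "(\<integral>u. d u * cnj (p u) \<partial>leb_circ) = 0" .
    define R where "R u = Re (d u * cnj (p u))" for u
    have R: "integrable leb_circ R" "(\<integral>u. R u \<partial>leb_circ) = 0"
      unfolding R_def using integrable_Re[OF i] integral_Re[OF i] orth_p by simp_all
    have pt: "(cmod (d u - p u))\<^sup>2 = (cmod (d u))\<^sup>2 + (cmod (p u))\<^sup>2 - 2 * R u" for u
      unfolding cmod_power2 R_def by (simp add: power2_eq_square algebra_simps)
    have "sqnorm leb_circ (\<lambda>u. d u - p u) = sqnorm leb_circ d + sqnorm leb_circ p"
      unfolding sqnorm_def pt using L2_integrable[OF d] L2_integrable[OF p] R by simp
    then show ?thesis using F(2) sqnorm_nonneg[of leb_circ p] unfolding p_def by linarith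
  qed
  then have "sqnorm leb_circ d \<le> 0" using field_le_epsilon[of "sqnorm leb_circ d" 0] less_imp_le by force
  then have "sqnorm leb_circ d = 0" using sqnorm_nonneg[of leb_circ d] by linarith
  then show ?thesis using sqnorm_0_iff[OF d] by simp
qed

lemma exp_diff_le:
  fixes a b :: real
  assumes "a \<le> m" "b \<le> m" shows "\<bar>exp a - exp b\<bar> \<le> exp m * \<bar>a - b\<bar>"
proof -
  have *: "exp a - exp b \<le> exp m * \<bar>a - b\<bar>" if "a \<le> m" for a b :: real
  proof -
    have "exp a * (1 + (b - a)) \<le> exp a * exp (b - a)"
      by (intro mult_left_mono exp_ge_add_one_self) auto
    then have "exp a - exp b \<le> exp a * (a - b)" by (simp add: exp_diff algebra_simps)
    also have "\<dots> \<le> exp a * \<bar>a - b\<bar>" by (intro mult_left_mono) auto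
    also have "\<dots> \<le> exp m * \<bar>a - b\<bar>" using that by (intro mult_right_mono) auto
    finally show ?thesis .
  qed
  show ?thesis using *[OF assms(1), of b] *[OF assms(2), of a] by (simp add: abs_minus_commute abs_le_iff)
qed

lemma integral_mono_measure:
  fixes g :: "'a \<Rightarrow> real"
  assumes s: "sets M = sets N" and le: "\<And>A. A \<in> sets M \<Longrightarrow> emeasure M A \<le> emeasure N A"
    and g: "integrable N g" "\<And>x. 0 \<le> g x"
  shows "integral\<^sup>L M g \<le> integral\<^sup>L N g"
proof -
  have gm: "g \<in> borel_measurable M" using g(1) s by (simp cong: measurable_cong_sets)
  have "M \<le> N" using s le by (simp add: le_measure)
  then have nn: "(\<integral>\<^sup>+x. ennreal (g x) \<partial>M) \<le> (\<integral>\<^sup>+x. ennreal (g x) \<partial>N)"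
    by (rule nn_integral_mono_measure[OF s])
  have "(\<integral>\<^sup>+x. ennreal (g x) \<partial>N) = ennreal (integral\<^sup>L N g)"
    by (rule nn_integral_eq_integral) (use g in auto)
  with nn show ?thesis
    using gm g(2) by (simp add: integral_eq_nn_integral enn2real_leI integral_nonneg_AE)
qed

context circle_measure
begin

text \<open>The smallest measure dominating both \<open>\<mu>\<close> and Lebesgue measure is finite, so one entire
  function approximates \<open>w\<close> with respect to both.\<close>

lemma entire_L1_approx_both:
  assumes w: "w \<in> borel_measurable \<mu>" "\<And>u. u \<in> space \<mu> \<Longrightarrow> 0 \<le> w u \<and> w u \<le> C" and C: "0 \<le> C" and e: "e > 0"
  shows "\<exists>P. P holomorphic_on UNIV \<and> Im (P 0) = 0 \<and> (\<forall>u. 0 \<le> Re (P (cis (- u))) \<and> Re (P (cis (- u))) \<le> C + 1) \<and>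
     (\<integral>u. \<bar>Re (P (cis (- u))) - w u\<bar> \<partial>\<mu>) < e \<and> (\<integral>u. \<bar>Re (P (cis (- u))) - w u\<bar> \<partial>leb_circ) < e"
proof -
  define m where "m = sup_measure' leb_circ \<mu>"
  have sm: "sets m = sets leb_circ" by (simp add: m_def sets_circle)
  have fin: "emeasure m (space m) \<noteq> \<infinity>"
  proof -
    have "emeasure m {-pi..<pi} \<le> emeasure leb_circ {-pi..<pi} + emeasure \<mu> {-pi..<pi}"
      unfolding m_def
      by (subst emeasure_sup_measure'[OF sets_circle])
        (auto intro!: SUP_least add_mono emeasure_mono
          simp: sets.top[of leb_circ, simplified] sets.top[of \<mu>, unfolded space_circle])
    also have "\<dots> < \<infinity>"
      using emeasure_finite leb.emeasure_finite by (simp add: less_top[symmetric])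
    finally show ?thesis using sets_eq_imp_space_eq[OF sm] by simp
  qed
  interpret fm: finite_measure m by (rule finite_measureI[OF fin])
  interpret m: circle_measure m by unfold_locales (rule sm)
  have wm: "w \<in> borel_measurable m" using w(1) by (simp add: measurable_circle_iff m.measurable_circle_iff)
  obtain P where P: "P holomorphic_on UNIV" "Im (P 0) = 0"
    "\<And>u. 0 \<le> Re (P (cis (- u))) \<and> Re (P (cis (- u))) \<le> C + 1"
    "(\<integral>u. \<bar>Re (P (cis (- u))) - w u\<bar> \<partial>m) < e"
    using m.entire_L1_approx_bounded[OF wm _ C e] w(2) by auto
  have "integrable m (\<lambda>u. \<bar>Re (P (cis (- u))) - w u\<bar>)"
  proof (rule fm.integrable_const_bound[where B = "C + 1"])
    show "AE u in m. norm \<bar>Re (P (cis (- u))) - w u\<bar> \<le> C + 1"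
    proof (rule AE_I2)
      fix u assume "u \<in> space m"
      then show "norm \<bar>Re (P (cis (- u))) - w u\<bar> \<le> C + 1" using P(3)[of u] w(2)[of u] by auto
    qed
    show "(\<lambda>u. \<bar>Re (P (cis (- u))) - w u\<bar>) \<in> borel_measurable m"
      using m.entire_measurable[OF P(1)] wm by measurable
  qed
  then have "(\<integral>u. \<bar>Re (P (cis (- u))) - w u\<bar> \<partial>\<mu>) \<le> (\<integral>u. \<bar>Re (P (cis (- u))) - w u\<bar> \<partial>m)"
    and "(\<integral>u. \<bar>Re (P (cis (- u))) - w u\<bar> \<partial>leb_circ) \<le> (\<integral>u. \<bar>Re (P (cis (- u))) - w u\<bar> \<partial>m)"
    by (auto intro!: integral_mono_measure simp: sm sets_circle m_def
      le_emeasure_sup_measure'1[OF sets_circle] le_emeasure_sup_measure'2[OF sets_circle])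
  then show ?thesis using P by (intro exI[of _ P]) auto
qed

end

lemma Re_entire_mean_value:
  fixes P :: "complex \<Rightarrow> complex"
  assumes P: "P holomorphic_on UNIV"
  shows "(\<integral>u. Re (P (cis (- u))) \<partial>leb_circ) = 2 * pi * Re (P 0)"
    and "integrable leb_circ (\<lambda>u. P (cis (- u)))"
proof -
  show iP: "integrable leb_circ (\<lambda>u. P (cis (- u)))"
    using leb.entire_bounded[OF P] leb.entire_measurable[OF P] by (auto intro: leb.integrable_const_bound)
  show "(\<integral>u. Re (P (cis (- u))) \<partial>leb_circ) = 2 * pi * Re (P 0)"
    using integral_Re[OF iP] entire_mean_value[OF P] by simp
qed

section \<open>Singular part and logarithmic integrability\<close>

text \<open>The null set \<open>N\<close> carries the singular component: off \<open>N\<close>, \<open>\<mu>\<close> has density \<open>f\<close>.\<close>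

locale lebesgue_decomposition = circle_measure +
  fixes f :: "real \<Rightarrow> real" and N :: "real set"
  assumes f_measurable [measurable]: "f \<in> borel_measurable leb_circ"
    and f_nonneg: "\<And>u. u \<in> {-pi..<pi} \<Longrightarrow> 0 \<le> f u"
    and N_sets: "N \<in> sets leb_circ" and N_null: "emeasure leb_circ N = 0"
    and ac: "\<And>A. A \<in> sets leb_circ \<Longrightarrow> emeasure \<mu> (A - N) = emeasure (density leb_circ (\<lambda>u. ennreal (f u))) A"
begin

lemma N_sets' [measurable]: "N \<in> sets \<mu>" "N \<in> sets leb_circ"
  using N_sets sets_circle by auto

lemma AE_not_N: "AE u in leb_circ. u \<notin> N"
  using N_sets N_null by (intro AE_not_in) auto

lemma AE_f_nonneg: "AE u in leb_circ. 0 \<le> f u"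
  using f_nonneg by (intro AE_I2) simp

lemma density_off_N: "density \<mu> (\<lambda>u. ennreal (indicator (- N) u)) = density leb_circ (\<lambda>u. ennreal (f u))"
proof (rule measure_eqI)
  have [measurable]: "(\<lambda>u. ennreal (indicator (- N) u)) \<in> borel_measurable \<mu>"
  proof -
    have "(\<lambda>u. ennreal (1 - indicator N u)) \<in> borel_measurable \<mu>" by measurable
    then show ?thesis by (rule measurable_cong[THEN iffD1, rotated]) (auto simp: indicator_def)
  qed
  fix A assume "A \<in> sets (density \<mu> (\<lambda>u. ennreal (indicator (- N) u)))"
  then have A[measurable]: "A \<in> sets \<mu>" by simp
  have "emeasure (density \<mu> (\<lambda>u. ennreal (indicator (- N) u))) A = (\<integral>\<^sup>+u. indicator (A - N) u \<partial>\<mu>)"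
  proof (subst emeasure_density)
    show "(\<integral>\<^sup>+u. ennreal (indicator (- N) u) * indicator A u \<partial>\<mu>) = (\<integral>\<^sup>+u. indicator (A - N) u \<partial>\<mu>)"
      by (rule nn_integral_cong) (auto simp: indicator_def)
  qed measurable
  also have "\<dots> = emeasure \<mu> (A - N)" by (rule nn_integral_indicator) measurable
  finally show "emeasure (density \<mu> (\<lambda>u. ennreal (indicator (- N) u))) A =
      emeasure (density leb_circ (\<lambda>u. ennreal (f u))) A"
    using ac[of A] A sets_circle by simp
qed (simp add: sets_circle)

lemma integral_split:
  fixes g :: "real \<Rightarrow> real"
  assumes g: "integrable \<mu> g"
  shows "integrable leb_circ (\<lambda>u. f u * g u)"
    and "(\<integral>u. g u \<partial>\<mu>) = (\<integral>u. f u * g u \<partial>leb_circ) + (\<integral>u. indicator N u * g u \<partial>\<mu>)"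
proof -
  have gm[measurable]: "g \<in> borel_measurable \<mu>" using g by auto
  then have [measurable]: "g \<in> borel_measurable leb_circ" by (simp add: measurable_circle_iff)
  have im[measurable]: "(\<lambda>u. indicator (- N) u :: real) \<in> borel_measurable \<mu>"
  proof -
    have "(\<lambda>u. 1 - indicator N u :: real) \<in> borel_measurable \<mu>" by measurable
    then show ?thesis by (rule measurable_cong[THEN iffD1, rotated]) (auto simp: indicator_def)
  qed
  have i1: "integrable \<mu> (\<lambda>u. indicator (- N) u * g u)" and i2: "integrable \<mu> (\<lambda>u. indicator N u * g u)"
    by (rule Bochner_Integration.integrable_bound[OF g]; (auto simp: indicator_def)[1]; fail)+
  have "integrable (density \<mu> (\<lambda>u. ennreal (indicator (- N) u))) g"
    by (subst integrable_density) (use i1 in auto)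
  then have "integrable (density leb_circ (\<lambda>u. ennreal (f u))) g" by (simp add: density_off_N)
  then show "integrable leb_circ (\<lambda>u. f u * g u)"
    by (subst (asm) integrable_density) (use AE_f_nonneg in auto)
  have "(\<integral>u. f u * g u \<partial>leb_circ) = integral\<^sup>L (density leb_circ (\<lambda>u. ennreal (f u))) g"
    by (subst integral_density) (use AE_f_nonneg in auto)
  also have "\<dots> = integral\<^sup>L (density \<mu> (\<lambda>u. ennreal (indicator (- N) u))) g"
    by (simp add: density_off_N)
  also have "\<dots> = (\<integral>u. indicator (- N) u * g u \<partial>\<mu>)"
    by (subst integral_density) auto
  finally have *: "(\<integral>u. f u * g u \<partial>leb_circ) = (\<integral>u. indicator (- N) u * g u \<partial>\<mu>)" .
  have "(\<integral>u. g u \<partial>\<mu>) = (\<integral>u. indicator (- N) u * g u + indicator N u * g u \<partial>\<mu>)"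
    by (rule Bochner_Integration.integral_cong) (auto simp: indicator_def)
  also have "\<dots> = (\<integral>u. f u * g u \<partial>leb_circ) + (\<integral>u. indicator N u * g u \<partial>\<mu>)"
    unfolding * by (rule Bochner_Integration.integral_add[OF i1 i2])
  finally show "(\<integral>u. g u \<partial>\<mu>) = (\<integral>u. f u * g u \<partial>leb_circ) + (\<integral>u. indicator N u * g u \<partial>\<mu>)" .
qed

lemma f_integrable: "integrable leb_circ f"
  using integral_split(1)[of "\<lambda>u. 1"] by simp

text \<open>If \<open>ln f\<close> is not integrable then its negative part is not, because $\ln^+ f\le f$. Hence
  there are bounded $w \ge 0$, supported off \<open>N\<close>, with $e^{2w} f \le 1 + f$ and arbitrarily large mean.\<close>

lemma large_log_weight:
  assumes inf: "(\<integral>\<^sup>+u. abs_ln (f u) \<partial>leb_circ) = \<infinity>"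
  shows "\<exists>w n. w \<in> borel_measurable leb_circ \<and> (\<forall>u. 0 \<le> w u \<and> w u \<le> real n) \<and> (\<forall>u\<in>N. w u = 0) \<and>
    (\<forall>u\<in>{-pi..<pi}. exp (2 * w u) * f u \<le> 1 + f u) \<and> R < (\<integral>u. w u \<partial>leb_circ)"
proof -
  define w where "w n u = (if u \<in> N \<or> 1 \<le> f u then 0 else if f u = 0 then real n else min (real n) \<bar>ln (f u) / 2\<bar>)"
    for n :: nat and u
  have [measurable]: "w n \<in> borel_measurable leb_circ" for n
    unfolding w_def by measurable
  have w0: "0 \<le> w n u" "w n u \<le> real n" for n u by (auto simp: w_def)
  have mono: "incseq (\<lambda>n u. ennreal (w n u))"
    by (auto simp: incseq_def le_fun_def w_def intro!: ennreal_leI)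
  define h where "h u = (if u \<in> N \<or> 1 \<le> f u then 0 else abs_ln (f u) / 2)" for u
  have sup: "(SUP n. ennreal (w n u)) = h u" if "u \<in> {-pi..<pi}" for u
  proof (cases "u \<in> N \<or> 1 \<le> f u")
    case True then show ?thesis by (simp add: w_def h_def)
  next
    case False
    show ?thesis
    proof (cases "f u = 0")
      case True
      have "(SUP n. ennreal (real n)) = \<infinity>"
        using ennreal_SUP_of_nat_eq_top by (simp add: ennreal_of_nat_eq_real_of_nat)
      then show ?thesis using True False by (simp add: w_def h_def abs_ln_def ennreal_top_divide)
    next
      case f0: False
      define a where "a = \<bar>ln (f u) / 2\<bar>"
      have "(SUP n. ennreal (w n u)) = ennreal a"
      proof (rule SUP_eqI)
        fix y assume y: "\<And>n. n \<in> UNIV \<Longrightarrow> ennreal (w n u) \<le> y"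
        have "w (nat \<lceil>a\<rceil>) u = a" using False f0 by (simp add: w_def a_def)
        then show "ennreal a \<le> y" using y[of "nat \<lceil>a\<rceil>"] by simp
      qed (use False f0 in \<open>auto simp: w_def a_def intro!: ennreal_leI\<close>)
      also have "ennreal a = h u"
        using False f0 unfolding h_def abs_ln_def a_def by (simp add: ennreal_divide_numeral abs_divide)
      finally show ?thesis .
    qed
  qed
  have hinf: "(\<integral>\<^sup>+u. h u \<partial>leb_circ) = \<infinity>"
  proof (rule ccontr)
    assume ni: "(\<integral>\<^sup>+u. h u \<partial>leb_circ) \<noteq> \<infinity>"
    have [measurable]: "h \<in> borel_measurable leb_circ" unfolding h_def abs_ln_def by measurable
    have "(\<integral>\<^sup>+u. abs_ln (f u) \<partial>leb_circ) \<le> (\<integral>\<^sup>+u. 2 * h u + ennreal (f u) \<partial>leb_circ)"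
    proof (rule nn_integral_mono_AE)
      show "AE u in leb_circ. abs_ln (f u) \<le> 2 * h u + ennreal (f u)"
        using AE_not_N
      proof eventually_elim
        case (elim u)
        show ?case
        proof (cases "1 \<le> f u")
          case True
          then have "\<bar>ln (f u)\<bar> \<le> f u" using ln_le_minus_one[of "f u"] by simp
          then show ?thesis using True by (auto simp: abs_ln_def h_def intro!: ennreal_leI)
        next
          case False
          then have "2 * h u = abs_ln (f u)"
            using elim by (simp add: h_def ennreal_times_divide ennreal_mult_divide_eq mult.commute)
          then show ?thesis by simp
        qed
      qed
    qed
    also have "\<dots> = 2 * (\<integral>\<^sup>+u. h u \<partial>leb_circ) + (\<integral>\<^sup>+u. ennreal (f u) \<partial>leb_circ)"
      by (subst nn_integral_add) (auto simp: nn_integral_cmult)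
    also have "\<dots> < \<infinity>"
      using ni nn_integral_eq_integral[OF f_integrable AE_f_nonneg]
      by (simp add: less_top[symmetric] ennreal_mult_eq_top_iff)
    finally show False using inf by simp
  qed
  have "(SUP n. \<integral>\<^sup>+u. ennreal (w n u) \<partial>leb_circ) = (\<integral>\<^sup>+u. (SUP n. ennreal (w n u)) \<partial>leb_circ)"
    by (rule nn_integral_monotone_convergence_SUP[OF mono, symmetric]) measurable
  also have "\<dots> = (\<integral>\<^sup>+u. h u \<partial>leb_circ)"
    using sup by (intro nn_integral_cong) simp
  also have "\<dots> = \<infinity>" by (rule hinf)
  finally have "(SUP n. \<integral>\<^sup>+u. ennreal (w n u) \<partial>leb_circ) = \<infinity>" .
  then have "ennreal (max R 0) < (SUP n. \<integral>\<^sup>+u. ennreal (w n u) \<partial>leb_circ)"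
    by (simp only: infinity_ennreal_def ennreal_less_top)
  then obtain n where n: "ennreal (max R 0) < (\<integral>\<^sup>+u. ennreal (w n u) \<partial>leb_circ)"
    unfolding less_SUP_iff by blast
  have iw: "integrable leb_circ (w n)"
    by (rule leb.integrable_const_bound[where B = "real n"]) (use w0 in auto)
  have "ennreal (max R 0) < ennreal (\<integral>u. w n u \<partial>leb_circ)"
    using n nn_integral_eq_integral[OF iw] w0 by simp
  then have "max R 0 < (\<integral>u. w n u \<partial>leb_circ)" by (subst (asm) ennreal_less_iff) auto
  then have R: "R < (\<integral>u. w n u \<partial>leb_circ)" by simp
  have "exp (2 * w n u) * f u \<le> 1 + f u" if u: "u \<in> {-pi..<pi}" for u
  proof (cases "u \<in> N \<or> 1 \<le> f u \<or> f u = 0")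
    case True then show ?thesis using f_nonneg[OF u] by (auto simp: w_def)
  next
    case False
    then have f: "0 < f u" "f u < 1" using f_nonneg[OF u] by auto
    have "2 * w n u \<le> - ln (f u)" using False f by (auto simp: w_def abs_if)
    then have "exp (2 * w n u) * f u \<le> exp (- ln (f u)) * f u" using f by (intro mult_right_mono) auto
    also have "\<dots> = 1" using f by (simp add: exp_minus)
    finally show ?thesis using f by simp
  qed
  then show ?thesis using w0 R by (intro exI[of _ "w n"] exI[of _ n]) (auto simp: w_def)
qed

text \<open>The function $1 - F = e^{P - P(0)}$ has square norm $e^{-2P(0)} \int e^{2\mathrm{Re}\,P} d\mu$. For
  $\mathrm{Re}\,P \approx w$ with \<open>w\<close> from the preceding lemma the integral is bounded independently of
  \<open>w\<close>, also over the set \<open>N\<close> on which \<open>w\<close> vanishes, while the first factor is as small as the mean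
  of \<open>w\<close> is large.\<close>

lemma Szego_degenerate:
  assumes inf: "(\<integral>\<^sup>+u. abs_ln (f u) \<partial>leb_circ) = \<infinity>"
  shows "(\<lambda>u. 1) \<in> closed_span \<mu> trig {..-1}"
proof (rule closed_span_closed[OF trig_L2_circle])
  show one: "(\<lambda>u. 1) \<in> L2 \<mu>" by (rule L2_bounded[where C = 1]) auto
  fix e :: real assume e: "e > 0"
  define Q where "Q = (\<integral>u. 1 + f u \<partial>leb_circ) + measure \<mu> N"
  have fi: "0 \<le> (\<integral>u. 1 + f u \<partial>leb_circ)" by (rule integral_nonneg_AE) (use AE_f_nonneg in auto)
  then have Q: "Q \<ge> 0" by (simp add: Q_def)
  define R where "R = 1 + pi * \<bar>ln (e / (Q + 2))\<bar>"
  obtain w n where w[measurable]: "w \<in> borel_measurable leb_circ"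
    and w0: "\<And>u. 0 \<le> w u \<and> w u \<le> real n" and wN: "\<And>u. u \<in> N \<Longrightarrow> w u = 0"
    and wf: "\<And>u. u \<in> {-pi..<pi} \<Longrightarrow> exp (2 * w u) * f u \<le> 1 + f u" and wR: "R < (\<integral>u. w u \<partial>leb_circ)"
    using large_log_weight[OF inf, of R] by blast
  have [measurable]: "w \<in> borel_measurable \<mu>" by (simp add: measurable_circle_iff)
  define K where "K = 2 * exp (2 * (real n + 1))"
  have K: "K > 0" by (simp add: K_def)
  obtain P where P: "P holomorphic_on UNIV" "Im (P 0) = 0"
    "\<And>u. 0 \<le> Re (P (cis (- u))) \<and> Re (P (cis (- u))) \<le> real n + 1"
    "(\<integral>u. \<bar>Re (P (cis (- u))) - w u\<bar> \<partial>\<mu>) < min 1 (1 / K)"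
    "(\<integral>u. \<bar>Re (P (cis (- u))) - w u\<bar> \<partial>leb_circ) < min 1 (1 / K)"
    using entire_L1_approx_both[of w "real n" "min 1 (1 / K)"] w0 K by auto
  define r where "r u = Re (P (cis (- u)))" for u
  have [measurable]: "r \<in> borel_measurable \<mu>" "r \<in> borel_measurable leb_circ"
    unfolding r_def using entire_measurable[OF P(1)] leb.entire_measurable[OF P(1)] by measurable
  have r: "0 \<le> r u" "r u \<le> real n + 1" for u using P(3)[of u] by (auto simp: r_def)
  have id: "integrable \<mu> (\<lambda>u. \<bar>r u - w u\<bar>)"
  proof (rule integrable_const_bound[where B = "real n + 1"])
    have "\<bar>r u - w u\<bar> \<le> real n + 1" for u using r[of u] w0[of u] by linarith
    then show "AE u in \<mu>. norm \<bar>r u - w u\<bar> \<le> real n + 1" by simp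
  qed measurable
  have ie: "integrable \<mu> (\<lambda>u. exp (2 * w u))"
    by (rule integrable_const_bound[where B = "exp (2 * real n)"]) (use w0 in auto)
  have ier: "integrable \<mu> (\<lambda>u. exp (2 * r u))"
    by (rule integrable_const_bound[where B = "exp (2 * (real n + 1))"]) (use r in \<open>auto simp del: distrib_left_numeral\<close>)
  have "(\<integral>u. exp (2 * w u) \<partial>\<mu>) = (\<integral>u. f u * exp (2 * w u) \<partial>leb_circ) + (\<integral>u. indicator N u * exp (2 * w u) \<partial>\<mu>)"
    by (rule integral_split(2)[OF ie])
  also have "(\<integral>u. f u * exp (2 * w u) \<partial>leb_circ) \<le> (\<integral>u. 1 + f u \<partial>leb_circ)"
    using integral_split(1)[OF ie] wf f_integrable by (intro integral_mono) (auto simp: mult.commute)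
  also have "(\<integral>u. indicator N u * exp (2 * w u) \<partial>\<mu>) = (\<integral>u. indicator N u \<partial>\<mu>)"
    by (rule Bochner_Integration.integral_cong) (auto simp: indicator_def wN)
  also have "(\<integral>u. indicator N u \<partial>\<mu>) = measure \<mu> N"
    using sets.Int_space_eq2[OF N_sets'(1)] by simp
  finally have ew: "(\<integral>u. exp (2 * w u) \<partial>\<mu>) \<le> Q" by (simp add: Q_def)
  have "(\<integral>u. exp (2 * r u) \<partial>\<mu>) \<le> (\<integral>u. exp (2 * w u) + K * \<bar>r u - w u\<bar> \<partial>\<mu>)"
  proof (rule integral_mono[OF ier])
    show "exp (2 * r u) \<le> exp (2 * w u) + K * \<bar>r u - w u\<bar>" for u
    proof -
      have "w u \<le> real n + 1" using w0[of u] by linarith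
      then have "\<bar>exp (2 * r u) - exp (2 * w u)\<bar> \<le> exp (2 * (real n + 1)) * \<bar>2 * r u - 2 * w u\<bar>"
        using r(2)[of u] by (intro exp_diff_le) auto
      also have "\<dots> = K * \<bar>r u - w u\<bar>"
        unfolding K_def right_diff_distrib[symmetric] abs_mult by simp
      finally show ?thesis by linarith
    qed
  qed (use ie id in auto)
  also have "\<dots> = (\<integral>u. exp (2 * w u) \<partial>\<mu>) + K * (\<integral>u. \<bar>r u - w u\<bar> \<partial>\<mu>)"
    using ie id by simp
  also have "\<dots> \<le> Q + K * (1 / K)"
    using ew P(4) K by (intro add_mono mult_left_mono) (auto simp: r_def)
  finally have er: "(\<integral>u. exp (2 * r u) \<partial>\<mu>) \<le> Q + 1" using K by simp
  have iw: "integrable leb_circ w" by (rule leb.integrable_const_bound[where B = "real n"]) (use w0 in auto)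
  have ir: "integrable leb_circ r" by (rule leb.integrable_const_bound[where B = "real n + 1"]) (use r in auto)
  have "(\<integral>u. w u \<partial>leb_circ) - (\<integral>u. r u \<partial>leb_circ) \<le> (\<integral>u. \<bar>r u - w u\<bar> \<partial>leb_circ)"
    unfolding Bochner_Integration.integral_diff[OF iw ir, symmetric]
    by (rule integral_mono) (use iw ir in auto)
  then have "R - 1 \<le> (\<integral>u. r u \<partial>leb_circ)" using wR P(5) by (simp add: r_def)
  also have "\<dots> = 2 * pi * Re (P 0)" unfolding r_def by (rule Re_entire_mean_value(1)[OF P(1)])
  finally have "pi * \<bar>ln (e / (Q + 2))\<bar> \<le> pi * (2 * Re (P 0))" by (simp add: R_def)
  then have "\<bar>ln (e / (Q + 2))\<bar> \<le> 2 * Re (P 0)" by (subst (asm) mult_le_cancel_left_pos) auto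
  then have "exp (- (2 * Re (P 0))) \<le> exp (ln (e / (Q + 2)))" by simp
  also have "\<dots> = e / (Q + 2)" using e Q by simp
  finally have e0: "exp (- (2 * Re (P 0))) \<le> e / (Q + 2)" .
  define F where "F z = 1 - exp (P z - P 0)" for z
  have F: "F holomorphic_on UNIV" "F 0 = 0" unfolding F_def using P(1) by (auto intro!: holomorphic_intros)
  have "sqnorm \<mu> (\<lambda>u. 1 - F (cis (- u))) = (\<integral>u. exp (- (2 * Re (P 0))) * exp (2 * r u) \<partial>\<mu>)"
    unfolding sqnorm_def F_def r_def
    by (rule Bochner_Integration.integral_cong)
      (auto simp: norm_exp_eq_Re power2_eq_square exp_add[symmetric] algebra_simps)
  also have "\<dots> \<le> e / (Q + 2) * (Q + 1)"
    unfolding integral_mult_right_zero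
    by (intro mult_mono e0 er) (use e Q in \<open>auto intro!: integral_nonneg_AE\<close>)
  also have "\<dots> < e" using e Q by (simp add: field_simps)
  finally have "sqnorm \<mu> (\<lambda>u. 1 - F (cis (- u))) < e" .
  then show "\<exists>g\<in>closed_span \<mu> trig {..-1}. sqnorm \<mu> (\<lambda>u. 1 - g u) < e"
    by (rule bexI[OF _ entire_in_past(2)[OF F]])
qed

text \<open>Weights $w = A\cdot 1_N$ vanish almost everywhere for Lebesgue measure, so the entire functions
  $e^{-P}$ with $\mathrm{Re}\,P \approx w$ have modulus at most one and mean close to one. They are
  therefore close to one off \<open>N\<close>, and close to zero on \<open>N\<close>.\<close>

lemma null_set_predictable: "indicator N \<in> closed_span \<mu> trig {..-1}"
proof (rule closed_span_closed[OF trig_L2_circle])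
  show ind: "(indicator N :: real \<Rightarrow> complex) \<in> L2 \<mu>"
    by (rule L2_bounded[where C = 1]) (auto simp: indicator_def)
  fix e :: real assume e: "e > 0"
  define m where "m = measure \<mu> (space \<mu>)"
  have m0: "m \<ge> 0" by (simp add: m_def)
  \<comment> \<open>truncation of \<open>f\<close> at the level \<open>l\<close>; below, $|F|^2 \le 9$ and $f \le 2 (f - l)^+$ where $f > 2l$\<close>
  obtain l :: nat where l: "(\<integral>u. max 0 (f u - real l) \<partial>leb_circ) < e / 72"
    using ex_integral_excess_less[OF f_integrable AE_f_nonneg, of "e / 72"] e by auto
  define A where "A = \<bar>ln (e / (16 * (m + 1)))\<bar>"
  have A0: "A \<ge> 0" by (simp add: A_def)
  have A: "4 * (exp (- A) * m) < e / 4"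
  proof -
    have "exp (- A) \<le> exp (ln (e / (16 * (m + 1))))" by (simp add: A_def)
    also have "\<dots> = e / (16 * (m + 1))" using e m0 by simp
    finally have "exp (- A) * m \<le> e / (16 * (m + 1)) * m" using m0 by (rule mult_right_mono)
    also have "\<dots> < e / 16" using e m0 by (simp add: field_simps)
    finally show ?thesis by simp
  qed
  define d where "d = min (1/2) (min (e / 16) (e / (64 * pi * (real l + 1))))"
  have d: "d > 0" "d \<le> 1/2" "4 * d \<le> e / 4" "2 * real l * (8 * pi * d) \<le> e / 4"
  proof -
    show d0: "d > 0" using e pi_gt_zero by (simp add: d_def)
    show "d \<le> 1/2" unfolding d_def by linarith
    show "4 * d \<le> e / 4" unfolding d_def by linarith
    have "2 * real l * (8 * pi * d) \<le> 2 * (real l + 1) * (8 * pi * (e / (64 * pi * (real l + 1))))"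
      using d0 by (intro mult_mono) (auto simp: d_def)
    also have "\<dots> = e / 4"
    proof -
      have "2 * L * (8 * pi * (e / (64 * pi * L))) = e / 4" if "L > 0" for L :: real
        using that by (simp add: field_simps)
      then show ?thesis by (metis of_nat_0_le_iff add_nonneg_pos zero_less_one)
    qed
    finally show "2 * real l * (8 * pi * d) \<le> e / 4" .
  qed
  obtain P where P: "P holomorphic_on UNIV" "Im (P 0) = 0"
    "\<And>u. 0 \<le> Re (P (cis (- u))) \<and> Re (P (cis (- u))) \<le> A + 1"
    "(\<integral>u. \<bar>Re (P (cis (- u))) - A * indicator N u\<bar> \<partial>\<mu>) < d"
    "(\<integral>u. \<bar>Re (P (cis (- u))) - A * indicator N u\<bar> \<partial>leb_circ) < d"
  proof -
    have w: "(\<lambda>u. A * indicator N u) \<in> borel_measurable \<mu>" by measurable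
    have "0 \<le> A * indicator N u \<and> A * indicator N u \<le> A" for u using A0 by (simp add: indicator_def)
    from entire_L1_approx_both[OF w this A0 d(1)] that show thesis by blast
  qed
  define r where "r u = Re (P (cis (- u)))" for u
  have [measurable]: "r \<in> borel_measurable \<mu>" "r \<in> borel_measurable leb_circ"
    unfolding r_def using entire_measurable[OF P(1)] leb.entire_measurable[OF P(1)] by measurable
  have r: "0 \<le> r u" "r u \<le> A + 1" for u using P(3)[of u] by (auto simp: r_def)
  define c where "c = Re (P 0)"
  have P0: "P 0 = complex_of_real c" using P(2) by (simp add: c_def complex_eq_iff)
  have ir: "integrable leb_circ r" by (rule leb.integrable_const_bound[where B = "A + 1"]) (use r in auto)
  have rc: "(\<integral>u. r u \<partial>leb_circ) = 2 * pi * c"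
    unfolding r_def c_def by (rule Re_entire_mean_value(1)[OF P(1)])
  have "(\<integral>u. r u \<partial>leb_circ) = (\<integral>u. \<bar>r u - A * indicator N u\<bar> \<partial>leb_circ)"
  proof (rule integral_cong_AE)
    show "AE u in leb_circ. r u = \<bar>r u - A * indicator N u\<bar>"
      using AE_not_N by eventually_elim (simp add: r)
  qed auto
  then have rd: "2 * pi * c < d" using P(5) rc by (simp add: r_def)
  have c0: "c \<ge> 0" using rc integral_nonneg_AE[of r leb_circ] r pi_gt_zero by (auto simp: zero_le_mult_iff)
  have cd: "c \<le> d"
  proof -
    have "1 * c \<le> (2 * pi) * c" using c0 pi_gt3 by (intro mult_right_mono) auto
    then show ?thesis using rd by simp
  qed
  have ec: "exp (2 * c) \<le> 1 + 4 * d" "exp c \<le> 2"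
  proof -
    have "exp (2 * c) \<le> exp (2 * d)" using cd by simp
    also have "\<dots> \<le> 1 + 2 * d + (2 * d)\<^sup>2" using d by (intro exp_bound) auto
    also have "(2 * d)\<^sup>2 \<le> 2 * d" using d mult_right_mono[of "2 * d" 1 "2 * d"] by (simp add: power2_eq_square)
    finally show "exp (2 * c) \<le> 1 + 4 * d" by simp
    then have "(exp c)\<^sup>2 \<le> 2\<^sup>2" using d by (simp add: exp_double[symmetric])
    then show "exp c \<le> 2" by (rule power2_le_imp_le) simp
  qed
  define E where "E z = exp (P 0 - P z)" for z
  have E: "E holomorphic_on UNIV" "E 0 = 1" unfolding E_def using P(1) by (auto intro!: holomorphic_intros)
  define F where "F z = 1 - E z" for z
  have F: "F holomorphic_on UNIV" "F 0 = 0" unfolding F_def using E by (auto intro!: holomorphic_intros)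
  have Em: "cmod (E (cis (- u))) = exp c * exp (- r u)" for u
    unfolding E_def norm_exp_eq_Re r_def exp_add[symmetric] by (simp add: P0)
  have E2: "cmod (E (cis (- u))) \<le> exp c" for u unfolding Em using r(1)[of u] by simp
  have EL: "(\<lambda>u. E (cis (- u))) \<in> L2 \<mu>" "(\<lambda>u. E (cis (- u))) \<in> L2 leb_circ"
    by (rule entire_L2[OF E(1)], rule leb.entire_L2[OF E(1)])
  have FL: "(\<lambda>u. F (cis (- u))) \<in> L2 \<mu>" "(\<lambda>u. F (cis (- u))) \<in> L2 leb_circ"
    by (rule entire_L2[OF F(1)], rule leb.entire_L2[OF F(1)])
  define g where "g u = (cmod (indicator N u - F (cis (- u))))\<^sup>2" for u
  have ig: "integrable \<mu> g" unfolding g_def by (rule L2_integrable[OF L2_diff[OF ind FL(1)]])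
  have irA: "integrable \<mu> (\<lambda>u. \<bar>r u - A * indicator N u\<bar>)"
    by (intro integrable_abs
        Bochner_Integration.integrable_diff integrable_const_bound[where f = r and B = "A + 1"]
        integrable_const_bound[where f = "\<lambda>u. A * indicator N u" and B = A])
      (use r A0 in \<open>auto simp: indicator_def\<close>)
  \<comment> \<open>on \<open>N\<close> the integrand is $|E|^2 \le 4 e^{-\mathrm{Re}\,P}$ with $\mathrm{Re}\,P \approx A$\<close>
  have "(\<integral>u. indicator N u * g u \<partial>\<mu>) \<le> (\<integral>u. 4 * (exp (- A) + \<bar>r u - A * indicator N u\<bar>) \<partial>\<mu>)"
  proof (rule integral_mono)
    show "integrable \<mu> (\<lambda>u. indicator N u * g u)"
      by (rule Bochner_Integration.integrable_bound[OF ig]) (use ig in \<open>auto simp: indicator_def\<close>)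
    show "integrable \<mu> (\<lambda>u. 4 * (exp (- A) + \<bar>r u - A * indicator N u\<bar>))"
      by (intro integrable_mult_right Bochner_Integration.integrable_add integrable_const irA)
    fix u
    show "indicator N u * g u \<le> 4 * (exp (- A) + \<bar>r u - A * indicator N u\<bar>)"
    proof (cases "u \<in> N")
      case True
      have x: "exp (- r u) \<le> 1" "0 \<le> exp (- r u)" using r(1)[of u] by auto
      have "(exp c)\<^sup>2 \<le> 2\<^sup>2" using ec(2) by (intro power_mono) auto
      then have "g u \<le> 4 * (exp (- r u))\<^sup>2"
        using True by (simp add: g_def F_def Em power_mult_distrib)
      also have "(exp (- r u))\<^sup>2 \<le> exp (- r u)" using x mult_right_mono[OF x] by (simp add: power2_eq_square)
      also have "exp (- r u) \<le> exp (- A) + \<bar>r u - A\<bar>"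
        using exp_diff_le[of "- r u" 0 "- A"] r(1)[of u] A0 by simp
      finally show ?thesis using True by simp
    qed simp
  qed
  also have "\<dots> = 4 * (exp (- A) * m + (\<integral>u. \<bar>r u - A * indicator N u\<bar> \<partial>\<mu>))"
    using irA by (simp add: m_def mult.commute)
  also have "\<dots> < 4 * (exp (- A) * m) + e / 4" using P(4) d(3) unfolding r_def by simp
  finally have onN: "(\<integral>u. indicator N u * g u \<partial>\<mu>) < e / 2" using A by simp
  \<comment> \<open>off \<open>N\<close>, use $|F|^2 \le 9$ where $f > 2l$, and smallness of \<open>F\<close> in \<open>L2 leb_circ\<close> elsewhere\<close>
  have F3: "(cmod (F (cis (- u))))\<^sup>2 \<le> 9" for u
  proof -
    have "cmod (F (cis (- u))) \<le> 1 + cmod (E (cis (- u)))"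
      unfolding F_def using norm_triangle_ineq4[of 1 "E (cis (- u))"] by simp
    also have "\<dots> \<le> 3" using E2[of u] ec(2) by linarith
    finally have "(cmod (F (cis (- u))))\<^sup>2 \<le> 3\<^sup>2" by (intro power_mono) auto
    then show ?thesis by simp
  qed
  have sF: "sqnorm leb_circ (\<lambda>u. F (cis (- u))) \<le> 8 * pi * d"
  proof -
    have iE: "integrable leb_circ (\<lambda>u. E (cis (- u)))" by (rule Re_entire_mean_value(2)[OF E(1)])
    have "(cmod (F (cis (- u))))\<^sup>2 = 1 - 2 * Re (E (cis (- u))) + (cmod (E (cis (- u))))\<^sup>2" for u
      unfolding F_def cmod_power2 by (simp add: power2_eq_square algebra_simps)
    also have "\<dots> u \<le> 1 - 2 * Re (E (cis (- u))) + exp (2 * c)" for u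
      using power_mono[OF E2[of u], of 2] by (simp add: exp_double)
    finally have "sqnorm leb_circ (\<lambda>u. F (cis (- u))) \<le> (\<integral>u. 1 - 2 * Re (E (cis (- u))) + exp (2 * c) \<partial>leb_circ)"
      unfolding sqnorm_def using iE L2_integrable[OF FL(2)]
      by (intro integral_mono) (auto intro!: integrable_Re)
    also have "\<dots> = (1 + exp (2 * c)) * (2 * pi) - 2 * (\<integral>u. Re (E (cis (- u))) \<partial>leb_circ)"
      using integrable_Re[OF iE] by (simp add: measure_leb_circ algebra_simps)
    also have "\<dots> = (exp (2 * c) - 1) * (2 * pi)"
      unfolding Re_entire_mean_value(1)[OF E(1)] E(2) by (simp add: algebra_simps)
    also have "\<dots> \<le> (4 * d) * (2 * pi)" using ec(1) by (intro mult_right_mono) auto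
    finally show ?thesis by (simp add: mult_ac)
  qed
  have im: "integrable leb_circ (\<lambda>u. max 0 (f u - real l))"
    using f_integrable by (intro integrable_max) auto
  have "(\<integral>u. f u * g u \<partial>leb_circ) \<le>
     (\<integral>u. 18 * max 0 (f u - real l) + 2 * real l * (cmod (F (cis (- u))))\<^sup>2 \<partial>leb_circ)"
  proof (rule integral_mono_AE)
    show "integrable leb_circ (\<lambda>u. 18 * max 0 (f u - real l) + 2 * real l * (cmod (F (cis (- u))))\<^sup>2)"
      by (intro Bochner_Integration.integrable_add integrable_mult_right im L2_integrable[OF FL(2)])
    show "integrable leb_circ (\<lambda>u. f u * g u)" by (rule integral_split(1)[OF ig])
    show "AE u in leb_circ. f u * g u \<le> 18 * max 0 (f u - real l) + 2 * real l * (cmod (F (cis (- u))))\<^sup>2"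
      using AE_f_nonneg AE_not_N
    proof eventually_elim
      case (elim u)
      then have g: "g u = (cmod (F (cis (- u))))\<^sup>2" by (simp add: g_def)
      show ?case
      proof (cases "2 * real l < f u")
        case True
        have "f u * g u \<le> (2 * (f u - real l)) * 9" unfolding g using True F3 elim by (intro mult_mono) auto
        also have "\<dots> = 18 * max 0 (f u - real l)" using True by simp
        finally show ?thesis by (simp add: add_increasing2)
      next
        case False
        then have "f u * g u \<le> 2 * real l * (cmod (F (cis (- u))))\<^sup>2" unfolding g by (intro mult_right_mono) auto
        then show ?thesis by (simp add: add_increasing)
      qed
    qed
  qed
  also have "\<dots> = 18 * (\<integral>u. max 0 (f u - real l) \<partial>leb_circ) + 2 * real l * sqnorm leb_circ (\<lambda>u. F (cis (- u)))"
    using im L2_integrable[OF FL(2)] by (simp add: sqnorm_def)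
  also have "\<dots> < e / 4 + e / 4"
  proof (rule add_less_le_mono)
    show "2 * real l * sqnorm leb_circ (\<lambda>u. F (cis (- u))) \<le> e / 4"
      by (rule order_trans[OF mult_left_mono[OF sF] d(4)]) simp
  qed (use l in simp)
  finally have "sqnorm \<mu> (\<lambda>u. indicator N u - F (cis (- u))) < e"
    using onN integral_split(2)[OF ig] unfolding sqnorm_def g_def by simp
  then show "\<exists>h\<in>closed_span \<mu> trig {..-1}. sqnorm \<mu> (\<lambda>u. indicator N u - h u) < e"
    by (rule bexI[OF _ entire_in_past(2)[OF F]])
qed

lemma ex_small_sqrt:
  fixes a :: real assumes "0 \<le> a" "e > 0" shows "\<exists>d>0. a * sqrt d < e"
proof (intro exI[of _ "(e / (a + 1))\<^sup>2"] conjI)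
  show "0 < (e / (a + 1))\<^sup>2" using assms by simp
  have "a * sqrt ((e / (a + 1))\<^sup>2) = a * (e / (a + 1))" using assms by simp
  also have "\<dots> < e" using assms by (simp add: field_simps)
  finally show "a * sqrt ((e / (a + 1))\<^sup>2) < e" .
qed

text \<open>Here $g = e^{-P}$ is a substitute for a bounded outer function. Let $v = \frac12 \ln^- f$ and
  $\mathrm{Re}\,P \approx (v-j)^+$. Then $|g| \lesssim e^j \sqrt f$, which makes $\int (\psi-q) g$ small
  when \<open>q\<close> is a polynomial close to \<open>\<psi>\<close> in \<open>L2 \<mu>\<close>. The integral of \<open>q g\<close> is zero by the mean value
  property. For large \<open>j\<close> the mean of \<open>g\<close> is close to one; as $|g| \le 1$, this forces \<open>g\<close> to be
  close to one in the mean square, so that $\int \psi g$ is close to $\int \psi$.\<close>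

lemma bounded_predictable_mean_zero:
  assumes fin: "(\<integral>\<^sup>+u. abs_ln (f u) \<partial>leb_circ) < \<infinity>"
    and psi: "\<psi> \<in> closed_span \<mu> trig {..-1}" and C: "\<And>u. cmod (\<psi> u) \<le> C"
  shows "(\<integral>u. \<psi> u \<partial>leb_circ) = 0"
proof -
  have psim[measurable]: "\<psi> \<in> borel_measurable \<mu>" using closed_spanD[OF psi] by auto
  then have psil[measurable]: "\<psi> \<in> borel_measurable leb_circ" by (simp add: measurable_circle_iff)
  have C0: "C \<ge> 0" using C[of 0] norm_ge_zero[of "\<psi> 0"] by linarith
  define v where "v u = (if 0 < f u \<and> f u < 1 then - ln (f u) / 2 else 0)" for u
  have [measurable]: "v \<in> borel_measurable leb_circ" unfolding v_def by measurable
  have v0: "0 \<le> v u" for u by (auto simp: v_def)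
  have vi: "integrable leb_circ v"
    unfolding integrable_iff_bounded
  proof
    have "(\<integral>\<^sup>+u. ennreal (norm (v u)) \<partial>leb_circ) \<le> (\<integral>\<^sup>+u. abs_ln (f u) \<partial>leb_circ)"
      by (rule nn_integral_mono) (auto simp: v_def abs_ln_def intro!: ennreal_leI)
    then show "(\<integral>\<^sup>+u. ennreal (norm (v u)) \<partial>leb_circ) < \<infinity>" using fin by (rule le_less_trans)
  qed measurable
  have "AE u in leb_circ. abs_ln (f u) \<noteq> \<infinity>"
    by (rule nn_integral_PInf_AE) (use fin in \<open>auto simp: abs_ln_def\<close>)
  then have AE_pos: "AE u in leb_circ. 0 < f u"
    using AE_f_nonneg by eventually_elim (auto simp: abs_ln_def split: if_splits)
  have expv: "AE u in leb_circ. exp (- v u) \<le> sqrt (f u)"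
    using AE_pos
  proof eventually_elim
    case (elim u)
    show ?case
    proof (cases "f u < 1")
      case True
      have "(exp (- v u))\<^sup>2 = f u"
        using True elim by (simp add: v_def exp_double[symmetric])
      then show ?thesis by (metis exp_ge_zero order_refl real_sqrt_unique)
    next
      case False then show ?thesis by (simp add: v_def)
    qed
  qed
  have main: "cmod (\<integral>u. \<psi> u \<partial>leb_circ) < e" if e: "e > 0" for e
  proof -
    obtain d where d: "d > 0" "(C * sqrt (2 * pi) * 2) * sqrt d < e / 3"
      using ex_small_sqrt[of "C * sqrt (2 * pi) * 2" "e / 3"] C0 e by auto
    obtain j :: nat where j: "(\<integral>u. max 0 (v u - real j) \<partial>leb_circ) < d"
      using ex_integral_excess_less[OF vi _ d(1)] v0 by auto
    define vj where "vj u = max 0 (v u - real j)" for u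
    have vj0: "0 \<le> vj u" for u by (simp add: vj_def)
    have [measurable]: "vj \<in> borel_measurable leb_circ" unfolding vj_def by measurable
    have vji: "integrable leb_circ vj"
      by (rule Bochner_Integration.integrable_bound[OF vi]) (use v0 in \<open>auto simp: vj_def\<close>)
    obtain h where h: "h > 0" "(exp (real j) * sqrt (2 * pi)) * sqrt h < e / 3"
      using ex_small_sqrt[of "exp (real j) * sqrt (2 * pi)" "e / 3"] e by auto
    from psi h(1) obtain S c where S: "finite S" "S \<subseteq> {..-1}"
      "sqnorm \<mu> (\<lambda>u. \<psi> u - (\<Sum>s\<in>S. c s * trig s u)) < h"
      unfolding closed_span_def by auto
    define q where "q u = (\<Sum>s\<in>S. c s * trig s u)" for u
    have qL: "q \<in> L2 \<mu>" unfolding q_def by (intro L2_sum L2_scale trig_L2_circle)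
    have [measurable]: "q \<in> borel_measurable leb_circ"
      unfolding q_def by (intro borel_measurable_sum borel_measurable_times borel_measurable_const leb.trig_measurable)
    define D where "D = C + (\<Sum>s\<in>S. cmod (c s))"
    have D0: "D \<ge> 0" using C0 by (simp add: D_def sum_nonneg)
    have D: "cmod (\<psi> u - q u) \<le> D" for u
    proof -
      have "cmod (q u) \<le> (\<Sum>s\<in>S. cmod (c s))"
        unfolding q_def by (rule order_trans[OF norm_sum]) (simp add: norm_mult)
      then show ?thesis using norm_triangle_ineq4[of "\<psi> u" "q u"] C[of u] unfolding D_def by linarith
    qed
    define k where "k = min d (e / (3 * (D + 1)))"
    have k: "k > 0" "k \<le> d" "D * k \<le> e / 3"
    proof -
      show k0: "k > 0" using d e D0 by (simp add: k_def)
      show "k \<le> d" unfolding k_def by linarith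
      have "D * k \<le> (D + 1) * (e / (3 * (D + 1)))" using D0 k0 by (intro mult_mono) (auto simp: k_def)
      also have "\<dots> = e / 3" using D0 by (simp add: field_simps)
      finally show "D * k \<le> e / 3" .
    qed
    obtain P where P: "P holomorphic_on UNIV" "Im (P 0) = 0" "\<And>u. 0 \<le> Re (P (cis (- u)))"
      "(\<integral>u. \<bar>Re (P (cis (- u))) - vj u\<bar> \<partial>leb_circ) < k"
      using leb.entire_L1_approx[OF vji vj0 k(1)] by blast
    define r where "r u = Re (P (cis (- u)))" for u
    have r0: "0 \<le> r u" for u using P(3) by (simp add: r_def)
    have ir: "integrable leb_circ r" unfolding r_def by (rule integrable_Re[OF Re_entire_mean_value(2)[OF P(1)]])
    have ird: "integrable leb_circ (\<lambda>u. \<bar>r u - vj u\<bar>)" using ir vji by auto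
    define p where "p = Re (P 0)"
    have P0: "P 0 = complex_of_real p" using P(2) by (simp add: p_def complex_eq_iff)
    have rp: "(\<integral>u. r u \<partial>leb_circ) = 2 * pi * p"
      unfolding r_def p_def by (rule Re_entire_mean_value(1)[OF P(1)])
    have "(\<integral>u. r u \<partial>leb_circ) \<le> (\<integral>u. vj u + \<bar>r u - vj u\<bar> \<partial>leb_circ)"
      by (rule integral_mono) (use ir ird vji in auto)
    also have "\<dots> = (\<integral>u. vj u \<partial>leb_circ) + (\<integral>u. \<bar>r u - vj u\<bar> \<partial>leb_circ)"
      using vji ird by simp
    also have "\<dots> \<le> 2 * d" using j P(4) k(2) unfolding vj_def[symmetric] r_def by linarith
    finally have pd: "2 * pi * p \<le> 2 * d" by (simp add: rp)
    define g where "g u = exp (- P (cis (- u)))" for u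
    have hol: "(\<lambda>z. exp (- P z)) holomorphic_on UNIV" using P(1) by (intro holomorphic_intros)
    have gL: "g \<in> L2 leb_circ" unfolding g_def by (rule leb.entire_L2[OF hol])
    have [measurable]: "g \<in> borel_measurable leb_circ" using gL by auto
    have gm: "cmod (g u) = exp (- r u)" for u by (simp add: g_def r_def norm_exp_eq_Re)
    have g1: "cmod (g u) \<le> 1" for u unfolding gm using r0[of u] by simp
    have ig: "integrable leb_circ g" unfolding g_def by (rule Re_entire_mean_value(2)[OF hol])
    have one: "(\<lambda>u. 1) \<in> L2 leb_circ" by (rule leb.L2_bounded[where C = 1]) auto
    \<comment> \<open>since $|g| \le 1$, closeness to one is controlled by the mean of \<open>g\<close>, which is $e^{-P(0)}$\<close>
    have s1: "sqnorm leb_circ (\<lambda>u. 1 - g u) \<le> 4 * d"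
    proof -
      have "(cmod (1 - g u))\<^sup>2 = 1 - 2 * Re (g u) + (cmod (g u))\<^sup>2" for u
        unfolding cmod_power2 by (simp add: power2_eq_square algebra_simps)
      also have "\<dots> u \<le> 2 - 2 * Re (g u)" for u
        using power_mono[OF g1[of u], of 2] by simp
      finally have "sqnorm leb_circ (\<lambda>u. 1 - g u) \<le> (\<integral>u. 2 - 2 * Re (g u) \<partial>leb_circ)"
        unfolding sqnorm_def using ig L2_integrable[OF L2_diff[OF one gL]]
        by (intro integral_mono) (auto intro!: integrable_Re)
      also have "\<dots> = 4 * pi - 2 * (\<integral>u. Re (g u) \<partial>leb_circ)"
        using integrable_Re[OF ig] by (simp add: measure_leb_circ)
      also have "(\<integral>u. Re (g u) \<partial>leb_circ) = 2 * pi * exp (- p)"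
        unfolding g_def Re_entire_mean_value(1)[OF hol]
        by (simp only: P0 of_real_minus[symmetric] exp_of_real Re_complex_of_real)
      also have "4 * pi - 2 * (2 * pi * exp (- p)) \<le> 4 * pi * p"
      proof -
        have "4 * pi * (1 - p) \<le> 4 * pi * exp (- p)"
          using exp_ge_add_one_self[of "- p"] by (intro mult_left_mono) auto
        then show ?thesis by (simp add: algebra_simps)
      qed
      also have "\<dots> \<le> 4 * d" using pd by simp
      finally show ?thesis .
    qed
    have psiL: "\<psi> \<in> L2 leb_circ" by (rule leb.L2_bounded[OF psil C])
    have "(\<integral>u. \<psi> u * (1 - g u) \<partial>leb_circ) = (\<integral>u. \<psi> u \<partial>leb_circ) - (\<integral>u. \<psi> u * g u \<partial>leb_circ)"
      unfolding right_diff_distrib mult_1_right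
      using L2_mult_integrable[OF psiL one] L2_mult_integrable[OF psiL gL]
      by (intro Bochner_Integration.integral_diff) auto
    moreover have "cmod (\<integral>u. \<psi> u * (1 - g u) \<partial>leb_circ) < e / 3"
    proof -
      have "cmod (\<integral>u. \<psi> u * (1 - g u) \<partial>leb_circ) \<le> (\<integral>u. cmod (\<psi> u) * cmod (1 - g u) \<partial>leb_circ)"
        using integral_norm_bound[of leb_circ "\<lambda>u. \<psi> u * (1 - g u)"] by (simp add: norm_mult)
      also have "\<dots> \<le> sqrt (sqnorm leb_circ \<psi>) * sqrt (sqnorm leb_circ (\<lambda>u. 1 - g u))"
        by (rule Cauchy_Schwarz_L2[OF psiL L2_diff[OF one gL]])
      also have "\<dots> \<le> sqrt (C\<^sup>2 * (2 * pi)) * sqrt (4 * d)"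
        using leb.sqnorm_le_uniform[OF psiL C] s1
        by (intro mult_mono real_sqrt_le_mono) (auto simp: measure_leb_circ d(1) less_imp_le)
      also have "\<dots> = (C * sqrt (2 * pi) * 2) * sqrt d"
        using C0 by (simp add: real_sqrt_mult)
      finally show ?thesis using d(2) by simp
    qed
    moreover have "cmod (\<integral>u. \<psi> u * g u \<partial>leb_circ) < 2 * e / 3"
    proof -
      have iqg: "integrable leb_circ (\<lambda>u. c s * (trig s u * g u))" for s
        by (intro integrable_mult_right L2_mult_integrable leb.trig_L2_circle gL)
      have "(\<integral>u. trig s u * g u \<partial>leb_circ) = 0" if "s \<in> S" for s
      proof -
        have s: "nat (- s) > 0" "trig s u = cis (- u) ^ nat (- s)" for u
          using that S(2) by (auto simp: trig_power)
        have "(\<lambda>z. z ^ nat (- s) * exp (- P z)) holomorphic_on UNIV"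
          using P(1) by (intro holomorphic_intros)
        from entire_mean_value[OF this] show ?thesis using s(1) by (simp add: s(2) g_def)
      qed
      then have "(\<integral>u. q u * g u \<partial>leb_circ) = 0"
        unfolding q_def sum_distrib_right mult.assoc
        by (subst Bochner_Integration.integral_sum[OF iqg]) auto
      moreover have qLl: "q \<in> L2 leb_circ" unfolding q_def by (intro L2_sum L2_scale leb.trig_L2_circle)
      ultimately have "(\<integral>u. \<psi> u * g u \<partial>leb_circ) = (\<integral>u. (\<psi> u - q u) * g u \<partial>leb_circ)"
        unfolding left_diff_distrib
        using L2_mult_integrable[OF psiL gL] L2_mult_integrable[OF qLl gL] by simp
      then have eq: "(\<integral>u. \<psi> u * g u \<partial>leb_circ) = (\<integral>u. (\<psi> u - q u) * g u \<partial>leb_circ)" .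
      \<comment> \<open>\<open>y\<close> carries the distance in \<open>L2 \<mu>\<close> over to Lebesgue measure\<close>
      define y where "y u = (\<psi> u - q u) * complex_of_real (sqrt (f u))" for u
      have isq: "integrable \<mu> (\<lambda>u. (cmod (\<psi> u - q u))\<^sup>2)"
        by (rule L2_integrable[OF L2_diff[OF closed_spanD[OF psi] qL]])
      have ysq: "AE u in leb_circ. (cmod (y u))\<^sup>2 = f u * (cmod (\<psi> u - q u))\<^sup>2"
        using AE_f_nonneg by eventually_elim (simp add: y_def norm_mult power_mult_distrib mult.commute)
      have [measurable]: "y \<in> borel_measurable leb_circ" unfolding y_def by measurable
      have yL: "y \<in> L2 leb_circ"
      proof (rule L2I)
        show "integrable leb_circ (\<lambda>u. (cmod (y u))\<^sup>2)"
          by (rule integrable_cong_AE_imp[OF integral_split(1)[OF isq]]) (use ysq in auto)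
      qed measurable
      have "sqnorm leb_circ y = (\<integral>u. f u * (cmod (\<psi> u - q u))\<^sup>2 \<partial>leb_circ)"
        unfolding sqnorm_def by (rule integral_cong_AE) (use ysq in auto)
      also have "\<dots> \<le> (\<integral>u. (cmod (\<psi> u - q u))\<^sup>2 \<partial>\<mu>)"
        unfolding integral_split(2)[OF isq] by (simp add: integral_nonneg_AE)
      also have "\<dots> < h" using S(3) unfolding sqnorm_def q_def .
      finally have yh: "sqnorm leb_circ y < h" .
      have iy: "integrable leb_circ (\<lambda>u. cmod (y u))"
        using integrable_norm[OF L2_mult_integrable[OF yL one]] by simp
      have "(\<integral>u. cmod (y u) * cmod 1 \<partial>leb_circ) \<le> sqrt (sqnorm leb_circ y) * sqrt (sqnorm leb_circ (\<lambda>u. 1))"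
        by (rule Cauchy_Schwarz_L2[OF yL one])
      also have "sqnorm leb_circ (\<lambda>u. 1) = 2 * pi" by (simp add: sqnorm_def measure_leb_circ)
      also have "sqrt (sqnorm leb_circ y) * sqrt (2 * pi) \<le> sqrt h * sqrt (2 * pi)"
        using yh by (intro mult_right_mono) auto
      finally have y1: "exp (real j) * (\<integral>u. cmod (y u) \<partial>leb_circ) \<le> exp (real j) * (sqrt h * sqrt (2 * pi))"
        by simp
      have "cmod (\<integral>u. (\<psi> u - q u) * g u \<partial>leb_circ) \<le> (\<integral>u. cmod (\<psi> u - q u) * exp (- r u) \<partial>leb_circ)"
        using integral_norm_bound[of leb_circ "\<lambda>u. (\<psi> u - q u) * g u"] by (simp add: norm_mult gm)
      also have "\<dots> \<le> (\<integral>u. exp (real j) * cmod (y u) + D * \<bar>r u - vj u\<bar> \<partial>leb_circ)"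
      proof (rule integral_mono_AE)
        show "integrable leb_circ (\<lambda>u. cmod (\<psi> u - q u) * exp (- r u))"
          using integrable_norm[OF L2_mult_integrable[OF L2_diff[OF psiL qLl] gL]] by (simp add: norm_mult gm)
        show "integrable leb_circ (\<lambda>u. exp (real j) * cmod (y u) + D * \<bar>r u - vj u\<bar>)"
          using iy ird by auto
        show "AE u in leb_circ. cmod (\<psi> u - q u) * exp (- r u) \<le> exp (real j) * cmod (y u) + D * \<bar>r u - vj u\<bar>"
          using expv AE_pos
        proof eventually_elim
          case (elim u)
          have "exp (- r u) \<le> exp (- vj u) + \<bar>r u - vj u\<bar>"
            using exp_diff_le[of "- r u" 0 "- vj u"] r0[of u] vj0[of u] by simp
          also have "exp (- vj u) \<le> exp (real j + - v u)" by (simp add: vj_def)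
          also have "\<dots> \<le> exp (real j) * sqrt (f u)" unfolding exp_add using elim(1) by (intro mult_left_mono) auto
          finally have "cmod (\<psi> u - q u) * exp (- r u) \<le>
              cmod (\<psi> u - q u) * (exp (real j) * sqrt (f u) + \<bar>r u - vj u\<bar>)"
            by (intro mult_left_mono) auto
          also have "\<dots> = exp (real j) * cmod (y u) + cmod (\<psi> u - q u) * \<bar>r u - vj u\<bar>"
            using elim(2) by (simp only: y_def norm_mult norm_of_real) (simp add: algebra_simps)
          also have "\<dots> \<le> exp (real j) * cmod (y u) + D * \<bar>r u - vj u\<bar>"
            using D[of u] by (intro add_left_mono mult_right_mono) auto
          finally show ?case .
        qed
      qed
      also have "\<dots> = exp (real j) * (\<integral>u. cmod (y u) \<partial>leb_circ) + D * (\<integral>u. \<bar>r u - vj u\<bar> \<partial>leb_circ)"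
        using iy ird by simp
      also have "\<dots> \<le> exp (real j) * (sqrt h * sqrt (2 * pi)) + D * k"
        using y1 P(4) D0 by (intro add_mono mult_left_mono) (auto simp: r_def)
      also have "\<dots> < 2 * e / 3" using h(2) k(3) by (simp add: mult_ac)
      finally show ?thesis unfolding eq .
    qed
    ultimately show ?thesis
      using norm_triangle_ineq[of "\<integral>u. \<psi> u * (1 - g u) \<partial>leb_circ" "\<integral>u. \<psi> u * g u \<partial>leb_circ"] by simp
  qed
  show ?thesis
  proof (rule ccontr)
    assume "(\<integral>u. \<psi> u \<partial>leb_circ) \<noteq> 0"
    then show False using main[of "cmod (\<integral>u. \<psi> u \<partial>leb_circ)"] by simp
  qed
qed

end

section \<open>When a bounded real function is predictable\<close>

lemma density_Diff_null:
  assumes "f \<in> borel_measurable M" "A \<in> sets M" "N \<in> sets M" "emeasure M N = 0"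
  shows "emeasure (density M (\<lambda>u. ennreal (f u))) (A - N) = emeasure (density M (\<lambda>u. ennreal (f u))) A"
proof -
  have [measurable]: "f \<in> borel_measurable M" "A \<in> sets M" "N \<in> sets M" by fact+
  have "AE u in M. u \<notin> N" using assms by (intro AE_not_in) auto
  then have "AE u in M. ennreal (f u) * indicator (A - N) u = ennreal (f u) * indicator A u"
    by eventually_elim (auto simp: indicator_def)
  then show ?thesis by (simp add: emeasure_density nn_integral_cong_AE)
qed

context lebesgue_decomposition
begin

text \<open>This absorbs the exceptional set of an almost everywhere identity into the null set that carries
  the singular component.\<close>

lemma enlarge_null_set:
  assumes N': "N' \<in> sets leb_circ" "emeasure leb_circ N' = 0"
  shows "lebesgue_decomposition \<mu> f (N \<union> N')"
proof unfold_locales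
  show "N \<union> N' \<in> sets leb_circ" using N' by simp
  show "emeasure leb_circ (N \<union> N') = 0"
    using emeasure_subadditive[OF N_sets N'(1)] N_null N'(2) by simp
  fix A assume A[measurable]: "A \<in> sets leb_circ"
  have [measurable]: "N' \<in> sets leb_circ" by fact
  have "A - (N \<union> N') = (A - N') - N" by auto
  then have "emeasure \<mu> (A - (N \<union> N')) = emeasure (density leb_circ (\<lambda>u. ennreal (f u))) (A - N')"
    using ac[of "A - N'"] A N' by (metis sets.Diff)
  also have "\<dots> = emeasure (density leb_circ (\<lambda>u. ennreal (f u))) A"
    using N' by (intro density_Diff_null) auto
  finally show "emeasure \<mu> (A - (N \<union> N')) = emeasure (density leb_circ (\<lambda>u. ennreal (f u))) A" .
qed (use f_nonneg in auto)

text \<open>The difference between \<open>\<phi>\<close> and the polynomial is supported on a Lebesgue null set and therefore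
  lies in the remote past.\<close>

lemma trig_polynomial_predictable:
  assumes p: "\<phi> \<in> borel_measurable leb_circ" "\<And>u. cmod (\<phi> u) \<le> C"
    and eq: "AE u in leb_circ. \<phi> u = (\<Sum>j \<in> {j. \<bar>j\<bar> \<le> t}. b j * trig j u)"
  shows "\<phi> \<in> closed_span \<mu> trig {..t}"
proof -
  define q where "q u = (\<Sum>j \<in> {j. \<bar>j\<bar> \<le> t}. b j * trig j u)" for u
  have [measurable]: "\<phi> \<in> borel_measurable leb_circ" by fact
  have [measurable]: "q \<in> borel_measurable leb_circ"
    unfolding q_def by (intro borel_measurable_sum borel_measurable_times borel_measurable_const leb.trig_measurable)
  have phi: "\<phi> \<in> L2 \<mu>" by (rule L2_bounded[OF _ p(2)]) (simp add: measurable_circle_iff)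
  have q: "q \<in> closed_span \<mu> trig {..t}"
    unfolding q_def
    by (intro closed_span_sum[OF trig_L2_circle] closed_span_scale closed_span_generator trig_L2_circle) auto
  define N' where "N' = {u \<in> space leb_circ. \<phi> u \<noteq> q u}"
  have N': "N' \<in> sets leb_circ" unfolding N'_def by measurable
  have "AE u in leb_circ. u \<notin> N'" using eq by eventually_elim (simp add: N'_def q_def)
  then have null: "emeasure leb_circ N' = 0"
    using AE_iff_null_sets[OF N'] by (simp add: null_setsD1)
  interpret D: lebesgue_decomposition \<mu> f "N \<union> N'" by (rule enlarge_null_set[OF N' null])
  have d: "(\<lambda>u. indicator (N \<union> N') u * (\<phi> u - q u)) \<in> closed_span \<mu> trig {..t}"
    by (rule idempotent_in_remote_past[OF D.null_set_predictable])
      (auto simp: indicator_def intro!: L2_diff phi closed_spanD[OF q])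
  have "(\<lambda>u. q u + indicator (N \<union> N') u * (\<phi> u - q u)) \<in> closed_span \<mu> trig {..t}"
    by (rule closed_span_add[OF trig_L2_circle q d])
  then show ?thesis
  proof (rule closed_span_cong_AE[OF _ _ _ trig_L2_circle])
    show "AE u in \<mu>. q u + indicator (N \<union> N') u * (\<phi> u - q u) = \<phi> u"
      by (rule AE_I2) (auto simp: N'_def indicator_def)
  qed (use phi in auto)
qed

text \<open>After a shift by $-k$ with \<open>k > t\<close>, the function has only negative frequencies, so that its mean,
  the Fourier coefficient of index \<open>k\<close>, vanishes. Being real, the function has no coefficient of index
  below \<open>- t\<close> either.\<close>

lemma predictable_imp_trig_polynomial:
  assumes fin: "(\<integral>\<^sup>+u. abs_ln (f u) \<partial>leb_circ) < \<infinity>"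
    and phi: "\<phi> \<in> closed_span \<mu> trig {..t}" and C: "\<And>u. cmod (\<phi> u) \<le> C" and real: "\<And>u. cnj (\<phi> u) = \<phi> u"
  shows "\<exists>b. AE u in leb_circ. \<phi> u = (\<Sum>j \<in> {j. \<bar>j\<bar> \<le> t}. b j * trig j u)"
proof -
  have "\<phi> \<in> borel_measurable leb_circ"
    using closed_spanD[OF phi] by (auto simp: measurable_circle_iff[symmetric])
  then have pL: "\<phi> \<in> L2 leb_circ" by (rule leb.L2_bounded[OF _ C])
  have int: "integrable leb_circ (\<lambda>u. \<phi> u * trig k u)" for k
    by (rule L2_mult_integrable[OF pL leb.trig_L2_circle])
  have neg: "(\<integral>u. \<phi> u * trig (- k) u \<partial>leb_circ) = 0" if k: "k > t" for k
  proof (rule bounded_predictable_mean_zero[OF fin, where C = C])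
    have "(\<lambda>u. trig (- k) u * \<phi> u) \<in> closed_span \<mu> trig {..t + - k}" by (rule trig_shift[OF phi])
    then show "(\<lambda>u. \<phi> u * trig (- k) u) \<in> closed_span \<mu> trig {..-1}"
      using closed_span_mono[of "{..t + - k}" "{..-1}" \<mu> trig] k by (auto simp: mult.commute)
  qed (use C in \<open>simp add: norm_mult\<close>)
  have pos: "(\<integral>u. \<phi> u * trig k u \<partial>leb_circ) = 0" if k: "k > t" for k
  proof -
    have "(\<integral>u. \<phi> u * trig k u \<partial>leb_circ) = (\<integral>u. cnj (\<phi> u * trig (- k) u) \<partial>leb_circ)"
      by (simp add: real cnj_trig)
    also have "\<dots> = cnj (\<integral>u. \<phi> u * trig (- k) u \<partial>leb_circ)" by (rule Bochner_Integration.integral_cnj)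
    finally show ?thesis using neg[OF k] by simp
  qed
  define b where "b j = (\<integral>u. \<phi> u * trig (- j) u \<partial>leb_circ) / (2 * pi)" for j
  have J: "finite {j::int. \<bar>j\<bar> \<le> t}"
    by (rule finite_subset[of _ "{-t..t}"]) auto
  define d where "d u = \<phi> u - (\<Sum>j \<in> {j. \<bar>j\<bar> \<le> t}. b j * trig j u)" for u
  have dL: "d \<in> L2 leb_circ"
    unfolding d_def by (intro L2_diff pL L2_sum L2_scale leb.trig_L2_circle)
  have "(\<integral>u. d u * trig k u \<partial>leb_circ) = 0" for k
  proof -
    have it: "integrable leb_circ (\<lambda>u. b j * (trig j u * trig k u))" for j
      by (intro integrable_mult_right L2_mult_integrable leb.trig_L2_circle)
    have "(\<integral>u. d u * trig k u \<partial>leb_circ) =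
       (\<integral>u. \<phi> u * trig k u - (\<Sum>j \<in> {j. \<bar>j\<bar> \<le> t}. b j * (trig j u * trig k u)) \<partial>leb_circ)"
      by (simp add: d_def left_diff_distrib sum_distrib_right mult.assoc)
    also have "\<dots> = (\<integral>u. \<phi> u * trig k u \<partial>leb_circ) -
        (\<integral>u. (\<Sum>j \<in> {j. \<bar>j\<bar> \<le> t}. b j * (trig j u * trig k u)) \<partial>leb_circ)"
      by (intro Bochner_Integration.integral_diff int Bochner_Integration.integrable_sum it)
    also have "(\<integral>u. (\<Sum>j \<in> {j. \<bar>j\<bar> \<le> t}. b j * (trig j u * trig k u)) \<partial>leb_circ) =
       (\<Sum>j \<in> {j. \<bar>j\<bar> \<le> t}. b j * (\<integral>u. trig (j + k) u \<partial>leb_circ))"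
      by (subst Bochner_Integration.integral_sum[OF it]) (simp add: trig_mult)
    also have "\<dots> = (\<Sum>j \<in> {j. \<bar>j\<bar> \<le> t}. if j = - k then b (- k) * (2 * pi) else 0)"
      by (intro sum.cong) (auto simp: integral_trig)
    also have "\<dots> = (if \<bar>k\<bar> \<le> t then \<integral>u. \<phi> u * trig k u \<partial>leb_circ else 0)"
      using J by (simp add: b_def)
    finally have "(\<integral>u. d u * trig k u \<partial>leb_circ) = (\<integral>u. \<phi> u * trig k u \<partial>leb_circ) -
      (if \<bar>k\<bar> \<le> t then \<integral>u. \<phi> u * trig k u \<partial>leb_circ else 0)" .
    moreover have "\<bar>k\<bar> \<le> t \<or> k > t \<or> - k > t" by linarith
    ultimately show ?thesis using pos[of k] neg[of "- k"] by auto
  qed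
  from vanishing_Fourier_coefficients[OF dL this]
  show ?thesis unfolding d_def by (intro exI[of _ b]) simp
qed

end

lemma abs_cont_density_decomposition:
  assumes \<mu>: "finite_measure \<mu>" "sets \<mu> = sets leb_circ" and f: "abs_cont_density \<mu> f"
  shows "\<exists>N. lebesgue_decomposition \<mu> f N"
proof -
  interpret finite_measure \<mu> by fact
  from f obtain \<nu> N where fm: "f \<in> borel_measurable leb_circ" "\<And>u. u \<in> space leb_circ \<Longrightarrow> 0 \<le> f u"
    and N: "sets \<nu> = sets leb_circ" "N \<in> sets leb_circ" "emeasure leb_circ N = 0" "emeasure \<nu> (space leb_circ - N) = 0"
    and split: "\<And>A. A \<in> sets leb_circ \<Longrightarrow>
      emeasure \<mu> A = emeasure (density leb_circ (\<lambda>u. ennreal (f u))) A + emeasure \<nu> A"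
    unfolding abs_cont_density_def by blast
  have "lebesgue_decomposition \<mu> f N"
  proof unfold_locales
    fix A assume A: "A \<in> sets leb_circ"
    have [measurable]: "f \<in> borel_measurable leb_circ" "A \<in> sets leb_circ" "N \<in> sets leb_circ" by fact+
    have "emeasure \<nu> (A - N) \<le> emeasure \<nu> (space leb_circ - N)"
      using N(1) sets.sets_into_space[OF A] sets.Diff[OF sets.top N(2)] by (intro emeasure_mono) auto
    then have "emeasure \<mu> (A - N) = emeasure (density leb_circ (\<lambda>u. ennreal (f u))) (A - N)"
      using split[of "A - N"] A N by simp
    also have "\<dots> = emeasure (density leb_circ (\<lambda>u. ennreal (f u))) A"
      using A N fm by (intro density_Diff_null) auto
    finally show "emeasure \<mu> (A - N) = emeasure (density leb_circ (\<lambda>u. ennreal (f u))) A" .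
  qed (use \<mu> fm N in auto)
  then show ?thesis by blast
qed

theorem theorem5p3:
  fixes M :: "'a measure"
    and B :: "int \<Rightarrow> 'a \<Rightarrow> complex"
    and \<mu> :: "real measure"
    and W :: "real set \<Rightarrow> 'a \<Rightarrow> complex"
    and f\<^sub>a :: "real \<Rightarrow> real"
    and \<l> :: "real \<Rightarrow> complex"
    and t :: int
  assumes "prob_space M"
    and "wide_sense_stationary M B"
    and "spectral_measure M B \<mu>"
    and "spectral_representation M B \<mu> W"
    and "abs_cont_density \<mu> f\<^sub>a"
    and "\<l> \<in> borel_measurable leb_circ"
  shows "sigma2 M B \<mu> W \<l> t = sigma2_inf M B \<mu> W \<l> \<longleftrightarrow>
     (\<integral>\<^sup>+u. abs_ln (f\<^sub>a u) \<partial>leb_circ) = \<infinity> \<or>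
     (\<integral>\<^sup>+u. abs_ln (f\<^sub>a u) \<partial>leb_circ) < \<infinity> \<and>
     (\<exists>b :: int \<Rightarrow> complex. AE u in leb_circ.
        complex_of_real (1 / (1 + (cmod (\<l> u))\<^sup>2)) =
          (\<Sum>j \<in> {j. \<bar>j\<bar> \<le> t}. b j * cis (of_int j * u)))"
proof -
  have \<mu>: "finite_measure \<mu>" "sets \<mu> = sets leb_circ"
    using assms(3) by (auto simp: spectral_measure_def)
  interpret finite_measure \<mu> by fact
  interpret circle_measure \<mu> by unfold_locales (rule \<mu>(2))
  interpret stationary_model \<mu> M W B
    by unfold_locales (use assms(4) in \<open>auto simp: spectral_representation_def trig_def[abs_def]\<close>)
  obtain N where "lebesgue_decomposition \<mu> f\<^sub>a N"
    using abs_cont_density_decomposition[OF \<mu> assms(5)] by blast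
  then interpret lebesgue_decomposition \<mu> f\<^sub>a N .
  have \<l>: "\<l> \<in> borel_measurable \<mu>" using assms(6) by (simp add: measurable_circle_iff)
  have [measurable]: "\<l> \<in> borel_measurable leb_circ" by fact
  have wm: "wiener_filter \<l> \<in> borel_measurable leb_circ"
    unfolding wiener_filter_def[abs_def] by measurable
  then have wL: "wiener_filter \<l> \<in> L2 \<mu>"
    using wiener_filter_bounds(1) by (intro L2_bounded[where C = 1]) (auto simp: measurable_circle_iff)
  have red: "sigma2 M B \<mu> W \<l> t = sigma2_inf M B \<mu> W \<l> \<longleftrightarrow> wiener_filter \<l> \<in> closed_span \<mu> trig {..t}"
    unfolding sigma2_def sigma2_inf_def by (rule pred_error_eq_iff[OF \<l> trig_span_dense])
  show ?thesis
  proof (cases "(\<integral>\<^sup>+u. abs_ln (f\<^sub>a u) \<partial>leb_circ) = \<infinity>")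
    case True
    have "(\<lambda>u. 1 * wiener_filter \<l> u) \<in> closed_span \<mu> trig {..t}"
      by (rule idempotent_in_remote_past[OF Szego_degenerate[OF True] _ wL]) simp
    then show ?thesis using True red by simp
  next
    case False
    then have fin: "(\<integral>\<^sup>+u. abs_ln (f\<^sub>a u) \<partial>leb_circ) < \<infinity>" by (simp add: less_top[symmetric])
    have "wiener_filter \<l> \<in> closed_span \<mu> trig {..t} \<longleftrightarrow>
      (\<exists>b. AE u in leb_circ. wiener_filter \<l> u = (\<Sum>j \<in> {j. \<bar>j\<bar> \<le> t}. b j * trig j u))"
    proof
      assume "wiener_filter \<l> \<in> closed_span \<mu> trig {..t}"
      then show "\<exists>b. AE u in leb_circ. wiener_filter \<l> u = (\<Sum>j \<in> {j. \<bar>j\<bar> \<le> t}. b j * trig j u)"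
        by (rule predictable_imp_trig_polynomial[OF fin _ wiener_filter_bounds(1)]) (simp add: wiener_filter_def)
    next
      assume "\<exists>b. AE u in leb_circ. wiener_filter \<l> u = (\<Sum>j \<in> {j. \<bar>j\<bar> \<le> t}. b j * trig j u)"
      then show "wiener_filter \<l> \<in> closed_span \<mu> trig {..t}"
        using trig_polynomial_predictable[OF wm wiener_filter_bounds(1)] by blast
    qed
    with fin False red show ?thesis by (simp add: wiener_filter_def trig_def)
  qed
qed

end
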